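(* Let $n\ge 1$ and $d>1$ be integers and let $k$ be an algebraically closed field. Then every $\varphi\in\mathrm{Hom}_d^n(k)$ is a stable point of $\mathbb{P}^N$ for the conjugation action of $\mathrm{SL}(n+1)$; that is, $\mathrm{Hom}_d^n\subseteq\mathrm{Hom}_d^{n,s}$.
   Context: Let $N=\binom{n+d}{d}(n+1)-1$. The space $\mathbb{P}^N$ parametrizes tuples $(q_0:q_1:\dots:q_n)$, up to common nonzero scalar, of homogeneous polynomials of degree $d$ in the $n+1$ variables $x_0,\dots,x_n$, not all zero (the homogeneous coordinates are the coefficients of the $q_i$); such a tuple is regarded as a rational map $\varphi$ from $\mathbb{P}^n$ to itself. $\mathrm{Hom}_d^n\subset\mathbb{P}^N$ is the open subset of those $\varphi$ that are morphisms, i.e. for which $q_0,\dots,q_n$ have no common zero in $\mathbb{P}^n(\bar k)$. $\mathrm{PGL}(n+1)$ acts on $\mathbb{P}^N$ by conjugation, $A\cdot\varphi=A\varphi A^{-1}$. This action lifts to the linear action of $\mathrm{SL}(n+1)$ on $\mathbb{A}^{N+1}$ by $A\cdot\varphi=A\circ\varphi\circ A^{-1}$ on tuples $(q_0,\dots,q_n)$; stability is in the sense of geometric invariant theory with respect to this linearization. A point of $\mathbb{P}^N$ is semistable if some $\mathrm{SL}(n+1)$-invariant homogeneous polynomial of positive degree on $\mathbb{A}^{N+1}$ does not vanish at it. It is stable if it is semistable, its orbit is closed in the semistable locus, and its stabilizer is finite. Equivalently (Hilbert–Mumford), a point is stable (resp. semistable) iff for every nontrivial one-parameter subgroup of $\mathrm{SL}(n+1)$,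 after diagonalizing its action on $\mathbb{A}^{N+1}$ with diagonal entries $t^{a_I}$, at least one coordinate $I$ of a lift of the point that is nonzero has $a_I<0$ (resp. $a_I\le 0$). $\mathrm{Hom}_d^{n,s}$ denotes the stable locus in $\mathbb{P}^N$. *)

theory Defs
  imports
    "HOL-Library.Poly_Mapping"
    "HOL-Computational_Algebra.Polynomial"
    "Jordan_Normal_Form.Determinant"
    "Jordan_Normal_Form.Gauss_Jordan_Elimination"
begin

type_synonym 'v monom = "'v \<Rightarrow>\<^sub>0 nat"
type_synonym ('v, 'a) mpoly = "'v monom \<Rightarrow>\<^sub>0 'a"

definition mconst :: "'a::zero \<Rightarrow> ('v, 'a) mpoly" where
  "mconst c = Poly_Mapping.single 0 c"

definition mvar :: "'v \<Rightarrow> ('v, 'a::zero_neq_one) mpoly" where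
  "mvar v = Poly_Mapping.single (Poly_Mapping.single v 1) 1"

text \<open>
  Apply \<open>h\<close> to the coefficients and put \<open>f v\<close> for the variable \<open>v\<close>: with \<open>h = id\<close>
  this is evaluation at a point, with \<open>h = mconst\<close> it is substitution of polynomials.
\<close>
definition msubst ::
    "('a::zero \<Rightarrow> 'b::comm_semiring_1) \<Rightarrow> ('v \<Rightarrow> 'b) \<Rightarrow> ('v, 'a) mpoly \<Rightarrow> 'b" where
  "msubst h f p =
     (\<Sum>m\<in>Poly_Mapping.keys p.
        h (Poly_Mapping.lookup p m) *
        (\<Prod>v\<in>Poly_Mapping.keys m. f v ^ Poly_Mapping.lookup m v))"

abbreviation meval :: "('v \<Rightarrow> 'a::comm_semiring_1) \<Rightarrow> ('v, 'a) mpoly \<Rightarrow> 'a" where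
  "meval \<equiv> msubst id"

definition monoms :: "'v set \<Rightarrow> nat \<Rightarrow> 'v monom set" where
  "monoms V r = {m. Poly_Mapping.keys m \<subseteq> V \<and>
                    (\<Sum>v\<in>Poly_Mapping.keys m. Poly_Mapping.lookup m v) = r}"

text \<open>Homogeneous polynomials of degree \<open>r\<close> in the variables \<open>V\<close>, including 0.\<close>
definition forms :: "'v set \<Rightarrow> nat \<Rightarrow> ('v, 'a::zero) mpoly set" where
  "forms V r = {p. Poly_Mapping.keys p \<subseteq> monoms V r}"

text \<open>
  A point of the affine space of dimension \<open>N + 1\<close> is a tuple \<open>(q\<^sub>0, \<dots>, q\<^sub>n)\<close> of forms
  of degree \<open>d\<close> in the variables \<open>0, \<dots>, n\<close>.
\<close>
type_synonym 'a tuple = "(nat, 'a) mpoly vec"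

definition tuples :: "nat \<Rightarrow> nat \<Rightarrow> 'a::zero tuple set" where
  "tuples n d = {q \<in> carrier_vec (n + 1). \<forall>i<n + 1. q $ i \<in> forms {..n} d}"

definition nonzero_tuples :: "nat \<Rightarrow> nat \<Rightarrow> 'a::zero tuple set" where
  "nonzero_tuples n d = tuples n d - {0\<^sub>v (n + 1)}"

definition proj_rel :: "nat \<Rightarrow> nat \<Rightarrow> ('a::field tuple \<times> 'a tuple) set" where
  "proj_rel n d = {(q, q'). q \<in> nonzero_tuples n d \<and> q' \<in> nonzero_tuples n d \<and>
                            (\<exists>c. c \<noteq> 0 \<and> q' = mconst c \<cdot>\<^sub>v q)}"

text \<open>Projective \<open>N\<close>-space; its points are the classes of nonzero tuples up to scaling.\<close>
definition rat_maps :: "nat \<Rightarrow> nat \<Rightarrow> 'a::field tuple set set" where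
  "rat_maps n d = nonzero_tuples n d // proj_rel n d"

text \<open>
  The field is algebraically closed, so geometric common zeros are common zeros over it.
\<close>
definition Hom :: "nat \<Rightarrow> nat \<Rightarrow> 'a::alg_closed_field tuple set set" where
  "Hom n d = {\<phi> \<in> rat_maps n d. \<forall>q\<in>\<phi>.
     \<not> (\<exists>x \<in> carrier_vec (n + 1). x \<noteq> 0\<^sub>v (n + 1) \<and>
            (\<forall>i<n + 1. meval (\<lambda>j. x $ j) (q $ i) = 0))}"

text \<open>
  The homogeneous coordinates are the coefficients of the \<open>q\<^sub>i\<close>; the coordinate \<open>(i, m)\<close>
  is the coefficient of the monomial \<open>m\<close> in \<open>q\<^sub>i\<close>.
\<close>
type_synonym coord = "nat \<times> nat monom"

definition coords :: "nat \<Rightarrow> nat \<Rightarrow> coord set" where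
  "coords n d = {..n} \<times> monoms {..n} d"

definition eval_coords :: "(coord, 'a::comm_semiring_1) mpoly \<Rightarrow> 'a tuple \<Rightarrow> 'a" where
  "eval_coords F q = meval (\<lambda>(i, m). Poly_Mapping.lookup (q $ i) m) F"

definition vanishes_at :: "(coord, 'a::comm_semiring_1) mpoly \<Rightarrow> 'a tuple set \<Rightarrow> bool" where
  "vanishes_at F \<phi> \<longleftrightarrow> (\<forall>q\<in>\<phi>. eval_coords F q = 0)"

definition zariski_closed :: "nat \<Rightarrow> nat \<Rightarrow> 'a::field tuple set set \<Rightarrow> bool" where
  "zariski_closed n d Z \<longleftrightarrow>
     (\<exists>S \<subseteq> (\<Union>r. forms (coords n d) r). Z = {\<phi> \<in> rat_maps n d. \<forall>F\<in>S. vanishes_at F \<phi>})"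

definition SL :: "nat \<Rightarrow> 'a::field mat set" where
  "SL m = {A \<in> carrier_mat m m. det A = 1}"

text \<open>The tuple \<open>q(B x)\<close>, i.e. \<open>q \<circ> B\<close>.\<close>
definition precomp :: "nat \<Rightarrow> 'a::field tuple \<Rightarrow> 'a mat \<Rightarrow> 'a tuple" where
  "precomp n q B =
     map_vec (msubst mconst (\<lambda>j. \<Sum>l<n + 1. mconst (B $$ (j, l)) * mvar l)) q"

text \<open>\<open>A \<circ> q \<circ> A\<^sup>-\<^sup>1\<close>; every \<open>A\<close> in \<open>SL\<close> is invertible, so \<open>mat_inverse A\<close> is not \<open>None\<close>.\<close>
definition conj_act :: "nat \<Rightarrow> 'a::field mat \<Rightarrow> 'a tuple \<Rightarrow> 'a tuple" where
  "conj_act n A q = map_mat mconst A *\<^sub>v precomp n q (the (mat_inverse A))"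

text \<open>On a point of projective space, as a class of tuples, the action is \<open>conj_act n A ` \<phi>\<close>.\<close>
definition orbit :: "nat \<Rightarrow> 'a::field tuple set \<Rightarrow> 'a tuple set set" where
  "orbit n \<phi> = {conj_act n A ` \<phi> | A. A \<in> SL (n + 1)}"

definition stabilizer :: "nat \<Rightarrow> 'a::field tuple set \<Rightarrow> 'a mat set" where
  "stabilizer n \<phi> = {A \<in> SL (n + 1). conj_act n A ` \<phi> = \<phi>}"

definition invariant :: "nat \<Rightarrow> nat \<Rightarrow> (coord, 'a::field) mpoly \<Rightarrow> bool" where
  "invariant n d F \<longleftrightarrow>
     (\<forall>A \<in> SL (n + 1). \<forall>q \<in> tuples n d. eval_coords F (conj_act n A q) = eval_coords F q)"

text \<open>
  The base field is assumed algebraically closed from here on, so that invariance,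
  closedness and finiteness may be tested on points over the field itself.
\<close>
definition semistable_locus :: "nat \<Rightarrow> nat \<Rightarrow> 'a::alg_closed_field tuple set set" where
  "semistable_locus n d = {\<phi> \<in> rat_maps n d.
     \<exists>r>0. \<exists>F \<in> forms (coords n d) r. invariant n d F \<and> \<not> vanishes_at F \<phi>}"

definition stable_locus :: "nat \<Rightarrow> nat \<Rightarrow> 'a::alg_closed_field tuple set set" where
  "stable_locus n d = {\<phi> \<in> semistable_locus n d.
     (\<exists>Z. zariski_closed n d Z \<and> orbit n \<phi> = Z \<inter> semistable_locus n d) \<and>
     finite (stabilizer n \<phi>)}"

end

theory Submission
  imports Defs "Jordan_Normal_Form.Char_Poly"
begin

text \<open>
  Pull the forms \<open>q\<^sub>0, \<dots>, q\<^sub>n\<close> back to \<open>(P\<^sup>1)\<^sup>n\<close> along the map which sends \<open>n\<close> binary linear forms to the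
  coefficients of their product. For the multidegrees \<open>m = (d - 1, 2 d - 1, \<dots>, n d - 1)\<close> the multiplication map
  \<open>(g\<^sub>i) \<mapsto> \<Sum> g\<^sub>i q\<^sub>i\<close> from \<open>n + 1\<close> copies of \<open>O(m)\<close> to \<open>O(m + d)\<close> is square, and if the \<open>q\<^sub>i\<close> have no common zero
  it is surjective on global sections, because every line bundle in the relevant range of the Koszul complex has
  a factor without the obstructing cohomology. So its determinant \<open>F\<close> is a polynomial in the coefficients whose
  nonvanishing locus is exactly the set of morphisms. Along a transvection \<open>F\<close> is a polynomial of one parameter
  without zeros, hence constant; as transvections generate \<open>SL\<close>, \<open>F\<close> is an invariant and morphisms are semistable.

  For more than \<open>n + 1\<close> forms the same surjectivity, perturbed from one fibre, is the main theorem of elimination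
  theory. If \<open>q\<close> and \<open>q'\<close> are morphisms, the equation \<open>q'(A x) = A q(x)\<close> in the matrix \<open>A\<close> has leading part
  \<open>q'(A x)\<close> since \<open>d > 1\<close>, and this vanishes only for \<open>A = 0\<close>. So it has finitely many solutions,
  and the set of \<open>q'\<close> for which there are mutually inverse \<open>A\<close> and \<open>B\<close> with \<open>q'(A x) = A q(x)\<close> and \<open>q(B x) = B q'(x)\<close>
  is closed among morphisms. Since \<open>F\<close> cannot vanish at a semistable limit of the orbit, the orbit is closed.
\<close>

text \<open>Stability is defined by an invariant, a closed orbit and a finite stabilizer, and these
  are established directly, without the numerical criterion and in every characteristic. All three
  rest on one fact: forms without a common zero generate everything in one fixed multidegree.
  Products of lines replace n-space because a line has only two charts: its cohomology is read off
  from the exponents of monomials, and the lines can be treated one at a time. This also takes the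
  place of the Nullstellensatz: over the last line the forms are a family over the principal ideal
  domain \<open>k[t]\<close>, and induction on the number of lines gives surjectivity in each fibre.
  The multidegree grows with the index of the line so that the numbers of exponents,
  \<open>(j + 1) d\<close> and \<open>(j + 2) d\<close>, have products with quotient
  \<open>n + 1\<close>, the number of forms. The determinant has degree \<open>(n + 1)! d^n\<close>,
  which is \<open>n!\<close> times the degree of the classical resultant; the factor is the degree
  of the map from the product of lines to n-space.\<close>

abbreviation (input) lookup where "lookup \<equiv> Poly_Mapping.lookup"
abbreviation (input) single where "single \<equiv> Poly_Mapping.single"
abbreviation (input) keys where "keys \<equiv> Poly_Mapping.keys"

section \<open>Koszul complexes\<close>

text \<open>
  Chains of degree \<open>p\<close> are functions on the \<open>p\<close>-element subsets of \<open>{..<r}\<close>; the values of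
  such a function on other sets are irrelevant.
\<close>

definition ksign :: "nat \<Rightarrow> nat set \<Rightarrow> 'a::comm_ring_1" where
  "ksign i I = (- 1) ^ card {j \<in> I. j < i}"

text \<open>Contraction of an exterior form with \<open>f\<close>, on coefficients;
  \<open>khom\<close> below is the exterior product with \<open>c\<close>. As \<open>kbd\<close> at
  \<open>I\<close> reads values on larger sets, it lowers the chain degree.\<close>

definition kbd :: "nat \<Rightarrow> (nat \<Rightarrow> 'a::comm_ring_1) \<Rightarrow> (nat set \<Rightarrow> 'a) \<Rightarrow> nat set \<Rightarrow> 'a" where
  "kbd r f w I = (\<Sum>i\<in>{..<r} - I. ksign i I * f i * w (insert i I))"

definition khom :: "(nat \<Rightarrow> 'a::comm_ring_1) \<Rightarrow> (nat set \<Rightarrow> 'a) \<Rightarrow> nat set \<Rightarrow> 'a" where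
  "khom c w I = (\<Sum>i\<in>I. ksign i I * c i * w (I - {i}))"

lemma ksign_insert:
  assumes "finite I" "j \<notin> I"
  shows "ksign i (insert j I) = (if j < i then - ksign i I else (ksign i I :: 'a::comm_ring_1))"
proof -
  have "{k \<in> insert j I. k < i} = (if j < i then insert j {k \<in> I. k < i} else {k \<in> I. k < i})"
    by auto
  then show ?thesis
    using assms by (auto simp: ksign_def)
qed

lemma ksign_remove:
  assumes "finite I" "j \<in> I"
  shows "ksign i (I - {j}) = (if j < i then - ksign i I else (ksign i I :: 'a::comm_ring_1))"
  using ksign_insert[of "I - {j}" j i, where ?'a = 'a] assms by (auto simp: insert_absorb)

lemma ksign_square [simp]: "ksign i I * ksign i I = (1 :: 'a::comm_ring_1)"
  by (simp add: ksign_def flip: power_add mult_2)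

text \<open>The halves \<open>i < j\<close> and \<open>j < i\<close> are matched by exchanging the
  sums. For two successive insertions this is the reason that the differential squares to zero: both
  orders give the same set with opposite signs.\<close>

lemma sum_antisym_pairs:
  fixes T :: "nat \<Rightarrow> nat \<Rightarrow> 'a::comm_ring_1"
  assumes "finite S" "\<And>i j. i \<in> S \<Longrightarrow> j \<in> S \<Longrightarrow> i < j \<Longrightarrow> T i j + T j i = 0"
  shows "(\<Sum>i\<in>S. \<Sum>j\<in>S - {i}. T i j) = 0"
proof -
  have eq: "(\<Sum>j\<in>S - {i}. T i j) = (\<Sum>j\<in>S. if i < j then T i j else 0) + (\<Sum>j\<in>S. if j < i then T i j else 0)"
    (is "_ = ?R") if "i \<in> S" for i
  proof -
    have "?R = (\<Sum>j\<in>S. if j = i then 0 else T i j)"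
      unfolding sum.distrib[symmetric] by (intro sum.cong) auto
    also have "\<dots> = (\<Sum>j\<in>S - {i}. T i j)"
      using assms(1) by (intro sum.mono_neutral_cong_right) auto
    finally show ?thesis by simp
  qed
  have "(\<Sum>i\<in>S. \<Sum>j\<in>S - {i}. T i j) =
      (\<Sum>i\<in>S. \<Sum>j\<in>S. if i < j then T i j else 0) + (\<Sum>i\<in>S. \<Sum>j\<in>S. if j < i then T i j else 0)"
    by (simp add: eq sum.distrib)
  also have "(\<Sum>i\<in>S. \<Sum>j\<in>S. if j < i then T i j else 0) = (\<Sum>i\<in>S. \<Sum>j\<in>S. if i < j then T j i else 0)"
    by (rule sum.swap)
  also have "(\<Sum>i\<in>S. \<Sum>j\<in>S. if i < j then T i j else 0) + \<dots> =
      (\<Sum>i\<in>S. \<Sum>j\<in>S. if i < j then T i j + T j i else 0)"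
    unfolding sum.distrib[symmetric] by (intro sum.cong) auto
  also have "\<dots> = 0"
    using assms(2) by (intro sum.neutral ballI) auto
  finally show ?thesis .
qed

lemma kbd_kbd:
  assumes "finite I"
  shows "kbd r f (kbd r f w) I = 0"
proof -
  let ?S = "{..<r} - I"
  have "kbd r f (kbd r f w) I = (\<Sum>i\<in>?S. \<Sum>j\<in>?S - {i}.
      ksign i I * f i * (ksign j (insert i I) * f j * w (insert j (insert i I))))"
    unfolding kbd_def sum_distrib_left by (intro sum.cong) auto
  also have "\<dots> = 0"
  proof (rule sum_antisym_pairs)
    fix i j assume "i \<in> ?S" "j \<in> ?S" "i < j"
    then show "ksign i I * f i * (ksign j (insert i I) * f j * w (insert j (insert i I))) +
       ksign j I * f j * (ksign i (insert j I) * f i * w (insert i (insert j I))) = 0"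
      using assms by (auto simp: ksign_insert insert_commute algebra_simps)
  qed auto
  finally show ?thesis .
qed

text \<open>Contraction is an antiderivation. Terms which insert and remove the same index add up,
  over \<open>I\<close> and its complement, to the scalar product of \<open>c\<close> and
  \<open>f\<close>; terms with two different indices cancel by sign. If the scalar product is 1,
  \<open>khom c\<close> is a contracting homotopy.\<close>

lemma kbd_khom:
  assumes "I \<subseteq> {..<r}"
  shows "kbd r f (khom c w) I + khom c (kbd r f w) I = (\<Sum>i<r. c i * f i) * w I"
proof -
  let ?S = "{..<r} - I"
  have fin: "finite I" using assms finite_subset by blast
  have "kbd r f (khom c w) I = (\<Sum>i\<in>?S. ksign i I * f i * (ksign i (insert i I) * c i * w I +
      (\<Sum>j\<in>I. ksign j (insert i I) * c j * w (insert i I - {j}))))"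
    unfolding kbd_def khom_def
  proof (intro sum.cong refl)
    fix i assume i: "i \<in> ?S"
    then show "ksign i I * f i * (\<Sum>j\<in>insert i I. ksign j (insert i I) * c j * w (insert i I - {j})) =
        ksign i I * f i * (ksign i (insert i I) * c i * w I + (\<Sum>j\<in>I. ksign j (insert i I) * c j * w (insert i I - {j})))"
      using fin by (subst sum.insert) (auto)
  qed
  also have "\<dots> = (\<Sum>i\<in>?S. c i * f i * w I) +
      (\<Sum>i\<in>?S. \<Sum>j\<in>I. ksign i I * f i * (ksign j (insert i I) * c j * w (insert i I - {j})))"
    unfolding distrib_left sum.distrib sum_distrib_left
  proof (intro arg_cong2[where f = "(+)"] sum.cong refl)
    fix i assume i: "i \<in> ?S"
    have "ksign i I * f i * (ksign i (insert i I) * c i * w I) = (ksign i I * ksign i I) * (f i * c i * w I)"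
      using i fin by (simp only: ksign_insert if_False less_irrefl ac_simps DiffE)
        (simp add: ksign_insert ac_simps)
    then show "ksign i I * f i * (ksign i (insert i I) * c i * w I) = c i * f i * w I"
      by (simp add: ac_simps)
  qed
  finally have A: "kbd r f (khom c w) I = (\<Sum>i\<in>?S. c i * f i * w I) +
      (\<Sum>i\<in>?S. \<Sum>j\<in>I. ksign i I * f i * (ksign j (insert i I) * c j * w (insert i I - {j})))" .
  have "khom c (kbd r f w) I = (\<Sum>j\<in>I. ksign j I * c j * (ksign j (I - {j}) * f j * w I +
      (\<Sum>i\<in>?S. ksign i (I - {j}) * f i * w (insert i (I - {j})))))"
    unfolding kbd_def khom_def
  proof (intro sum.cong refl arg_cong2[where f = "(*)"])
    fix j assume j: "j \<in> I"
    then have "{..<r} - (I - {j}) = insert j ?S" using assms by auto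
    then show "(\<Sum>i\<in>{..<r} - (I - {j}). ksign i (I - {j}) * f i * w (insert i (I - {j}))) =
        ksign j (I - {j}) * f j * w I + (\<Sum>i\<in>?S. ksign i (I - {j}) * f i * w (insert i (I - {j})))"
      using j by (simp add: insert_absorb)
  qed
  also have "\<dots> = (\<Sum>j\<in>I. c j * f j * w I) +
      (\<Sum>j\<in>I. \<Sum>i\<in>?S. ksign j I * c j * (ksign i (I - {j}) * f i * w (insert i (I - {j}))))"
    unfolding distrib_left sum.distrib sum_distrib_left
  proof (intro arg_cong2[where f = "(+)"] sum.cong refl)
    fix j assume j: "j \<in> I"
    have "ksign j I * c j * (ksign j (I - {j}) * f j * w I) = (ksign j I * ksign j I) * (f j * c j * w I)"
      using j fin by (simp add: ksign_remove ac_simps)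
    then show "ksign j I * c j * (ksign j (I - {j}) * f j * w I) = c j * f j * w I"
      by (simp add: ac_simps)
  qed
  also have "(\<Sum>j\<in>I. \<Sum>i\<in>?S. ksign j I * c j * (ksign i (I - {j}) * f i * w (insert i (I - {j})))) =
      (\<Sum>i\<in>?S. \<Sum>j\<in>I. ksign j I * c j * (ksign i (I - {j}) * f i * w (insert i (I - {j}))))"
    by (rule sum.swap)
  also have "\<dots> = - (\<Sum>i\<in>?S. \<Sum>j\<in>I. ksign i I * f i * (ksign j (insert i I) * c j * w (insert i I - {j})))"
    unfolding sum_negf[symmetric]
  proof (intro sum.cong refl)
    fix i j assume ij: "i \<in> ?S" "j \<in> I"
    then have "insert i I - {j} = insert i (I - {j})" "i \<noteq> j" by auto
    then show "ksign j I * c j * (ksign i (I - {j}) * f i * w (insert i (I - {j}))) =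
        - (ksign i I * f i * (ksign j (insert i I) * c j * w (insert i I - {j})))"
      using ij fin by (auto simp: ksign_insert ksign_remove ac_simps)
  qed
  finally have B: "khom c (kbd r f w) I = (\<Sum>j\<in>I. c j * f j * w I) -
    (\<Sum>i\<in>?S. \<Sum>j\<in>I. ksign i I * f i * (ksign j (insert i I) * c j * w (insert i I - {j})))"
    by simp
  have "(\<Sum>i\<in>?S. c i * f i * w I) + (\<Sum>j\<in>I. c j * f j * w I) = (\<Sum>i<r. c i * f i * w I)"
    using assms by (subst sum.subset_diff[of I "{..<r}"]) auto
  then show ?thesis
    unfolding A B by (simp add: sum_distrib_right)
qed

lemma kbd_cong:
  assumes "\<And>i. i < r \<Longrightarrow> i \<notin> I \<Longrightarrow> w (insert i I) = w' (insert i I)"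
  shows "kbd r f w I = kbd r f w' I"
  unfolding kbd_def using assms by (intro sum.cong) auto

lemma kbd_add: "kbd r f (\<lambda>I. v I + w I) I = kbd r f v I + kbd r f w I"
  by (simp add: kbd_def distrib_left sum.distrib)

lemma kbd_diff: "kbd r f (\<lambda>I. v I - w I) I = kbd r f v I - kbd r f w I"
  by (simp add: kbd_def right_diff_distrib sum_subtractf)

section \<open>Laurent polynomials with bounded exponents\<close>

type_synonym 'k laurent = "(nat \<Rightarrow>\<^sub>0 int) \<Rightarrow>\<^sub>0 'k"

text \<open>
  The exponent of the \<open>j\<close>-th variable is bounded below by \<open>0\<close> if \<open>l j\<close> and above by \<open>a j\<close> if
  \<open>h j\<close>. Both bounds together describe the sections of \<open>O(a j)\<close> over the \<open>j\<close>-th projective line, one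
  of them the sections over one of its two standard charts, none the sections over their overlap.
\<close>
definition laur :: "nat \<Rightarrow> (nat \<Rightarrow> bool) \<Rightarrow> (nat \<Rightarrow> bool) \<Rightarrow> (nat \<Rightarrow> int) \<Rightarrow> 'k::zero laurent set" where
  "laur n l h a = {g. \<forall>e \<in> keys g. \<forall>j.
     if j < n then (l j \<longrightarrow> 0 \<le> lookup e j) \<and> (h j \<longrightarrow> lookup e j \<le> a j)
     else lookup e j = 0}"

abbreviation box :: "nat \<Rightarrow> (nat \<Rightarrow> int) \<Rightarrow> 'k::zero laurent set" where
  "box n a \<equiv> laur n (\<lambda>_. True) (\<lambda>_. True) a"

lemma laur_zero [simp]: "0 \<in> laur n l h a"
  by (simp add: laur_def)

lemma laur_add: "f \<in> laur n l h a \<Longrightarrow> g \<in> laur n l h a \<Longrightarrow> (f + g :: 'k::comm_ring_1 laurent) \<in> laur n l h a"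
  unfolding laur_def using Poly_Mapping.keys_add[of f g] by blast

lemma keys_uminus: "keys (- f) = keys (f :: _ \<Rightarrow>\<^sub>0 'k::ab_group_add)"
  by (auto simp: in_keys_iff)

lemma laur_uminus: "f \<in> laur n l h a \<Longrightarrow> (- f :: 'k::comm_ring_1 laurent) \<in> laur n l h a"
  unfolding laur_def by (simp add: keys_uminus)

lemma laur_diff: "f \<in> laur n l h a \<Longrightarrow> g \<in> laur n l h a \<Longrightarrow> (f - g :: 'k::comm_ring_1 laurent) \<in> laur n l h a"
  using laur_add[OF _ laur_uminus] by fastforce

lemma laur_sum: "(\<And>i. i \<in> S \<Longrightarrow> f i \<in> laur n l h a) \<Longrightarrow> (sum f S :: 'k::comm_ring_1 laurent) \<in> laur n l h a"
  by (induction S rule: infinite_finite_induct) (auto intro: laur_add)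

lemma laur_mult:
  assumes "f \<in> laur n l h a" "g \<in> laur n l h b" "\<And>j. j < n \<Longrightarrow> h j \<Longrightarrow> c j = a j + b j"
  shows "(f * g :: 'k::comm_ring_1 laurent) \<in> laur n l h c"
  unfolding laur_def
proof (intro CollectI ballI allI)
  fix e j assume "e \<in> keys (f * g)"
  then obtain e1 e2 where e: "e = e1 + e2" "e1 \<in> keys f" "e2 \<in> keys g"
    using Poly_Mapping.keys_mult[of f g] by blast
  then show "if j < n then (l j \<longrightarrow> 0 \<le> lookup e j) \<and> (h j \<longrightarrow> lookup e j \<le> c j)
     else lookup e j = 0"
    using assms unfolding laur_def by (fastforce simp: lookup_add split: if_splits)
qed

lemma laur_mono:
  assumes "f \<in> laur n l h a" "\<And>j. j < n \<Longrightarrow> l' j \<Longrightarrow> l j" "\<And>j. j < n \<Longrightarrow> h' j \<Longrightarrow> h j \<and> a j \<le> b j"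
  shows "f \<in> laur n l' h' b"
  using assms unfolding laur_def by (fastforce split: if_splits)

lemma laur_ksign: "f \<in> laur n l h a \<Longrightarrow> (ksign i I * f :: 'k::comm_ring_1 laurent) \<in> laur n l h a"
  unfolding ksign_def
  by (cases "even (card {j \<in> I. j < i})") (auto intro: laur_uminus)

lemma laur_kbd:
  assumes f: "\<And>i. i < r \<Longrightarrow> f i \<in> box n (\<lambda>_. d)"
    and w: "\<And>i. i < r \<Longrightarrow> i \<notin> I \<Longrightarrow> w (insert i I) \<in> laur n l h a" and "\<And>j. j < n \<Longrightarrow> b j = a j + d"
  shows "(kbd r f w I :: 'k::comm_ring_1 laurent) \<in> laur n l h b"
  unfolding kbd_def
proof (rule laur_sum)
  fix i assume i: "i \<in> {..<r} - I"
  have "f i \<in> laur n l h (\<lambda>_. d)" using f[of i] i by (auto intro: laur_mono)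
  then have "f i * w (insert i I) \<in> laur n l h b"
    using w[of i] i assms(3) by (auto intro!: laur_mult)
  then show "ksign i I * f i * w (insert i I) \<in> laur n l h b"
    by (simp add: laur_ksign mult.assoc)
qed

text \<open>Vanishing of the first cohomology of \<open>O(a)\<close> for \<open>a \<ge> - 1\<close>: no exponent is both negative and above \<open>a\<close>.\<close>
lemma laur_split:
  fixes x :: "'k::comm_ring_1 laurent"
  assumes "x \<in> laur n (l(m := False)) (h(m := False)) a" "m < n" "a m \<ge> - 1" "l m" "h m"
  obtains y z where "y \<in> laur n (l(m := False)) h a" "z \<in> laur n l (h(m := False)) a" "x = y + z"
proof -
  let ?N = "{e. lookup e m < 0}"
  define y where "y = Abs_poly_mapping (\<lambda>e. lookup x e when e \<in> ?N)"
  define z where "z = Abs_poly_mapping (\<lambda>e. lookup x e when e \<notin> ?N)"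
  have fin: "finite {e. (lookup x e when P e) \<noteq> 0}" for P
    by (rule finite_subset[OF _ finite_lookup[of x]]) (auto simp: when_def)
  have ly: "lookup y e = (lookup x e when e \<in> ?N)" for e
    unfolding y_def using fin[of "\<lambda>e. e \<in> ?N"] by (subst lookup_Abs_poly_mapping) auto
  have lz: "lookup z e = (lookup x e when e \<notin> ?N)" for e
    unfolding z_def using fin[of "\<lambda>e. e \<notin> ?N"] by (subst lookup_Abs_poly_mapping) auto
  show ?thesis
  proof
    show "x = y + z"
      by (rule poly_mapping_eqI) (auto simp: lookup_add ly lz when_def)
    show "y \<in> laur n (l(m := False)) h a"
      unfolding laur_def
    proof (intro CollectI ballI allI)
      fix e j assume "e \<in> keys y"
      then have e: "e \<in> keys x" "lookup e m < 0"
        by (auto simp: in_keys_iff ly when_def split: if_splits)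
      then show "if j < n then ((l(m := False)) j \<longrightarrow> 0 \<le> lookup e j) \<and> (h j \<longrightarrow> lookup e j \<le> a j)
          else lookup e j = 0"
        using assms unfolding laur_def by (cases "j = m") (auto split: if_splits)
    qed
    show "z \<in> laur n l (h(m := False)) a"
      unfolding laur_def
    proof (intro CollectI ballI allI)
      fix e j assume "e \<in> keys z"
      then have e: "e \<in> keys x" "\<not> lookup e m < 0"
        by (auto simp: in_keys_iff lz when_def split: if_splits)
      then show "if j < n then (l j \<longrightarrow> 0 \<le> lookup e j) \<and> ((h(m := False)) j \<longrightarrow> lookup e j \<le> a j)
          else lookup e j = 0"
        using assms unfolding laur_def by (cases "j = m") (auto split: if_splits)
    qed
  qed
qed

section \<open>Regularity of the Koszul complex on a product of projective lines\<close>

text \<open>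
  The degree in the \<open>j\<close>-th line of the values of \<open>p\<close>-chains. It is \<open>- 1\<close> for \<open>p = j + 2\<close>, hence at least \<open>- 1\<close>
  for all \<open>p\<close> which matter when the \<open>j\<close>-th line is glued from its charts, lines being glued in descending order.
\<close>
definition kdeg :: "int \<Rightarrow> nat \<Rightarrow> nat \<Rightarrow> int" where
  "kdeg d p j = (int j + 2) * d - 1 - int p * d"

text \<open>Exactness at the \<open>p\<close>-chains in the one multigraded piece that matters. For
  \<open>p = 0\<close> the cycle condition is vacuous, so every 0-chain has to be a combination of
  the \<open>f i\<close>.\<close>

definition kexact :: "nat \<Rightarrow> nat \<Rightarrow> int \<Rightarrow> (nat \<Rightarrow> 'k::comm_ring_1 laurent) \<Rightarrow>
    (nat \<Rightarrow> bool) \<Rightarrow> (nat \<Rightarrow> bool) \<Rightarrow> nat \<Rightarrow> bool" where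
  "kexact n r d f l h p \<longleftrightarrow> (\<forall>w.
     (\<forall>I \<subseteq> {..<r}. card I = p \<longrightarrow> w I \<in> laur n l h (kdeg d p)) \<longrightarrow>
     (\<forall>I \<subseteq> {..<r}. Suc (card I) = p \<longrightarrow> kbd r f w I = 0) \<longrightarrow>
     (\<exists>v. (\<forall>I \<subseteq> {..<r}. card I = Suc p \<longrightarrow> v I \<in> laur n l h (kdeg d (Suc p))) \<and>
          (\<forall>I \<subseteq> {..<r}. card I = p \<longrightarrow> kbd r f v I = w I)))"

lemma kexactD:
  assumes "kexact n r d f l h p"
    "\<And>I. I \<subseteq> {..<r} \<Longrightarrow> card I = p \<Longrightarrow> w I \<in> laur n l h (kdeg d p)"
    "\<And>I. I \<subseteq> {..<r} \<Longrightarrow> Suc (card I) = p \<Longrightarrow> kbd r f w I = 0"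
  obtains v where "\<And>I. I \<subseteq> {..<r} \<Longrightarrow> card I = Suc p \<Longrightarrow> v I \<in> laur n l h (kdeg d (Suc p))"
    "\<And>I. I \<subseteq> {..<r} \<Longrightarrow> card I = p \<Longrightarrow> kbd r f v I = w I"
  using assms unfolding kexact_def by metis

text \<open>A contracting homotopy raises the chain degree by one and hence must lower the
  polynomial degree by \<open>d\<close>, so the \<open>c i\<close> have degree \<open>- d\<close>.
  For \<open>d > 0\<close>, a line with both bounds would leave only zero: this is a statement about
  charts and overlaps.\<close>

lemma kexact_unit:
  fixes f :: "nat \<Rightarrow> 'k::comm_ring_1 laurent"
  assumes c: "\<And>i. i < r \<Longrightarrow> c i \<in> laur n l h (\<lambda>_. - d)" and one: "(\<Sum>i<r. c i * f i) = 1"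
  shows "kexact n r d f l h p"
  unfolding kexact_def
proof (intro allI impI)
  fix w
  assume w: "\<forall>I \<subseteq> {..<r}. card I = p \<longrightarrow> w I \<in> laur n l h (kdeg d p)"
    and cyc: "\<forall>I \<subseteq> {..<r}. Suc (card I) = p \<longrightarrow> kbd r f w I = 0"
  show "\<exists>v. (\<forall>I \<subseteq> {..<r}. card I = Suc p \<longrightarrow> v I \<in> laur n l h (kdeg d (Suc p))) \<and>
          (\<forall>I \<subseteq> {..<r}. card I = p \<longrightarrow> kbd r f v I = w I)"
  proof (intro exI[of _ "khom c w"] conjI allI impI)
    fix I assume I: "I \<subseteq> {..<r}" "card I = Suc p"
    show "khom c w I \<in> laur n l h (kdeg d (Suc p))"
      unfolding khom_def
    proof (rule laur_sum)
      fix i assume i: "i \<in> I"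
      then have "w (I - {i}) \<in> laur n l h (kdeg d p)"
        using w[rule_format, of "I - {i}"] I finite_subset[OF I(1)] by (auto simp: card_Diff_singleton)
      then have "c i * w (I - {i}) \<in> laur n l h (kdeg d (Suc p))"
        using c[of i] i I by (intro laur_mult) (auto simp: kdeg_def algebra_simps)
      then show "ksign i I * c i * w (I - {i}) \<in> laur n l h (kdeg d (Suc p))"
        by (simp add: laur_ksign mult.assoc)
    qed
  next
    fix I assume I: "I \<subseteq> {..<r}" "card I = p"
    then have fin: "finite I" using finite_subset by blast
    have "khom c (kbd r f w) I = 0"
      unfolding khom_def
    proof (intro sum.neutral ballI)
      fix i assume i: "i \<in> I"
      then have "Suc (card (I - {i})) = p"
        using card_Suc_Diff1[OF fin i] I by simp
      then have "kbd r f w (I - {i}) = 0"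
        using cyc[rule_format, of "I - {i}"] I(1) by blast
      then show "ksign i I * c i * kbd r f w (I - {i}) = 0" by simp
    qed
    then show "kbd r f (khom c w) I = w I"
      using kbd_khom[OF I(1), of f c w] one by simp
  qed
qed

text \<open>
  One step of the computation of the cohomology of a product of lines: exactness over the two charts
  of the \<open>m\<close>-th line and over their overlap gives exactness over the whole line.
\<close>
lemma kexact_glue:
  fixes f :: "nat \<Rightarrow> 'k::comm_ring_1 laurent"
  assumes f: "\<And>i. i < r \<Longrightarrow> f i \<in> box n (\<lambda>_. d)" and m: "m < n" "l m" "h m" and p: "p \<le> m" and d: "d \<ge> 0"
    and lo: "kexact n r d f (l(m := False)) h p" and hi: "kexact n r d f l (h(m := False)) p"
    and lh: "kexact n r d f (l(m := False)) (h(m := False)) (Suc p)"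
  shows "kexact n r d f l h p"
  unfolding kexact_def
proof (intro allI impI)
  let ?l = "l(m := False)" and ?h = "h(m := False)"
  fix w
  assume w: "\<forall>I \<subseteq> {..<r}. card I = p \<longrightarrow> w I \<in> laur n l h (kdeg d p)"
    and cyc: "\<forall>I \<subseteq> {..<r}. Suc (card I) = p \<longrightarrow> kbd r f w I = 0"
  obtain v where v: "\<And>I. I \<subseteq> {..<r} \<Longrightarrow> card I = Suc p \<Longrightarrow> v I \<in> laur n ?l h (kdeg d (Suc p))"
    "\<And>I. I \<subseteq> {..<r} \<Longrightarrow> card I = p \<Longrightarrow> kbd r f v I = w I"
  proof (rule kexactD[OF lo, of w])
    show "w I \<in> laur n ?l h (kdeg d p)" if "I \<subseteq> {..<r}" "card I = p" for I
      by (rule laur_mono[of _ n l h "kdeg d p"]) (use w that in \<open>auto split: if_splits\<close>)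
  qed (use cyc in auto)
  obtain v' where v': "\<And>I. I \<subseteq> {..<r} \<Longrightarrow> card I = Suc p \<Longrightarrow> v' I \<in> laur n l ?h (kdeg d (Suc p))"
    "\<And>I. I \<subseteq> {..<r} \<Longrightarrow> card I = p \<Longrightarrow> kbd r f v' I = w I"
  proof (rule kexactD[OF hi, of w])
    show "w I \<in> laur n l ?h (kdeg d p)" if "I \<subseteq> {..<r}" "card I = p" for I
      by (rule laur_mono[of _ n l h "kdeg d p"]) (use w that in \<open>auto split: if_splits\<close>)
  qed (use cyc in auto)
  \<comment> \<open>Over the overlap, the two local solutions differ by a cycle of chain degree
    \<open>p + 1\<close>, which is a boundary there.\<close>
  obtain x where x: "\<And>I. I \<subseteq> {..<r} \<Longrightarrow> card I = Suc (Suc p) \<Longrightarrow> x I \<in> laur n ?l ?h (kdeg d (Suc (Suc p)))"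
    "\<And>I. I \<subseteq> {..<r} \<Longrightarrow> card I = Suc p \<Longrightarrow> kbd r f x I = v I - v' I"
  proof (rule kexactD[OF lh, of "\<lambda>I. v I - v' I"])
    show "v I - v' I \<in> laur n ?l ?h (kdeg d (Suc p))" if I: "I \<subseteq> {..<r}" "card I = Suc p" for I
    proof (rule laur_diff)
      show "v I \<in> laur n ?l ?h (kdeg d (Suc p))"
        using v(1)[OF I] by (rule laur_mono) (auto split: if_splits)
      show "v' I \<in> laur n ?l ?h (kdeg d (Suc p))"
        using v'(1)[OF I] by (rule laur_mono) (auto split: if_splits)
    qed
    show "kbd r f (\<lambda>I. v I - v' I) I = 0" if "I \<subseteq> {..<r}" "Suc (card I) = Suc p" for I
      using that v(2) v'(2) by (simp add: kbd_diff)
  qed auto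
  \<comment> \<open>The chain \<open>x\<close> lives in degree \<open>p + 2\<close>, where the
    degree on the line \<open>m\<close> is \<open>(m - p) d - 1\<close>. Here
    \<open>p \<le> m\<close> enters.\<close>
  have a: "kdeg d (Suc (Suc p)) m \<ge> - 1"
  proof -
    have "kdeg d (Suc (Suc p)) m = (int m - int p) * d - 1"
      by (simp add: kdeg_def algebra_simps)
    moreover have "(int m - int p) * d \<ge> 0"
      using p d by simp
    ultimately show ?thesis by linarith
  qed
  have "\<exists>y z. y \<in> laur n ?l h (kdeg d (Suc (Suc p))) \<and> z \<in> laur n l ?h (kdeg d (Suc (Suc p))) \<and> x I = y + z"
    if "I \<subseteq> {..<r}" "card I = Suc (Suc p)" for I
    using laur_split[OF x(1)[OF that] m(1) a m(2,3)] by metis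
  then obtain y z where yz: "\<And>I. I \<subseteq> {..<r} \<Longrightarrow> card I = Suc (Suc p) \<Longrightarrow> y I \<in> laur n ?l h (kdeg d (Suc (Suc p)))"
    "\<And>I. I \<subseteq> {..<r} \<Longrightarrow> card I = Suc (Suc p) \<Longrightarrow> z I \<in> laur n l ?h (kdeg d (Suc (Suc p)))"
    "\<And>I. I \<subseteq> {..<r} \<Longrightarrow> card I = Suc (Suc p) \<Longrightarrow> x I = y I + z I"
    by metis
  have card_ins: "insert i I \<subseteq> {..<r} \<and> card (insert i I) = Suc (card I)" if "I \<subseteq> {..<r}" "i < r" "i \<notin> I" for i I
    using that finite_subset[OF that(1)] by auto
  have kx: "kbd r f x I = kbd r f y I + kbd r f z I" if "I \<subseteq> {..<r}" "card I = Suc p" for I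
  proof -
    have "kbd r f x I = kbd r f (\<lambda>I. y I + z I) I"
      using card_ins[OF that(1)] that by (intro kbd_cong yz(3)) auto
    then show ?thesis by (simp add: kbd_add)
  qed
  \<comment> \<open>The Cech correction: \<open>u\<close> is \<open>v\<close> minus a boundary over
    one chart and equals \<open>v'\<close> plus a boundary over the other, so it obeys both
    bounds.\<close>
  define u where "u I = v I - kbd r f y I" for I
  have u': "u I = v' I + kbd r f z I" if "I \<subseteq> {..<r}" "card I = Suc p" for I
    using x(2)[OF that] kx[OF that] by (simp add: u_def algebra_simps)
  have ky: "kbd r f y I \<in> laur n ?l h (kdeg d (Suc p))" "kbd r f z I \<in> laur n l ?h (kdeg d (Suc p))"
    if "I \<subseteq> {..<r}" "card I = Suc p" for I
    by (rule laur_kbd[where a = "kdeg d (Suc (Suc p))" and d = d];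
        use f yz(1,2) card_ins[OF that(1)] that in \<open>auto simp: kdeg_def algebra_simps\<close>)+
  show "\<exists>v. (\<forall>I \<subseteq> {..<r}. card I = Suc p \<longrightarrow> v I \<in> laur n l h (kdeg d (Suc p))) \<and>
          (\<forall>I \<subseteq> {..<r}. card I = p \<longrightarrow> kbd r f v I = w I)"
  proof (intro exI[of _ u] conjI allI impI)
    fix I assume I: "I \<subseteq> {..<r}" "card I = Suc p"
    have "u I \<in> laur n ?l h (kdeg d (Suc p))"
      unfolding u_def using v(1)[OF I] ky(1)[OF I] by (rule laur_diff)
    moreover have "u I \<in> laur n l ?h (kdeg d (Suc p))"
      unfolding u'[OF I] using v'(1)[OF I] ky(2)[OF I] by (rule laur_add)
    ultimately show "u I \<in> laur n l h (kdeg d (Suc p))"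
      unfolding laur_def by (auto split: if_splits)
  next
    fix I assume I: "I \<subseteq> {..<r}" "card I = p"
    then have "finite I" using finite_subset by blast
    then show "kbd r f u I = w I"
      unfolding u_def kbd_diff using v(2)[OF I] by (simp add: kbd_kbd)
  qed
qed

text \<open>The forms \<open>f\<close> generate the unit ideal on each of the \<open>2\<^sup>n\<close> standard affine charts.\<close>
definition chart_units :: "nat \<Rightarrow> nat \<Rightarrow> int \<Rightarrow> (nat \<Rightarrow> 'k::comm_ring_1 laurent) \<Rightarrow> bool" where
  "chart_units n r d f \<longleftrightarrow> (\<forall>h. \<exists>c. (\<forall>i<r. c i \<in> laur n (\<lambda>j. \<not> h j) h (\<lambda>_. - d)) \<and> (\<Sum>i<r. c i * f i) = 1)"

text \<open>Induction on the number \<open>n - m\<close> of whole lines. Gluing the line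
  \<open>m\<close> asks for chain degree \<open>p\<close> on its charts and \<open>p + 1\<close> on
  the overlap, with \<open>m + 1\<close> lines now local, so \<open>p \<le> m\<close> persists. When
  all lines are local, the unit combination over a chart also serves on overlaps, where fewer bounds
  are imposed.\<close>

lemma kexact_partial:
  fixes f :: "nat \<Rightarrow> 'k::comm_ring_1 laurent"
  assumes f: "\<And>i. i < r \<Longrightarrow> f i \<in> box n (\<lambda>_. d)" and d: "d \<ge> 0" and u: "chart_units n r d f"
    and "m \<le> n" "p \<le> m" "\<And>j. j < m \<Longrightarrow> \<not> (l j \<and> h j)" "\<And>j. m \<le> j \<Longrightarrow> j < n \<Longrightarrow> l j \<and> h j"
  shows "kexact n r d f l h p"
  using assms(4-)
proof (induction "n - m" arbitrary: m p l h)
  case 0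
  obtain c where c: "\<And>i. i < r \<Longrightarrow> c i \<in> laur n (\<lambda>j. \<not> h j) h (\<lambda>_. - d)" "(\<Sum>i<r. c i * f i) = 1"
    using u unfolding chart_units_def by blast
  show ?case
  proof (rule kexact_unit[OF _ c(2)])
    show "c i \<in> laur n l h (\<lambda>_. - d)" if "i < r" for i
      using c(1)[OF that] 0 by (auto intro: laur_mono)
  qed
next
  case (Suc k)
  have IH: "kexact n r d f l' h' p'"
    if "p' \<le> Suc m" "\<And>j. j < Suc m \<Longrightarrow> \<not> (l' j \<and> h' j)" "\<And>j. Suc m \<le> j \<Longrightarrow> j < n \<Longrightarrow> l' j \<and> h' j" for l' h' p'
    using Suc.hyps(2) that by (intro Suc.hyps(1)[of "Suc m"]) auto
  from Suc.hyps(2) Suc.prems have m: "m < n" "l m" "h m" by auto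
  show ?case
  proof (rule kexact_glue[where r = r and d = d and f = f and l = l and h = h and m = m, OF _ m Suc.prems(2) d])
    show "kexact n r d f (l(m := False)) h p" "kexact n r d f l (h(m := False)) p"
      "kexact n r d f (l(m := False)) (h(m := False)) (Suc p)"
      using Suc.prems by (intro IH; auto simp: less_Suc_eq)+
  qed (use f in auto)
qed

section \<open>Surjectivity on global sections\<close>

definition top_deg :: "int \<Rightarrow> nat \<Rightarrow> int" where
  "top_deg d j = (int j + 2) * d - 1"

definition sub_deg :: "int \<Rightarrow> nat \<Rightarrow> int" where
  "sub_deg d j = (int j + 1) * d - 1"

definition full_image :: "nat \<Rightarrow> nat \<Rightarrow> int \<Rightarrow> (nat \<Rightarrow> 'k::comm_ring_1 laurent) \<Rightarrow> bool" where
  "full_image n r d f \<longleftrightarrow>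
     (\<forall>g \<in> box n (top_deg d). \<exists>v. (\<forall>i<r. v i \<in> box n (sub_deg d)) \<and> (\<Sum>i<r. v i * f i) = g)"

text \<open>The case \<open>p = 0\<close> with no line local: a 0-chain is a single section, and a
  1-chain is a family of multipliers indexed by singletons.\<close>

lemma full_image_if_chart_units:
  fixes f :: "nat \<Rightarrow> 'k::comm_ring_1 laurent"
  assumes "\<And>i. i < r \<Longrightarrow> f i \<in> box n (\<lambda>_. d)" "d \<ge> 0" "chart_units n r d f"
  shows "full_image n r d f"
  unfolding full_image_def
proof
  fix g :: "'k laurent" assume g: "g \<in> box n (top_deg d)"
  have deg: "kdeg d 0 = top_deg d" "kdeg d (Suc 0) = sub_deg d"
    by (auto simp: fun_eq_iff kdeg_def top_deg_def sub_deg_def algebra_simps)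
  have "kexact n r d f (\<lambda>_. True) (\<lambda>_. True) 0"
    by (rule kexact_partial[OF assms, of 0]) auto
  then obtain v where v: "\<And>I. I \<subseteq> {..<r} \<Longrightarrow> card I = Suc 0 \<Longrightarrow> v I \<in> box n (sub_deg d)"
    "\<And>I. I \<subseteq> {..<r} \<Longrightarrow> card I = 0 \<Longrightarrow> kbd r f v I = g"
    by (rule kexactD[where w = "\<lambda>_. g"]) (use g in \<open>auto simp: deg\<close>)
  from v(2)[of "{}"] have "(\<Sum>i<r. v {i} * f i) = g"
    by (simp add: kbd_def ksign_def mult.commute)
  then show "\<exists>v. (\<forall>i<r. v i \<in> box n (sub_deg d)) \<and> (\<Sum>i<r. v i * f i) = g"
    using v(1) by (intro exI[of _ "\<lambda>i. v {i}"]) auto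
qed

section \<open>Surjectivity from the absence of common zeros\<close>

abbreviation lcst :: "'k::zero \<Rightarrow> 'k laurent" where
  "lcst \<equiv> single 0"

lemma lcst_hom: "comm_ring_hom (lcst :: 'k::comm_ring_1 \<Rightarrow> _)"
  by unfold_locales (auto simp: single_add mult_single)

lemma lcst_power: "lcst (c ^ k) = (lcst c :: 'k::comm_ring_1 laurent) ^ k"
proof (induction k)
  case (Suc k)
  have "lcst (c ^ Suc k) = lcst c * lcst (c ^ k)"
    by (simp add: mult_single)
  then show ?case by (simp add: Suc)
qed simp

lemma single_in_laur:
  assumes "\<And>j. j < n \<Longrightarrow> l j \<Longrightarrow> 0 \<le> lookup e j"
    "\<And>j. j < n \<Longrightarrow> h j \<Longrightarrow> lookup e j \<le> a j"
    "\<And>j. n \<le> j \<Longrightarrow> lookup e j = 0"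
  shows "single e (c::'k::zero) \<in> laur n l h a"
  using assms by (auto simp: laur_def)

lemma lcst_in_laur [simp]: "(\<And>j. j < n \<Longrightarrow> h j \<Longrightarrow> 0 \<le> a j) \<Longrightarrow> lcst c \<in> laur n l h a"
  by (rule single_in_laur) auto

lemma laur_lcst_mult: "f \<in> laur n l h a \<Longrightarrow> (lcst c * f :: 'k::comm_ring_1 laurent) \<in> laur n l h a"
  by (rule laur_mult[where a = "\<lambda>_. 0"]) auto

lemma lookup_lcst_mult: "lookup (lcst c * f) e = (c::'k::comm_ring_1) * lookup f e"
proof -
  have "lcst c * f = Poly_Mapping.map ((*) c) f"
    by (simp add: mult_map_scale_conv_mult)
  then show ?thesis
    by (simp add: map.rep_eq when_def)
qed

lemma laur_extend:
  assumes "f \<in> laur n l h a" "\<And>j. j < n \<Longrightarrow> l' j \<Longrightarrow> l j" "\<And>j. j < n \<Longrightarrow> h' j \<Longrightarrow> h j \<and> a j \<le> b j"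
    "h' n \<Longrightarrow> 0 \<le> b n"
  shows "f \<in> laur (Suc n) l' h' b"
  unfolding laur_def
proof (intro CollectI ballI allI)
  fix e j assume "e \<in> keys f"
  then have "\<forall>j. if j < n then (l j \<longrightarrow> 0 \<le> lookup e j) \<and> (h j \<longrightarrow> lookup e j \<le> a j)
     else lookup e j = 0"
    using assms(1) by (auto simp: laur_def)
  then show "if j < Suc n then (l' j \<longrightarrow> 0 \<le> lookup e j) \<and> (h' j \<longrightarrow> lookup e j \<le> b j)
     else lookup e j = 0"
    using assms(2-4) by (cases "j < n"; cases "j = n") (fastforce dest: spec[of _ j])+
qed

subsection \<open>The monomial basis\<close>

definition box_exps :: "nat \<Rightarrow> (nat \<Rightarrow> int) \<Rightarrow> (nat \<Rightarrow>\<^sub>0 int) set" where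
  "box_exps n a = {e. \<forall>j. if j < n then 0 \<le> lookup e j \<and> lookup e j \<le> a j
     else lookup e j = 0}"

lemma box_exps_bij:
  "bij_betw (\<lambda>e. \<lambda>j\<in>{..<n}. lookup e j) (box_exps n a) (PiE {..<n} (\<lambda>j. {0..a j}))"
proof (rule bij_betwI')
  fix e e' assume e: "e \<in> box_exps n a" "e' \<in> box_exps n a"
  have "e = e'" if eq: "(\<lambda>j\<in>{..<n}. lookup e j) = (\<lambda>j\<in>{..<n}. lookup e' j)"
  proof (rule poly_mapping_eqI)
    fix j
    have "lookup e j = lookup e' j" if "j < n"
      using fun_cong[OF eq, of j] that by simp
    moreover have "lookup e j = lookup e' j" if "\<not> j < n"
      using e that unfolding box_exps_def by (metis (mono_tags, lifting) mem_Collect_eq)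
    ultimately show "lookup e j = lookup e' j" by blast
  qed
  then show "((\<lambda>j\<in>{..<n}. lookup e j) = (\<lambda>j\<in>{..<n}. lookup e' j)) = (e = e')"
    by auto
next
  fix e assume "e \<in> box_exps n a"
  then show "(\<lambda>j\<in>{..<n}. lookup e j) \<in> PiE {..<n} (\<lambda>j. {0..a j})"
    by (auto simp: box_exps_def)
next
  fix x assume x: "x \<in> PiE {..<n} (\<lambda>j. {0..a j})"
  define e where "e = Abs_poly_mapping (\<lambda>j. if j < n then x j else 0)"
  have l: "lookup e = (\<lambda>j. if j < n then x j else 0)"
    unfolding e_def by (rule lookup_Abs_poly_mapping) (rule finite_subset[of _ "{..<n}"], auto)
  show "\<exists>e\<in>box_exps n a. x = (\<lambda>j\<in>{..<n}. lookup e j)"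
  proof
    have "x j \<in> {0..a j}" if "j < n" for j
      by (rule PiE_mem[OF x]) (use that in simp)
    then show "e \<in> box_exps n a"
      by (simp add: box_exps_def l)
    show "x = (\<lambda>j\<in>{..<n}. lookup e j)"
    proof
      fix j show "x j = (\<lambda>j\<in>{..<n}. lookup e j) j"
        using PiE_arb[OF x, of j] by (simp add: l)
    qed
  qed
qed

lemma finite_box_exps: "finite (box_exps n a)"
  using bij_betw_finite[OF box_exps_bij[of n a]] by (simp add: finite_PiE)

lemma card_box_exps: "card (box_exps n a) = (\<Prod>j<n. nat (a j + 1))"
  using bij_betw_same_card[OF box_exps_bij[of n a]] by (simp add: card_PiE)

lemma keys_box: "g \<in> box n a \<longleftrightarrow> keys g \<subseteq> box_exps n a"
  by (auto simp: laur_def box_exps_def split: if_splits)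

lemma sum_singles:
  assumes "finite S" "keys g \<subseteq> S"
  shows "(\<Sum>e\<in>S. single e (lookup g e)) = (g :: _ \<Rightarrow>\<^sub>0 'k::comm_ring_1)"
proof (rule poly_mapping_eqI)
  fix e
  have "lookup (\<Sum>e\<in>S. single e (lookup g e)) e =
      (\<Sum>e'\<in>S. if e' = e then lookup g e else 0)"
    unfolding lookup_sum by (intro sum.cong) (auto simp: lookup_single when_def)
  also have "\<dots> = lookup g e"
    using assms by (auto simp: in_keys_iff)
  finally show "lookup (\<Sum>e\<in>S. single e (lookup g e)) e = lookup g e" .
qed

lemma box_expand:
  assumes "g \<in> box n a" "bij_betw eb {..<D} (box_exps n a)"
  shows "(\<Sum>c<D. lcst (lookup g (eb c)) * single (eb c) 1) = (g :: 'k::comm_ring_1 laurent)"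
proof -
  have "(\<Sum>c<D. lcst (lookup g (eb c)) * single (eb c) 1) =
      (\<Sum>e\<in>box_exps n a. single e (lookup g e))"
    by (subst sum.reindex_bij_betw[OF assms(2), symmetric]) (simp add: mult_single)
  also have "\<dots> = g"
    using assms(1) by (intro sum_singles) (auto simp: finite_box_exps keys_box)
  finally show ?thesis .
qed

lemma single_in_box: "e \<in> box_exps n a \<Longrightarrow> single e c \<in> box n a"
  by (auto simp: keys_box)

text \<open>Cramer's rule, carried along a ring homomorphism. It is used twice: the determinant
  multiplies each basis monomial into the span of the columns, and a functional that kills all
  columns is killed by the determinant.\<close>

lemma adj_mat_vec:
  assumes M: "M \<in> carrier_mat D D" and hom: "comm_ring_hom \<phi>" and c: "c < D"
  shows "(\<Sum>b<D. \<phi> (adj_mat M $$ (b, c)) * (\<Sum>c'<D. \<phi> (M $$ (c', b)) * x c')) = \<phi> (det M) * x c"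
proof -
  interpret comm_ring_hom \<phi> by (rule hom)
  have adj: "adj_mat M \<in> carrier_mat D D" "M * adj_mat M = det M \<cdot>\<^sub>m 1\<^sub>m D"
    using adj_mat[OF M] by auto
  have entry: "(\<Sum>b<D. M $$ (c', b) * adj_mat M $$ (b, c)) = (if c' = c then det M else 0)" if "c' < D" for c'
  proof -
    have "(M * adj_mat M) $$ (c', c) = (\<Sum>b<D. M $$ (c', b) * adj_mat M $$ (b, c))"
      using M adj(1) that c by (simp add: scalar_prod_def lessThan_atLeast0)
    then show ?thesis unfolding adj(2) using that c by auto
  qed
  have "(\<Sum>b<D. \<phi> (adj_mat M $$ (b, c)) * (\<Sum>c'<D. \<phi> (M $$ (c', b)) * x c')) =
      (\<Sum>c'<D. \<Sum>b<D. \<phi> (M $$ (c', b) * adj_mat M $$ (b, c)) * x c')"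
    unfolding sum_distrib_left by (subst sum.swap) (simp add: hom_mult ac_simps)
  also have "\<dots> = (\<Sum>c'<D. \<phi> (\<Sum>b<D. M $$ (c', b) * adj_mat M $$ (b, c)) * x c')"
    by (simp add: hom_sum sum_distrib_right)
  also have "\<dots> = (\<Sum>c'<D. if c' = c then \<phi> (det M) * x c else 0)"
    by (intro sum.cong) (auto simp: entry)
  finally show ?thesis using c by simp
qed

subsection \<open>Families over the affine line\<close>

lemma poly_map_lookup:
  "poly (map_poly (\<lambda>g. lookup g e) W) p = lookup (poly W (lcst p)) e"
  for W :: "'k::comm_ring_1 laurent poly"
  by (induction W) (simp_all add: map_poly_pCons lookup_add lookup_lcst_mult)

text \<open>
  If the combinations of the \<open>P i\<close> reach every monomial after every specialisation of the parameter, then the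
  ideal of those parameter polynomials which multiply \<open>\<mu>\<close> into the combinations has no zero:
  near a point of the line, the determinant of a matrix which is the identity at that point belongs to it.
\<close>
lemma full_image_over_line:
  fixes P :: "nat \<Rightarrow> 'k::alg_closed_field laurent poly"
  assumes P: "\<And>i k. i < r \<Longrightarrow> coeff (P i) k \<in> box n (\<lambda>_. d)"
    and full: "\<And>p. full_image n r d (\<lambda>i. poly (P i) (lcst p))"
    and mu: "\<mu> \<in> box n (top_deg d)"
  obtains V where "\<And>i k. i < r \<Longrightarrow> coeff (V i) k \<in> box n (sub_deg d)" "(\<Sum>i<r. V i * P i) = [:\<mu>:]"
proof -
  interpret lc: comm_ring_hom "lcst :: 'k \<Rightarrow> 'k laurent" by (rule lcst_hom)
  interpret lp: map_poly_comm_ring_hom "lcst :: 'k \<Rightarrow> 'k laurent" ..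
  define \<kappa> where "\<kappa> = map_poly (lcst :: 'k \<Rightarrow> 'k laurent)"
  have \<kappa>hom: "comm_ring_hom \<kappa>"
    unfolding \<kappa>_def ..
  interpret K: comm_ring_hom \<kappa> by (rule \<kappa>hom)
  have \<kappa>c: "\<kappa> [:a:] = [:lcst a:]" for a
    by (simp add: \<kappa>_def lc.map_poly_pCons_hom)
  define good where "good V \<longleftrightarrow> (\<forall>i<r. \<forall>k. coeff (V i) k \<in> box n (sub_deg d))" for V :: "nat \<Rightarrow> 'k laurent poly"
  \<comment> \<open>\<open>J\<close> is a module over the parameter polynomials, acting through
    \<open>\<kappa>\<close>, but it is not an ideal, because the multipliers have bounded
    degree.\<close>
  define J where "J = {X. \<exists>V. good V \<and> X = (\<Sum>i<r. V i * P i)}"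
  have J_add: "X + Y \<in> J" if XY: "X \<in> J" "Y \<in> J" for X Y
  proof -
    obtain V W where "good V" "X = (\<Sum>i<r. V i * P i)" "good W" "Y = (\<Sum>i<r. W i * P i)"
      using XY unfolding J_def by blast
    then show ?thesis unfolding J_def
      by (intro CollectI exI[of _ "\<lambda>i. V i + W i"]) (auto simp: good_def laur_add distrib_right sum.distrib)
  qed
  have J_scale: "\<kappa> q * X \<in> J" if X: "X \<in> J" for X q
  proof -
    obtain V where V: "good V" "X = (\<Sum>i<r. V i * P i)"
      using X unfolding J_def by blast
    have "good (\<lambda>i. \<kappa> q * V i)"
      using V(1) unfolding good_def \<kappa>_def
      by (auto simp: coeff_mult coeff_map_poly intro!: laur_sum laur_lcst_mult)
    then show ?thesis unfolding J_def V(2)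
      by (intro CollectI exI[of _ "\<lambda>i. \<kappa> q * V i"]) (auto simp: sum_distrib_left mult.assoc)
  qed
  have J_0: "0 \<in> J"
    unfolding J_def by (intro CollectI exI[of _ "\<lambda>_. 0"]) (auto simp: good_def)
  have J_sum: "sum X S \<in> J" if "\<And>i. i \<in> S \<Longrightarrow> X i \<in> J" for X and S :: "nat set"
    using that by (induction S rule: infinite_finite_induct) (auto intro: J_0 J_add)
  define D where "D = card (box_exps n (top_deg d))"
  obtain eb where eb: "bij_betw eb {..<D} (box_exps n (top_deg d))"
    unfolding D_def using ex_bij_betw_nat_finite[OF finite_box_exps] by (metis lessThan_atLeast0)
  have eb_in: "eb c \<in> box_exps n (top_deg d)" if "c < D" for c
    using eb that by (auto simp: bij_betw_def)
  have eb_inj: "eb c = eb b \<longleftrightarrow> c = b" if "c < D" "b < D" for c b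
    using eb that by (auto simp: bij_betw_def inj_on_def)
  have local_mult: "\<exists>\<delta>. poly \<delta> p = 1 \<and> \<kappa> \<delta> * [:\<mu>:] \<in> J" for p
  proof -
    \<comment> \<open>Multipliers that reach the monomials at the parameter \<open>p\<close> are
      kept constant while the parameter varies. The matrix \<open>M\<close> of the resulting
      combinations is then the identity at \<open>p\<close>.\<close>
    have "\<forall>b\<in>{..<D}. \<exists>v. (\<forall>i<r. v i \<in> box n (sub_deg d)) \<and>
        (\<Sum>i<r. v i * poly (P i) (lcst p)) = single (eb b) 1"
      using full[of p] single_in_box[OF eb_in] unfolding full_image_def by blast
    from bchoice[OF this] obtain v where v: "\<And>b i. b < D \<Longrightarrow> i < r \<Longrightarrow> v b i \<in> box n (sub_deg d)"
      "\<And>b. b < D \<Longrightarrow> (\<Sum>i<r. v b i * poly (P i) (lcst p)) = single (eb b) 1"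
      by auto
    define W where "W b = (\<Sum>i<r. [:v b i:] * P i)" for b
    define M where "M = mat D D (\<lambda>(c, b). map_poly (\<lambda>g. lookup g (eb c)) (W b))"
    have M: "M \<in> carrier_mat D D" by (simp add: M_def)
    have WJ: "W b \<in> J" if "b < D" for b
      unfolding J_def W_def using v(1)[OF that]
      by (intro CollectI exI[of _ "\<lambda>i. [:v b i:]"]) (auto simp: good_def coeff_pCons split: nat.splits)
    have Wexp: "(\<Sum>c<D. \<kappa> (M $$ (c, b)) * [:single (eb c) 1:]) = W b" if b: "b < D" for b
    proof (rule poly_eqI)
      fix k
      have "coeff (W b) k \<in> box n (top_deg d)"
        unfolding W_def coeff_sum
        using v(1)[OF b] P by (auto intro!: laur_sum laur_mult[where a = "sub_deg d" and b = "\<lambda>_. d"]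
            simp: sub_deg_def top_deg_def algebra_simps)
      from box_expand[OF this eb]
      show "coeff (\<Sum>c<D. \<kappa> (M $$ (c, b)) * [:single (eb c) 1:]) k = coeff (W b) k"
        unfolding coeff_sum using b by (simp add: \<kappa>_def M_def coeff_map_poly mult.commute)
    qed
    have ev: "comm_ring_hom (\<lambda>q. poly q p)" by unfold_locales auto
    have "map_mat (\<lambda>q. poly q p) M = 1\<^sub>m D"
    proof (rule eq_matI)
      fix c b assume cb: "c < dim_row (1\<^sub>m D :: 'k mat)" "b < dim_col (1\<^sub>m D :: 'k mat)"
      have "poly (W b) (lcst p) = single (eb b) 1"
        unfolding W_def poly_sum using v(2)[of b] cb by simp
      then show "map_mat (\<lambda>q. poly q p) M $$ (c, b) = 1\<^sub>m D $$ (c, b)"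
        using cb eb_inj[of b c] by (auto simp: M_def poly_map_lookup lookup_single when_def)
    qed (auto simp: M_def)
    then have det1: "poly (det M) p = 1"
      using comm_ring_hom.hom_det[OF ev, of M] by simp
    have eJ: "\<kappa> (det M) * [:single (eb c) 1:] \<in> J" if c: "c < D" for c
      unfolding adj_mat_vec[OF M \<kappa>hom c, of "\<lambda>c. [:single (eb c) 1:]", symmetric]
    proof (rule J_sum)
      fix b assume "b \<in> {..<D}"
      then have b: "b < D" by simp
      show "\<kappa> (adj_mat M $$ (b, c)) * (\<Sum>c'<D. \<kappa> (M $$ (c', b)) * [:single (eb c') 1:]) \<in> J"
        unfolding Wexp[OF b] by (rule J_scale[OF WJ[OF b]])
    qed
    have "(\<Sum>c<D. \<kappa> [:lookup \<mu> (eb c):] * (\<kappa> (det M) * [:single (eb c) 1:])) =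
        \<kappa> (det M) * (\<Sum>c<D. [:lcst (lookup \<mu> (eb c)) * single (eb c) 1:])"
      unfolding \<kappa>c by (simp add: sum_distrib_left ac_simps)
    also have "(\<Sum>c<D. [:lcst (lookup \<mu> (eb c)) * single (eb c) 1:]) = [:\<mu>:]"
    proof -
      have "(\<Sum>c<D. [:g c:]) = [:\<Sum>c<D. g c:]" for g :: "nat \<Rightarrow> 'k laurent"
        by (induction D) auto
      then show ?thesis using box_expand[OF mu eb] by simp
    qed
    finally have eq: "(\<Sum>c<D. \<kappa> [:lookup \<mu> (eb c):] *
        (\<kappa> (det M) * [:single (eb c) 1:])) = \<kappa> (det M) * [:\<mu>:]" .
    have "\<kappa> (det M) * [:\<mu>:] \<in> J"
      unfolding eq[symmetric] by (rule J_sum, rule J_scale, rule eJ) simp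
    with det1 show ?thesis by blast
  qed
  \<comment> \<open>\<open>I\<close> is an ideal of polynomials in one variable, so a nonzero
    element of least degree divides all others. A root \<open>p\<close> of it would be a root of all
    of them, also of the \<open>\<delta>\<close> with value 1 at \<open>p\<close>.\<close>
  define I where "I = {q. \<kappa> q * [:\<mu>:] \<in> J}"
  obtain \<delta> where "poly \<delta> 0 = 1" "\<delta> \<in> I" using local_mult[of 0] unfolding I_def by blast
  then have "\<delta> \<in> I \<and> \<delta> \<noteq> 0" by auto
  then obtain q where q: "q \<in> I" "q \<noteq> 0" and qmin: "\<And>q'. q' \<in> I \<and> q' \<noteq> 0 \<Longrightarrow> Polynomial.degree q \<le> Polynomial.degree q'"
    using ex_has_least_nat[of "\<lambda>q. q \<in> I \<and> q \<noteq> 0" \<delta> Polynomial.degree] by blast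
  have "Polynomial.degree q = 0"
  proof (rule ccontr)
    assume "Polynomial.degree q \<noteq> 0"
    then obtain p where p: "poly q p = 0"
      using alg_closed_imp_poly_has_root[of q] by auto
    obtain \<delta> where \<delta>: "poly \<delta> p = 1" "\<delta> \<in> I" using local_mult[of p] unfolding I_def by blast
    have "\<delta> mod q = \<delta> + (- (\<delta> div q)) * q"
      by (simp add: minus_div_mult_eq_mod flip: minus_mult_left)
    then have "\<kappa> (\<delta> mod q) * [:\<mu>:] = \<kappa> \<delta> * [:\<mu>:] + \<kappa> (- (\<delta> div q)) * (\<kappa> q * [:\<mu>:])"
      by (simp only: K.hom_add K.hom_mult distrib_right mult.assoc)
    also have "\<dots> \<in> J"
      by (rule J_add[OF _ J_scale]) (use \<delta>(2) q(1) in \<open>simp_all only: I_def mem_Collect_eq\<close>)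
    finally have "\<delta> mod q \<in> I" by (simp add: I_def)
    then have "\<delta> mod q = 0"
      using qmin[of "\<delta> mod q"] degree_mod_less[OF q(2), of \<delta>] \<open>Polynomial.degree q \<noteq> 0\<close> by fastforce
    then have "q dvd \<delta>" by auto
    then show False using p \<delta>(1) by (auto elim!: dvdE)
  qed
  then obtain a where a: "q = [:a:]" "a \<noteq> 0"
    using q(2) by (metis degree_eq_zeroE pCons_0_0)
  have "\<kappa> ([:1 / a:] * q) * [:\<mu>:] \<in> J"
    using J_scale[of "\<kappa> q * [:\<mu>:]" "[:1 / a:]"] q(1) by (simp only: I_def K.hom_mult mult.assoc mem_Collect_eq)
  then have "[:\<mu>:] \<in> J"
    using a by (simp add: \<kappa>c)
  then show ?thesis using that unfolding J_def good_def by force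
qed

section \<open>Forms on a product of lines, treated by slices\<close>

abbreviation lvar :: "nat \<Rightarrow> 'k::zero_neq_one laurent" where
  "lvar j \<equiv> single (single j 1) 1"

abbreviation lvar_inv :: "nat \<Rightarrow> 'k::zero_neq_one laurent" where
  "lvar_inv j \<equiv> single (single j (- 1)) 1"

lemma lvar_inverse: "lvar j * lvar_inv j = (1 :: 'k::comm_ring_1 laurent)"
  by (simp add: mult_single flip: single_add)

lemma single_power: "single (single j (c::int)) 1 ^ k =
    (single (single j (int k * c)) 1 :: 'k::comm_ring_1 laurent)"
proof (induction k)
  case (Suc k)
  have "single j c + single j (int k * c) = single j (int (Suc k) * c)"
    by (simp add: algebra_simps flip: single_add)
  then show ?case by (simp add: Suc mult_single)
qed simp

text \<open>
  Forms of multidegree \<open>(d, \<dots>, d)\<close> on a product of \<open>n\<close> projective lines without a common zero: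
  by recursion on \<open>n\<close>, the slices at all points \<open>(s : t)\<close> of the last line have no common zero.
\<close>
inductive no_common_zero :: "nat \<Rightarrow> nat \<Rightarrow> nat \<Rightarrow> (nat \<Rightarrow> 'k::field laurent) \<Rightarrow> bool" for r d where
  no_common_zero_0: "(\<And>i. i < r \<Longrightarrow> f i \<in> box 0 (\<lambda>_. int d)) \<Longrightarrow> i0 < r \<Longrightarrow> f i0 = lcst c \<Longrightarrow> c \<noteq> 0 \<Longrightarrow>
    no_common_zero r d 0 f"
| no_common_zero_Suc: "(\<And>i k. i < r \<Longrightarrow> k \<le> d \<Longrightarrow> F i k \<in> box n (\<lambda>_. int d)) \<Longrightarrow>
    (\<And>i. i < r \<Longrightarrow> f i = (\<Sum>k\<le>d. F i k * lvar n ^ k)) \<Longrightarrow>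
    (\<And>s t. (s, t) \<noteq> (0, 0) \<Longrightarrow> no_common_zero r d n (\<lambda>i. \<Sum>k\<le>d. lcst (s ^ k * t ^ (d - k)) * F i k)) \<Longrightarrow>
    no_common_zero r d (Suc n) f"

text \<open>On a chart of the last line the coordinate parametrises a family whose fibres are the
  slices, so \<open>full_image_over_line\<close> represents a monomial \<open>\<mu>\<close> in the
  other variables. This monomial is chosen invertible on the given chart of the first
  \<open>n\<close> lines; dividing by it represents 1.\<close>

lemma chart_units_Suc:
  fixes f :: "nat \<Rightarrow> 'k::alg_closed_field laurent"
  assumes d: "d > 0" and F: "\<And>i k. i < r \<Longrightarrow> k \<le> d \<Longrightarrow> F i k \<in> box n (\<lambda>_. int d)"
    and f: "\<And>i. i < r \<Longrightarrow> f i = (\<Sum>k\<le>d. F i k * lvar n ^ k)"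
    and full: "\<And>s t. (s, t) \<noteq> (0, 0) \<Longrightarrow> full_image n r (int d) (\<lambda>i. \<Sum>k\<le>d. lcst (s ^ k * t ^ (d - k)) * F i k)"
  shows "chart_units (Suc n) r (int d) f"
  unfolding chart_units_def
proof
  fix h :: "nat \<Rightarrow> bool"
  let ?D = "int d"
  \<comment> \<open>The corner exponent: the top degree on the lines with exponents bounded above,
    zero on the others. Dividing by it moves the upper bounds from \<open>sub_deg\<close> to
    \<open>sub_deg - top_deg = - d\<close> and keeps the lower bounds.\<close>
  define e where "e = Abs_poly_mapping (\<lambda>j. if j < n \<and> h j then top_deg ?D j else 0)"
  have le: "lookup e = (\<lambda>j. if j < n \<and> h j then top_deg ?D j else 0)"
    unfolding e_def by (rule lookup_Abs_poly_mapping) (rule finite_subset[of _ "{..<n}"], auto)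
  have top0: "top_deg ?D j \<ge> 0" for j
  proof -
    have "top_deg ?D j = int j * ?D + 2 * ?D - 1" by (simp add: top_deg_def algebra_simps)
    moreover have "int j * ?D \<ge> 0" by simp
    ultimately show ?thesis using d by linarith
  qed
  define \<mu> :: "'k laurent" where "\<mu> = single e 1"
  have mu: "\<mu> \<in> box n (top_deg ?D)"
    unfolding \<mu>_def by (rule single_in_laur) (auto simp: le top0)
  define b where "b = (sub_deg ?D)(n := - ?D)"
  let ?l = "\<lambda>j. j = n \<longrightarrow> \<not> h n" and ?h = "\<lambda>j. j = n \<longrightarrow> h n"
  have "\<exists>G. (\<forall>i<r. G i \<in> laur (Suc n) ?l ?h b) \<and> (\<Sum>i<r. G i * f i) = \<mu>"
  proof (cases "h n")
    case False
    define P where "P i = (\<Sum>k\<le>d. monom (F i k) k)" for i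
    have cP: "coeff (P i) k \<in> box n (\<lambda>_. ?D)" if "i < r" for i k
      unfolding P_def coeff_sum coeff_monom by (rule laur_sum) (simp add: F[OF that])
    have evP: "poly (P i) x = (\<Sum>k\<le>d. F i k * x ^ k)" for i x
      by (simp add: P_def poly_sum poly_monom)
    have "full_image n r ?D (\<lambda>i. poly (P i) (lcst p))" for p
      using full[of p 1] by (simp add: evP lcst_power mult.commute)
    then obtain V where V: "\<And>i k. i < r \<Longrightarrow> coeff (V i) k \<in> box n (sub_deg ?D)" "(\<Sum>i<r. V i * P i) = [:\<mu>:]"
      using full_image_over_line[where P = P, OF cP _ mu] by blast
    have "(\<Sum>i<r. poly (V i) (lvar n) * f i) = poly (\<Sum>i<r. V i * P i) (lvar n)"
      by (simp add: poly_sum evP f)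
    then have "(\<Sum>i<r. poly (V i) (lvar n) * f i) = \<mu>"
      using V(2) by simp
    moreover have "poly (V i) (lvar n) \<in> laur (Suc n) ?l ?h b" if "i < r" for i
      unfolding poly_altdef
    proof (rule laur_sum)
      fix k
      have "coeff (V i) k \<in> laur (Suc n) ?l ?h b"
        by (rule laur_extend[OF V(1)[OF that]]) (use False in \<open>auto simp: b_def\<close>)
      moreover have "(lvar n ^ k :: 'k laurent) \<in> laur (Suc n) ?l ?h (\<lambda>_. 0)"
        unfolding single_power by (rule single_in_laur) (use False in \<open>auto simp: lookup_single when_def\<close>)
      ultimately show "coeff (V i) k * lvar n ^ k \<in> laur (Suc n) ?l ?h b"
        by (rule laur_mult) auto
    qed
    ultimately show ?thesis by (intro exI[of _ "\<lambda>i. poly (V i) (lvar n)"]) auto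
  next
    case True
    \<comment> \<open>On the other chart of the last line the coordinate is the inverse variable.
      Divided by the \<open>d\<close>-th power of the variable, \<open>f i\<close> is a polynomial
      in the inverse with the coefficients reversed; that power also accounts for the bound
      \<open>- d\<close> on the last line.\<close>
    define P where "P i = (\<Sum>k\<le>d. monom (F i (d - k)) k)" for i
    have cP: "coeff (P i) k \<in> box n (\<lambda>_. ?D)" if "i < r" for i k
      unfolding P_def coeff_sum coeff_monom by (rule laur_sum) (simp add: F[OF that])
    have evP: "poly (P i) x = (\<Sum>k\<le>d. F i (d - k) * x ^ k)" for i x
      by (simp add: P_def poly_sum poly_monom)
    have evP': "poly (P i) x = (\<Sum>k\<le>d. F i k * x ^ (d - k))" for i x
      unfolding evP atMost_atLeast0 by (subst sum.atLeastAtMost_rev) (auto intro!: sum.cong)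
    have "full_image n r ?D (\<lambda>i. poly (P i) (lcst p))" for p
      using full[of 1 p] by (simp add: evP' lcst_power mult.commute)
    then obtain V where V: "\<And>i k. i < r \<Longrightarrow> coeff (V i) k \<in> box n (sub_deg ?D)" "(\<Sum>i<r. V i * P i) = [:\<mu>:]"
      using full_image_over_line[where P = P, OF cP _ mu] by blast
    have fP: "lvar_inv n ^ d * f i = poly (P i) (lvar_inv n)" if "i < r" for i
    proof -
      have "lvar n ^ k * lvar_inv n ^ d = (lvar_inv n ^ (d - k) :: 'k laurent)" if "k \<le> d" for k
      proof -
        have "lvar n ^ k * lvar_inv n ^ d = (lvar n * lvar_inv n) ^ k * (lvar_inv n ^ (d - k) :: 'k laurent)"
          using that by (simp add: power_mult_distrib mult.assoc flip: power_add)
        then show ?thesis by (simp add: lvar_inverse)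
      qed
      then show ?thesis
        unfolding f[OF that] evP' sum_distrib_left by (intro sum.cong) (auto simp: ac_simps)
    qed
    have "(\<Sum>i<r. (poly (V i) (lvar_inv n) * lvar_inv n ^ d) * f i) = poly (\<Sum>i<r. V i * P i) (lvar_inv n)"
      unfolding poly_sum by (intro sum.cong) (auto simp: fP mult.assoc)
    then have "(\<Sum>i<r. (poly (V i) (lvar_inv n) * lvar_inv n ^ d) * f i) = \<mu>"
      using V(2) by simp
    moreover have "poly (V i) (lvar_inv n) * lvar_inv n ^ d \<in> laur (Suc n) ?l ?h b" if "i < r" for i
    proof (rule laur_mult)
      show "(lvar_inv n ^ d :: 'k laurent) \<in> laur (Suc n) ?l ?h (\<lambda>j. if j = n then - ?D else 0)"
        unfolding single_power by (rule single_in_laur) (use True in \<open>auto simp: lookup_single when_def\<close>)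
      show "poly (V i) (lvar_inv n) \<in> laur (Suc n) ?l ?h ((sub_deg ?D)(n := 0))"
        unfolding poly_altdef
      proof (rule laur_sum)
        fix k
        have "coeff (V i) k \<in> laur (Suc n) ?l ?h ((sub_deg ?D)(n := 0))"
          using V(1)[OF that, of k] by (rule laur_extend) (use True in auto)
        moreover have "(lvar_inv n ^ k :: 'k laurent) \<in> laur (Suc n) ?l ?h (\<lambda>_. 0)"
          unfolding single_power by (rule single_in_laur) (use True in \<open>auto simp: lookup_single when_def\<close>)
        ultimately show "coeff (V i) k * lvar_inv n ^ k \<in> laur (Suc n) ?l ?h ((sub_deg ?D)(n := 0))"
          by (rule laur_mult) auto
      qed
    qed (auto simp: b_def)
    ultimately show ?thesis
      by (intro exI[of _ "\<lambda>i. poly (V i) (lvar_inv n) * lvar_inv n ^ d"]) auto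
  qed
  then obtain G where G: "\<And>i. i < r \<Longrightarrow> G i \<in> laur (Suc n) ?l ?h b" "(\<Sum>i<r. G i * f i) = \<mu>"
    by blast
  define \<nu> :: "'k laurent" where "\<nu> = single (- e) 1"
  have "(\<Sum>i<r. \<nu> * G i * f i) = \<nu> * \<mu>"
    unfolding G(2)[symmetric] sum_distrib_left by (simp add: mult.assoc)
  also have "\<dots> = 1"
    by (simp add: \<nu>_def \<mu>_def mult_single)
  finally have one: "(\<Sum>i<r. \<nu> * G i * f i) = 1" .
  have "\<nu> * G i \<in> laur (Suc n) (\<lambda>j. \<not> h j) h (\<lambda>_. - ?D)" if "i < r" for i
  proof (rule laur_mult)
    show "\<nu> \<in> laur (Suc n) (\<lambda>j. \<not> h j) h (\<lambda>j. if j < n then - top_deg ?D j else 0)"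
      unfolding \<nu>_def by (rule single_in_laur) (auto simp: le)
    show "G i \<in> laur (Suc n) (\<lambda>j. \<not> h j) h b"
      using G(1)[OF that] by (rule laur_mono) auto
    show "- ?D = (if j < n then - top_deg ?D j else 0) + b j" if "j < Suc n" for j
      using that by (auto simp: b_def top_deg_def sub_deg_def algebra_simps)
  qed
  with one show "\<exists>c. (\<forall>i<r. c i \<in> laur (Suc n) (\<lambda>j. \<not> h j) h (\<lambda>_. - ?D)) \<and> (\<Sum>i<r. c i * f i) = 1"
    by (intro exI[of _ "\<lambda>i. \<nu> * G i"]) auto
qed

text \<open>Two implications alternate: surjectivity in all slices yields the unit ideal on each
  chart of a product with one more line, and the Koszul complex turns this into surjectivity there.
  The start is a point, where some form is a nonzero constant.\<close>

lemma no_common_zero_full_image: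
  fixes f :: "nat \<Rightarrow> 'k::alg_closed_field laurent"
  assumes "no_common_zero r d n f" "d > 0"
  shows "(\<forall>i<r. f i \<in> box n (\<lambda>_. int d)) \<and> full_image n r (int d) f"
  using assms(1)
proof induction
  case (no_common_zero_0 f i0 c)
  have "full_image 0 r (int d) f"
    unfolding full_image_def
  proof
    fix g :: "'k laurent" assume "g \<in> box 0 (top_deg (int d))"
    then have "keys g \<subseteq> {0}"
      by (auto simp: laur_def intro!: poly_mapping_eqI)
    then have g: "g = lcst (lookup g 0)"
      using sum_singles[of "{0}" g] by simp
    have "(\<Sum>i<r. (if i = i0 then lcst (lookup g 0 / c) else 0) * f i) =
        (\<Sum>i<r. if i = i0 then g else 0)"
      using no_common_zero_0 by (subst (2) g, intro sum.cong) (auto simp: mult_single)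
    then show "\<exists>v. (\<forall>i<r. v i \<in> box 0 (sub_deg (int d))) \<and> (\<Sum>i<r. v i * f i) = g"
      using no_common_zero_0(2)
      by (intro exI[of _ "\<lambda>i. if i = i0 then lcst (lookup g 0 / c) else 0"]) auto
  qed
  then show ?case using no_common_zero_0(1) by blast
next
  case (no_common_zero_Suc F n f)
  have f: "f i \<in> box (Suc n) (\<lambda>_. int d)" if "i < r" for i
    unfolding no_common_zero_Suc(2)[OF that]
  proof (rule laur_sum)
    fix k assume k: "k \<in> {..d}"
    show "F i k * lvar n ^ k \<in> box (Suc n) (\<lambda>_. int d)"
    proof (rule laur_mult)
      show "F i k \<in> box (Suc n) (\<lambda>j. if j = n then int d - int k else int d)"
        using no_common_zero_Suc(1)[OF that, of k] k by (intro laur_extend) auto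
      show "(lvar n ^ k :: 'k laurent) \<in> box (Suc n) (\<lambda>j. if j = n then int k else 0)"
        unfolding single_power by (rule single_in_laur) (auto simp: lookup_single when_def)
    qed auto
  qed
  have "chart_units (Suc n) r (int d) f"
    using no_common_zero_Suc(4)
    by (intro chart_units_Suc[OF assms(2) no_common_zero_Suc(1,2)]) auto
  then show ?case
    using full_image_if_chart_units[of r f "Suc n" "int d"] f by simp
qed

section \<open>Substitution into polynomials and forms\<close>

definition mdeg :: "'v monom \<Rightarrow> nat" where
  "mdeg m = (\<Sum>v\<in>keys m. lookup m v)"

definition mon :: "('v \<Rightarrow> 'b::comm_semiring_1) \<Rightarrow> 'v monom \<Rightarrow> 'b" where
  "mon f m = (\<Prod>v\<in>keys m. f v ^ lookup m v)"

lemma keys_add_monom: "keys (m + m') = keys m \<union> keys (m' :: 'v monom)"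
  by (auto simp: in_keys_iff lookup_add)

lemma mdeg_superset: "finite S \<Longrightarrow> keys m \<subseteq> S \<Longrightarrow> mdeg m = (\<Sum>v\<in>S. lookup m v)"
  unfolding mdeg_def by (intro sum.mono_neutral_left) (auto simp: in_keys_iff)

lemma mon_superset: "finite S \<Longrightarrow> keys m \<subseteq> S \<Longrightarrow> mon f m = (\<Prod>v\<in>S. f v ^ lookup m v)"
  unfolding mon_def by (intro prod.mono_neutral_left) (auto simp: in_keys_iff)

lemma mdeg_add: "mdeg (m + m') = mdeg m + mdeg m'"
  using mdeg_superset[of "keys m \<union> keys m'"]
  by (simp add: keys_add_monom lookup_add sum.distrib)

lemma mon_add: "mon f (m + m') = mon f m * mon f m'"
  using mon_superset[of "keys m \<union> keys m'", where f = f]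
  by (simp add: keys_add_monom lookup_add prod.distrib power_add)

lemma mon_0 [simp]: "mon f 0 = 1"
  by (simp add: mon_def)

lemma mdeg_0 [simp]: "mdeg 0 = 0"
  by (simp add: mdeg_def)

lemma mon_single [simp]: "mon f (single v k) = f v ^ k"
  by (cases "k = 0") (auto simp: mon_def)

lemma mdeg_single [simp]: "mdeg (single v k) = k"
  by (cases "k = 0") (auto simp: mdeg_def)

lemma monoms_iff: "m \<in> monoms V r \<longleftrightarrow> keys m \<subseteq> V \<and> mdeg m = r"
  by (simp add: monoms_def mdeg_def)

lemma monom_induct [consumes 1, case_names zero add]:
  assumes "keys m \<subseteq> V" and "P 0"
    and "\<And>v m. v \<in> V \<Longrightarrow> keys m \<subseteq> V \<Longrightarrow> P m \<Longrightarrow> P (single v 1 + m)"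
  shows "P (m :: 'v monom)"
  using assms(1)
proof (induction "mdeg m" arbitrary: m)
  case 0
  then have "m = 0"
    by (intro poly_mapping_eqI) (auto simp: mdeg_def in_keys_iff)
  then show ?case using assms(2) by simp
next
  case (Suc k)
  then have "keys m \<noteq> {}"
    by (auto simp: mdeg_def)
  then obtain v where v: "v \<in> keys m" by blast
  define m' where "m' = m - single v 1"
  have m: "m = single v 1 + m'"
    using v by (intro poly_mapping_eqI)
      (auto simp: m'_def lookup_add lookup_minus lookup_single when_def in_keys_iff)
  have "mdeg m = Suc (mdeg m')"
    using arg_cong[OF m, of mdeg] by (simp only: mdeg_add mdeg_single plus_1_eq_Suc)
  moreover have "keys m' \<subseteq> V" 
    using Suc.prems arg_cong[OF m, of keys] by (auto simp: keys_add_monom)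
  ultimately show ?case
    using Suc.hyps(1)[of m'] Suc.hyps(2) Suc.prems v assms(3)[of v m'] by (metis Suc_inject m subsetD)
qed

lemma msubst_superset:
  "h 0 = 0 \<Longrightarrow> finite S \<Longrightarrow> keys p \<subseteq> S \<Longrightarrow>
    msubst h f p = (\<Sum>m\<in>S. h (lookup p m) * mon f m)"
  unfolding msubst_def mon_def by (intro sum.mono_neutral_left) (auto simp: in_keys_iff)

lemma msubst_single: "h 0 = 0 \<Longrightarrow> msubst h f (single m c) = h c * mon f m"
  by (subst msubst_superset[of h "{m}"]) auto

lemma msubst_add:
  assumes "comm_ring_hom h"
  shows "msubst h f (p + q) = msubst h f p + msubst h f q"
proof -
  interpret comm_ring_hom h by (rule assms)
  let ?S = "keys p \<union> keys q"
  have "keys (p + q) \<subseteq> ?S" by (rule Poly_Mapping.keys_add)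
  then show ?thesis
    using msubst_superset[of h ?S] by (simp add: lookup_add hom_add distrib_right sum.distrib)
qed

lemma msubst_hom:
  assumes "comm_ring_hom (h :: 'a::comm_ring_1 \<Rightarrow> 'b::comm_ring_1)"
  shows "comm_ring_hom (msubst h (f :: 'v \<Rightarrow> 'b))"
proof -
  interpret comm_ring_hom h by (rule assms)
  have zero: "msubst h f 0 = 0" by (simp add: msubst_def)
  have sum: "msubst h f (sum g S) = (\<Sum>i\<in>S. msubst h f (g i))"
    for g :: "'v monom \<Rightarrow> ('v, 'a) mpoly" and S
    by (induction S rule: infinite_finite_induct) (auto simp: zero msubst_add[OF assms])
  have expand: "(\<Sum>m\<in>keys p. single m (lookup p m)) = p"
    for p :: "('v, 'a) mpoly"
    by (intro sum_singles) auto
  show ?thesis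
  proof
    fix p q :: "('v, 'a) mpoly"
    show "msubst h f (p + q) = msubst h f p + msubst h f q" by (rule msubst_add[OF assms])
    have "p * q = (\<Sum>m\<in>keys p. \<Sum>m'\<in>keys q.
        single (m + m') (lookup p m * lookup q m'))"
      by (subst (1) expand[of p, symmetric], subst (1) expand[of q, symmetric])
        (simp add: sum_product mult_single)
    then have "msubst h f (p * q) = (\<Sum>m\<in>keys p. \<Sum>m'\<in>keys q.
        (h (lookup p m) * mon f m) * (h (lookup q m') * mon f m'))"
      by (simp add: sum msubst_single hom_mult mon_add ac_simps)
    also have "\<dots> = msubst h f p * msubst h f q"
      by (simp add: sum_product msubst_def mon_def)
    finally show "msubst h f (p * q) = msubst h f p * msubst h f q" .
    show "msubst h f 1 = 1"
      using msubst_single[of h f 0 1] by simp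
  qed (rule zero)
qed

lemma mconst_hom: "comm_ring_hom (mconst :: 'a::comm_ring_1 \<Rightarrow> ('v, 'a) mpoly)"
  by unfold_locales (auto simp: mconst_def single_add mult_single)

lemma id_hom: "comm_ring_hom (id :: 'a::comm_ring_1 \<Rightarrow> 'a)"
  by unfold_locales auto

lemma comp_hom:
  assumes "comm_ring_hom g" "comm_ring_hom h"
  shows "comm_ring_hom (g \<circ> h)"
proof -
  interpret g: comm_ring_hom g by (rule assms)
  interpret h: comm_ring_hom h by (rule assms)
  show ?thesis by unfold_locales (auto simp: g.hom_add h.hom_add g.hom_mult h.hom_mult)
qed

lemma msubst_mconst [simp]: "h 0 = 0 \<Longrightarrow> msubst h f (mconst c) = h c"
  by (simp add: mconst_def msubst_single)

lemma msubst_mvar [simp]: "h 0 = 0 \<Longrightarrow> h 1 = 1 \<Longrightarrow> msubst h f (mvar v) = f v"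
  by (simp add: mvar_def msubst_single)

lemma hom_mon:
  assumes "comm_ring_hom \<phi>"
  shows "\<phi> (mon f m) = mon (\<lambda>v. \<phi> (f v)) m"
proof -
  interpret comm_ring_hom \<phi> by (rule assms)
  show ?thesis by (simp add: mon_def hom_prod hom_power)
qed

lemma hom_msubst:
  assumes "comm_ring_hom \<phi>" "h 0 = 0"
  shows "\<phi> (msubst h f p) = msubst (\<lambda>c. \<phi> (h c)) (\<lambda>v. \<phi> (f v)) p"
proof -
  interpret comm_ring_hom \<phi> by (rule assms)
  show ?thesis
    by (simp add: msubst_def hom_sum hom_mult hom_mon[OF assms(1)] flip: mon_def)
qed

lemma mon_cong: "(\<And>v. v \<in> keys m \<Longrightarrow> f v = g v) \<Longrightarrow> mon f m = mon g m"
  unfolding mon_def by (intro prod.cong) auto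

lemma forms_keysD: "p \<in> forms V d \<Longrightarrow> m \<in> keys p \<Longrightarrow> keys m \<subseteq> V \<and> mdeg m = d"
  unfolding forms_def monoms_iff[symmetric] by blast

lemma msubst_cong:
  assumes "p \<in> forms V d" "\<And>v. v \<in> V \<Longrightarrow> f v = g v"
  shows "msubst h f p = msubst h g p"
  unfolding msubst_def mon_def[symmetric]
proof (intro sum.cong refl arg_cong2[where f = "(*)"] mon_cong)
  fix m v assume "m \<in> keys p" "v \<in> keys m"
  then show "f v = g v" using forms_keysD[OF assms(1)] assms(2) by blast
qed

lemma mon_scale: "mon (\<lambda>v. c * f v) m = c ^ mdeg m * mon f m"
  unfolding mon_def mdeg_def by (simp add: power_mult_distrib prod.distrib power_sum)

lemma msubst_scale:
  assumes "p \<in> forms V d"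
  shows "msubst h (\<lambda>v. c * f v) p = c ^ d * msubst h f p"
  unfolding msubst_def mon_def[symmetric] mon_scale sum_distrib_left
  using forms_keysD[OF assms] by (intro sum.cong) (auto simp: ac_simps)

lemma forms_0 [simp]: "0 \<in> forms V d"
  by (simp add: forms_def)

lemma forms_add: "p \<in> forms V d \<Longrightarrow> q \<in> forms V d \<Longrightarrow> p + q \<in> forms V d"
  unfolding forms_def using Poly_Mapping.keys_add[of p q] by blast

lemma forms_uminus: "p \<in> forms V d \<Longrightarrow> - p \<in> forms V d"
  for p :: "('v, 'a::ab_group_add) mpoly"
  unfolding forms_def by (simp add: keys_uminus)

lemma forms_diff: "p \<in> forms V d \<Longrightarrow> q \<in> forms V d \<Longrightarrow> p - q \<in> forms V d"
  for p :: "('v, 'a::ab_group_add) mpoly"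
  using forms_add[OF _ forms_uminus] by fastforce

lemma forms_sum: "(\<And>i. i \<in> S \<Longrightarrow> f i \<in> forms V d) \<Longrightarrow> sum f S \<in> forms V d"
  by (induction S rule: infinite_finite_induct) (auto intro: forms_add)

lemma forms_mult: "p \<in> forms V d \<Longrightarrow> q \<in> forms V e \<Longrightarrow> p * q \<in> forms V (d + e)"
  unfolding forms_def using Poly_Mapping.keys_mult[of p q]
  by (fastforce simp: monoms_iff mdeg_add keys_add_monom)

lemma forms_mconst: "mconst c \<in> forms V 0"
  by (auto simp: forms_def mconst_def monoms_iff)

lemma forms_1: "1 \<in> forms V 0"
  by (auto simp: forms_def monoms_iff)

lemma forms_mvar: "v \<in> V \<Longrightarrow> mvar v \<in> forms V 1"
  by (auto simp: forms_def mvar_def monoms_iff)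

lemma forms_scale: "p \<in> forms V d \<Longrightarrow> mconst c * p \<in> forms V d"
  using forms_mult[OF forms_mconst] by fastforce

lemma forms_prod: "(\<And>i. i \<in> S \<Longrightarrow> f i \<in> forms V (e i)) \<Longrightarrow> prod f S \<in> forms V (sum e S)"
proof (induction S rule: infinite_finite_induct)
  case (insert x S)
  then show ?case using forms_mult[of "f x" V "e x" "prod f S" "sum e S"] by simp
qed (auto simp: forms_1)

lemma forms_power: "p \<in> forms V d \<Longrightarrow> p ^ k \<in> forms V (k * d)"
  by (induction k) (auto simp: forms_1 intro: forms_mult)

lemma forms_mon:
  "keys m \<subseteq> V \<Longrightarrow> (\<And>v. v \<in> V \<Longrightarrow> f v \<in> forms W e) \<Longrightarrow> mon f m \<in> forms W (mdeg m * e)"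
proof (induction rule: monom_induct)
  case (add v m)
  then show ?case using forms_mult[of "f v" W e "mon f m" "mdeg m * e"]
    by (simp add: mon_add mdeg_add)
qed (simp add: forms_1)

lemma msubst_forms:
  assumes "p \<in> forms V d" "\<And>v. v \<in> V \<Longrightarrow> f v \<in> forms W e" "\<And>c. h c \<in> forms W 0"
  shows "msubst h f p \<in> forms W (d * e)"
  unfolding msubst_def mon_def[symmetric]
proof (rule forms_sum)
  fix m assume "m \<in> keys p"
  then have "mon f m \<in> forms W (d * e)"
    using forms_keysD[OF assms(1)] forms_mon[of m V f W e] assms(2) by blast
  then show "h (lookup p m) * mon f m \<in> forms W (d * e)"
    using forms_mult[OF assms(3)] by fastforce
qed

lemma finite_monoms:
  assumes "finite V"
  shows "finite (monoms V d)"
proof -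
  have "inj_on (\<lambda>m. \<lambda>v\<in>V. lookup m v) (monoms V d)"
  proof (rule inj_onI, rule poly_mapping_eqI)
    fix m m' v assume "m \<in> monoms V d" "m' \<in> monoms V d"
      and eq: "(\<lambda>v\<in>V. lookup m v) = (\<lambda>v\<in>V. lookup m' v)"
    then have "v \<in> keys m \<Longrightarrow> v \<in> V" "v \<in> keys m' \<Longrightarrow> v \<in> V"
      by (auto simp: monoms_iff)
    then have "lookup m v = 0 \<and> lookup m' v = 0" if "v \<notin> V"
      using that unfolding not_in_keys_iff_lookup_eq_zero[symmetric] by blast
    then show "lookup m v = lookup m' v"
      using fun_cong[OF eq, of v] by (cases "v \<in> V") auto
  qed
  moreover have "(\<lambda>m. \<lambda>v\<in>V. lookup m v) ` monoms V d \<subseteq> PiE V (\<lambda>_. {..d})"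
  proof (intro image_subsetI PiE_I)
    fix m v assume "m \<in> monoms V d" "v \<in> V"
    then have "lookup m v \<le> mdeg m"
      using mdeg_superset[OF assms, of m] member_le_sum[OF _ _ assms, of v "lookup m"]
      by (auto simp: monoms_iff)
    then show "(\<lambda>v\<in>V. lookup m v) v \<in> {..d}"
      using \<open>m \<in> monoms V d\<close> \<open>v \<in> V\<close> by (simp add: monoms_iff)
  qed auto
  ultimately show ?thesis
    using assms by (meson finite_PiE finite_atMost finite_imageD finite_subset)
qed

section \<open>Pulling forms back to a product of projective lines\<close>

text \<open>
  The coefficient of \<open>X\<^sup>l\<close> in \<open>\<beta>(X) (1 + y\<^sub>0 X) \<dots> (1 + y\<^sub>m\<^sub>-\<^sub>1 X)\<close>. For \<open>\<beta> = 1\<close> and \<open>m = n\<close> these are the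
  coordinates of the map of degree \<open>n!\<close> from the product of \<open>n\<close> projective lines onto \<open>n\<close>-space.
\<close>
fun root_coeff :: "nat \<Rightarrow> 'k::comm_ring_1 poly \<Rightarrow> nat \<Rightarrow> 'k laurent" where
  "root_coeff 0 \<beta> l = lcst (coeff \<beta> l)"
| "root_coeff (Suc m) \<beta> l = root_coeff m \<beta> l + (case l of 0 \<Rightarrow> 0 | Suc l' \<Rightarrow> lvar m * root_coeff m \<beta> l')"

text \<open>Specialising a further root parameter to \<open>(s : t)\<close> amounts to multiplying
  \<open>\<beta>\<close> by \<open>t + s X\<close>. Hence slices of a pullback are pullbacks of the
  same kind, with one line fewer and another \<open>\<beta>\<close>.\<close>

lemma root_coeff_linear_factor:
  "root_coeff m ([:t, s:] * \<beta>) l =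
     lcst t * root_coeff m \<beta> l + lcst s * (case l of 0 \<Rightarrow> 0 | Suc l' \<Rightarrow> root_coeff m \<beta> l')"
proof (induction m arbitrary: l)
  case 0
  interpret comm_ring_hom "lcst :: 'a \<Rightarrow> 'a laurent" by (rule lcst_hom)
  show ?case by (cases l) (simp_all add: hom_add hom_mult coeff_pCons)
next
  case (Suc m)
  define \<gamma> where "\<gamma> = [:t, s:] * \<beta>"
  have IH: "root_coeff m \<gamma> l =
      lcst t * root_coeff m \<beta> l + lcst s * (case l of 0 \<Rightarrow> 0 | Suc l' \<Rightarrow> root_coeff m \<beta> l')" for l
    unfolding \<gamma>_def by (rule Suc)
  show ?case
    unfolding \<gamma>_def[symmetric] by (cases l; cases "l - 1") (simp_all add: IH algebra_simps)
qed

lemma lvar_in_laur: "j < n \<Longrightarrow> (\<And>i. i < n \<Longrightarrow> 0 \<le> a i) \<Longrightarrow> 1 \<le> a j \<Longrightarrow> lvar j \<in> box n a"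
  by (rule single_in_laur) (auto simp: lookup_single when_def)

lemma root_coeff_in_box: "root_coeff m \<beta> l \<in> box m (\<lambda>_. 1)"
proof (induction m arbitrary: l)
  case (Suc m)
  have *: "root_coeff m \<beta> l \<in> box (Suc m) (\<lambda>j. if j = m then 0 else 1)" for l
    using Suc by (rule laur_extend) auto
  have "root_coeff m \<beta> l \<in> box (Suc m) (\<lambda>_. 1)" for l
    using * by (rule laur_mono) auto
  moreover have "lvar m * root_coeff m \<beta> l \<in> box (Suc m) (\<lambda>_. 1)" for l
    by (rule laur_mult[OF lvar_in_laur[of m "Suc m" "\<lambda>j. if j = m then 1 else 0"] *]) auto
  ultimately show ?case by (auto intro!: laur_add split: nat.splits)
qed auto

lemma mon_in_box:
  assumes "\<And>v. f v \<in> box n (\<lambda>_. 1)"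
  shows "(mon f m :: 'k::comm_ring_1 laurent) \<in> box n (\<lambda>_. int (mdeg m))"
  using subset_UNIV[of "keys m"]
proof (induction rule: monom_induct)
  case (add v m)
  show ?case unfolding mon_add mon_single
    using assms[of v] add(3) by (auto intro: laur_mult simp: mdeg_add)
qed (auto simp flip: single_one)

lemma msubst_in_box:
  assumes "q \<in> forms V d" "\<And>v. f v \<in> box n (\<lambda>_. 1)"
  shows "(msubst (\<lambda>c. lcst (h c)) f q :: 'k::comm_ring_1 laurent) \<in> box n (\<lambda>_. int d)"
  unfolding msubst_def mon_def[symmetric]
proof (rule laur_sum)
  fix m assume "m \<in> keys q"
  then have "mdeg m = d" using forms_keysD[OF assms(1)] by blast
  then show "lcst (h (lookup q m)) * mon f m \<in> box n (\<lambda>_. int d)"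
    using mon_in_box[of f n m] assms(2) by (auto intro: laur_lcst_mult)
qed

lemma mon_pencil:
  fixes b b' :: "'v \<Rightarrow> 'k::comm_ring_1 laurent"
  assumes "\<And>v. b v \<in> box n (\<lambda>_. 1)" "\<And>v. b' v \<in> box n (\<lambda>_. 1)"
  shows "\<exists>F. (\<forall>k. F k \<in> box n (\<lambda>_. int (mdeg m))) \<and>
    (\<forall>S T. mon (\<lambda>v. T * b v + S * b' v) m = (\<Sum>k\<le>mdeg m. S ^ k * T ^ (mdeg m - k) * F k))"
  using subset_UNIV[of "keys m"]
proof (induction rule: monom_induct)
  case zero
  have "(1 :: 'k laurent) \<in> box n (\<lambda>_. 0)"
    using lcst_in_laur[of n "\<lambda>_. True" "\<lambda>_. 0" "1 :: 'k"] by simp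
  then show ?case by (intro exI[of _ "\<lambda>_. 1"]) auto
next
  case (add v m)
  then obtain F where F: "\<And>k. F k \<in> box n (\<lambda>_. int (mdeg m))"
    "\<And>S T. mon (\<lambda>v. T * b v + S * b' v) m = (\<Sum>k\<le>mdeg m. S ^ k * T ^ (mdeg m - k) * F k)"
    by blast
  let ?e = "mdeg m"
  define G where "G k = (if k \<le> ?e then b v * F k else 0) + (case k of 0 \<Rightarrow> 0 | Suc k' \<Rightarrow> b' v * F k')" for k
  have deg: "mdeg (single v 1 + m) = Suc ?e" by (simp add: mdeg_add)
  have "G k \<in> box n (\<lambda>_. int (Suc ?e))" for k
    unfolding G_def using F(1)
    by (auto intro!: laur_add split: nat.splits intro: laur_mult[OF assms(1)] laur_mult[OF assms(2)])
  moreover have "mon (\<lambda>v. T * b v + S * b' v) (single v 1 + m) =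
      (\<Sum>k\<le>Suc ?e. S ^ k * T ^ (Suc ?e - k) * G k)" for S T
  proof -
    have "(\<Sum>k\<le>Suc ?e. S ^ k * T ^ (Suc ?e - k) * G k) =
        (\<Sum>k\<le>Suc ?e. S ^ k * T ^ (Suc ?e - k) * (if k \<le> ?e then b v * F k else 0)) +
        (\<Sum>k\<le>Suc ?e. S ^ k * T ^ (Suc ?e - k) * (case k of 0 \<Rightarrow> 0 | Suc k' \<Rightarrow> b' v * F k'))"
      by (simp add: G_def distrib_left sum.distrib)
    also have "(\<Sum>k\<le>Suc ?e. S ^ k * T ^ (Suc ?e - k) * (if k \<le> ?e then b v * F k else 0)) =
        T * b v * (\<Sum>k\<le>?e. S ^ k * T ^ (?e - k) * F k)"
      by (simp add: sum_distrib_left Suc_diff_le ac_simps)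
    also have "(\<Sum>k\<le>Suc ?e. S ^ k * T ^ (Suc ?e - k) * (case k of 0 \<Rightarrow> 0 | Suc k' \<Rightarrow> b' v * F k')) =
        S * b' v * (\<Sum>k\<le>?e. S ^ k * T ^ (?e - k) * F k)"
      by (subst sum.atMost_Suc_shift) (simp add: sum_distrib_left ac_simps)
    finally show ?thesis
      unfolding mon_add mon_single F(2) by (simp add: algebra_simps)
  qed
  ultimately show ?case unfolding deg by (intro exI[of _ G]) blast
qed

text \<open>One family of coefficients serves all \<open>S\<close> and \<open>T\<close>. With
  \<open>T = 1\<close> and the new variable for \<open>S\<close> it expands the pullback; with
  constants it gives the slices. These are the two places where \<open>no_common_zero\<close> refers
  to the same \<open>F\<close>.\<close>

lemma form_pencil:
  fixes b b' :: "'v \<Rightarrow> 'k::comm_ring_1 laurent"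
  assumes q: "q \<in> forms V d" and "\<And>v. b v \<in> box n (\<lambda>_. 1)" "\<And>v. b' v \<in> box n (\<lambda>_. 1)"
  obtains F where "\<And>k. F k \<in> box n (\<lambda>_. int d)"
    "\<And>S T. msubst lcst (\<lambda>v. T * b v + S * b' v) q = (\<Sum>k\<le>d. S ^ k * T ^ (d - k) * F k)"
proof -
  have "\<forall>m. \<exists>F. (\<forall>k. F k \<in> box n (\<lambda>_. int (mdeg m))) \<and>
      (\<forall>S T. mon (\<lambda>v. T * b v + S * b' v) m = (\<Sum>k\<le>mdeg m. S ^ k * T ^ (mdeg m - k) * F k))"
    by (intro allI mon_pencil assms(2,3))
  from choice[OF this] obtain F where "\<forall>m. (\<forall>k. F m k \<in> box n (\<lambda>_. int (mdeg m))) \<and>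
      (\<forall>S T. mon (\<lambda>v. T * b v + S * b' v) m = (\<Sum>k\<le>mdeg m. S ^ k * T ^ (mdeg m - k) * F m k))" ..
  then have F: "\<And>m k. F m k \<in> box n (\<lambda>_. int (mdeg m))"
    "\<And>m S T. mon (\<lambda>v. T * b v + S * b' v) m = (\<Sum>k\<le>mdeg m. S ^ k * T ^ (mdeg m - k) * F m k)"
    by auto
  define G where "G k = (\<Sum>m\<in>keys q. lcst (lookup q m) * F m k)" for k
  show thesis
  proof (rule that)
    show "G k \<in> box n (\<lambda>_. int d)" for k
      unfolding G_def
    proof (rule laur_sum)
      fix m assume "m \<in> keys q"
      then have "mdeg m = d" using forms_keysD[OF q] by blast
      then show "lcst (lookup q m) * F m k \<in> box n (\<lambda>_. int d)"
        using F(1)[of m k] by (auto intro: laur_lcst_mult)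
    qed
    show "msubst lcst (\<lambda>v. T * b v + S * b' v) q = (\<Sum>k\<le>d. S ^ k * T ^ (d - k) * G k)" for S T
    proof -
      have "msubst lcst (\<lambda>v. T * b v + S * b' v) q =
          (\<Sum>m\<in>keys q. \<Sum>k\<le>d. S ^ k * T ^ (d - k) * (lcst (lookup q m) * F m k))"
        unfolding msubst_def mon_def[symmetric] F(2) sum_distrib_left
        using forms_keysD[OF q] by (intro sum.cong refl) (auto simp: ac_simps)
      also have "\<dots> = (\<Sum>k\<le>d. S ^ k * T ^ (d - k) * G k)"
        unfolding G_def by (subst sum.swap) (simp add: sum_distrib_left)
      finally show ?thesis .
    qed
  qed
qed

text \<open>\<open>\<beta>\<close> collects the linear factors at which lines have already been
  specialised. The bound on its degree keeps its coefficients at indices up to \<open>n\<close>, so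
  when no line is left they are the coordinates of a nonzero point.\<close>

lemma no_common_zero_pullback:
  fixes q :: "nat \<Rightarrow> (nat, 'k::alg_closed_field) mpoly"
  assumes q: "\<And>i. i < r \<Longrightarrow> q i \<in> forms {..n} d"
    and nz: "\<And>x. (\<exists>j\<le>n. x j \<noteq> 0) \<Longrightarrow> \<exists>i<r. meval x (q i) \<noteq> 0"
  shows "\<beta> \<noteq> 0 \<Longrightarrow> Polynomial.degree \<beta> + m \<le> n \<Longrightarrow>
    no_common_zero r d m (\<lambda>i. msubst lcst (root_coeff m \<beta>) (q i))"
proof (induction m arbitrary: \<beta>)
  case 0
  have "coeff \<beta> (Polynomial.degree \<beta>) \<noteq> 0" "Polynomial.degree \<beta> \<le> n" using 0 by simp_all
  then have "\<exists>j\<le>n. coeff \<beta> j \<noteq> 0" by blast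
  then obtain i where i: "i < r" "meval (coeff \<beta>) (q i) \<noteq> 0"
    using nz by blast
  have eq: "msubst lcst (root_coeff 0 \<beta>) (q i) = lcst (meval (coeff \<beta>) (q i))"
  proof -
    have "root_coeff 0 \<beta> = (\<lambda>v. lcst (coeff \<beta> v))" by (rule ext) simp
    then show ?thesis using hom_msubst[OF lcst_hom, of id "coeff \<beta>" "q i"] by simp
  qed
  show ?case
  proof (rule no_common_zero_0[of r _ d i "meval (coeff \<beta>) (q i)"])
    show "msubst lcst (root_coeff 0 \<beta>) (q i') \<in> box 0 (\<lambda>_. int d)" if "i' < r" for i'
      using msubst_in_box[OF q[OF that], of "root_coeff 0 \<beta>" 0 id] root_coeff_in_box[of 0 \<beta>] by simp
  qed (rule i(1) eq i(2))+
next
  case (Suc m)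
  let ?b = "root_coeff m \<beta>" and ?b' = "\<lambda>l. case l of 0 \<Rightarrow> 0 | Suc l' \<Rightarrow> root_coeff m \<beta> l'"
  have b: "?b v \<in> box m (\<lambda>_. 1)" "?b' v \<in> box m (\<lambda>_. 1)" for v
    using root_coeff_in_box by (auto split: nat.splits)
  have "\<forall>i\<in>{..<r}. \<exists>F. (\<forall>k. F k \<in> box m (\<lambda>_. int d)) \<and>
      (\<forall>S T. msubst lcst (\<lambda>v. T * ?b v + S * ?b' v) (q i) = (\<Sum>k\<le>d. S ^ k * T ^ (d - k) * F k))"
  proof
    fix i assume "i \<in> {..<r}"
    then have qi: "q i \<in> forms {..n} d" using q by simp
    show "\<exists>F. (\<forall>k. F k \<in> box m (\<lambda>_. int d)) \<and>
        (\<forall>S T. msubst lcst (\<lambda>v. T * ?b v + S * ?b' v) (q i) = (\<Sum>k\<le>d. S ^ k * T ^ (d - k) * F k))"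
      by (rule form_pencil[of "q i" "{..n}" d ?b m ?b', OF qi b]) blast
  qed
  from bchoice[OF this] obtain F where F0: "\<forall>i\<in>{..<r}. (\<forall>k. F i k \<in> box m (\<lambda>_. int d)) \<and>
      (\<forall>S T. msubst lcst (\<lambda>v. T * ?b v + S * ?b' v) (q i) = (\<Sum>k\<le>d. S ^ k * T ^ (d - k) * F i k))" ..
  have F: "F i k \<in> box m (\<lambda>_. int d)"
    "msubst lcst (\<lambda>v. T * ?b v + S * ?b' v) (q i) = (\<Sum>k\<le>d. S ^ k * T ^ (d - k) * F i k)"
    if "i < r" for i k S T
    using bspec[OF F0, of i] that by blast+
  have cong: "no_common_zero r d m f \<Longrightarrow> (\<And>i. i < r \<Longrightarrow> f i = g i) \<Longrightarrow> no_common_zero r d m g"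
    for m and f g :: "nat \<Rightarrow> 'k laurent"
  proof (induction arbitrary: g rule: no_common_zero.induct)
    case (no_common_zero_0 f i0 c)
    show ?case
      by (rule no_common_zero.no_common_zero_0[of r g d i0 c]) (use no_common_zero_0 in auto)
  next
    case (no_common_zero_Suc F n f)
    show ?case
      by (rule no_common_zero.no_common_zero_Suc[of r d F]) (use no_common_zero_Suc in auto)
  qed
  show ?case
  proof (rule no_common_zero_Suc)
    show "F i k \<in> box m (\<lambda>_. int d)" if "i < r" for i k by (rule F(1)[OF that])
    show "msubst lcst (root_coeff (Suc m) \<beta>) (q i) = (\<Sum>k\<le>d. F i k * lvar m ^ k)" if "i < r" for i
    proof -
      have "root_coeff (Suc m) \<beta> = (\<lambda>v. 1 * ?b v + lvar m * ?b' v)"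
        by (rule ext) (auto split: nat.splits)
      then show ?thesis
        using F(2)[OF that, of 1 "lvar m"] by (simp add: mult.commute)
    qed
    fix s t :: 'k assume st: "(s, t) \<noteq> (0, 0)"
    have "no_common_zero r d m (\<lambda>i. msubst lcst (root_coeff m ([:t, s:] * \<beta>)) (q i))"
    proof (rule Suc.IH)
      have "[:t, s:] \<noteq> 0" using st by auto
      then show "[:t, s:] * \<beta> \<noteq> 0" using Suc.prems(1) by (metis mult_eq_0_iff)
      have "Polynomial.degree ([:t, s:] * \<beta>) \<le> 1 + Polynomial.degree \<beta>"
        by (rule order_trans[OF degree_mult_le]) simp
      then show "Polynomial.degree ([:t, s:] * \<beta>) + m \<le> n"
        using Suc.prems(2) by simp
    qed
    then show "no_common_zero r d m (\<lambda>i. \<Sum>k\<le>d. lcst (s ^ k * t ^ (d - k)) * F i k)"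
    proof (rule cong)
      fix i assume i: "i < r"
      have "root_coeff m ([:t, s:] * \<beta>) = (\<lambda>v. lcst t * ?b v + lcst s * ?b' v)"
        by (rule ext) (rule root_coeff_linear_factor)
      then show "msubst lcst (root_coeff m ([:t, s:] * \<beta>)) (q i) = (\<Sum>k\<le>d. lcst (s ^ k * t ^ (d - k)) * F i k)"
        using F(2)[OF i, of "lcst t" "lcst s"] by (simp add: lcst_power[symmetric] mult_single)
    qed
  qed
qed

subsection \<open>Multihomogeneous evaluation\<close>

text \<open>An element of \<open>box n a\<close> is a form of multidegree \<open>a\<close> with the
  second coordinate of every line set to 1; \<open>a\<close> is an argument because the powers of
  \<open>t j\<close> have to be restored. Inside the box \<open>nat\<close> truncates
  nothing.\<close>

definition mhom_eval :: "nat \<Rightarrow> (nat \<Rightarrow> int) \<Rightarrow> (nat \<Rightarrow> 'k) \<Rightarrow> (nat \<Rightarrow> 'k) \<Rightarrow> 'k::comm_ring_1 laurent \<Rightarrow> 'k" where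
  "mhom_eval n a s t g = (\<Sum>e\<in>keys g. lookup g e *
     (\<Prod>j<n. s j ^ nat (lookup e j) * t j ^ nat (a j - lookup e j)))"

lemma mhom_eval_superset:
  "finite S \<Longrightarrow> keys g \<subseteq> S \<Longrightarrow> mhom_eval n a s t g = (\<Sum>e\<in>S. lookup g e *
     (\<Prod>j<n. s j ^ nat (lookup e j) * t j ^ nat (a j - lookup e j)))"
  unfolding mhom_eval_def by (intro sum.mono_neutral_left) (auto simp: in_keys_iff)

lemma mhom_eval_single: "mhom_eval n a s t (single e c) =
    c * (\<Prod>j<n. s j ^ nat (lookup e j) * t j ^ nat (a j - lookup e j))"
  by (subst mhom_eval_superset[of "{e}"]) auto

lemma mhom_eval_0 [simp]: "mhom_eval n a s t 0 = 0"
  by (simp add: mhom_eval_def)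

lemma mhom_eval_add: "mhom_eval n a s t (f + g) = mhom_eval n a s t f + mhom_eval n a s t g"
proof -
  let ?S = "keys f \<union> keys g"
  have "keys (f + g) \<subseteq> ?S" by (rule Poly_Mapping.keys_add)
  then show ?thesis
    by (subst (1 2 3) mhom_eval_superset[of ?S]) (simp_all add: lookup_add distrib_right sum.distrib)
qed

lemma mhom_eval_sum: "mhom_eval n a s t (sum f S) = (\<Sum>i\<in>S. mhom_eval n a s t (f i))"
  by (induction S rule: infinite_finite_induct) (auto simp: mhom_eval_add)

lemma mhom_eval_mult:
  assumes "f \<in> box n a" "g \<in> box n b" "\<And>j. j < n \<Longrightarrow> c j = a j + b j"
  shows "mhom_eval n c s t (f * g) = mhom_eval n a s t f * mhom_eval n b s t g"
proof -
  have expand: "(\<Sum>e\<in>keys f. single e (lookup f e)) = f" for f :: "'a laurent"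
    by (intro sum_singles) auto
  have "f * g = (\<Sum>e\<in>keys f. \<Sum>e'\<in>keys g.
      single (e + e') (lookup f e * lookup g e'))"
    by (subst (1) expand[of f, symmetric], subst (1) expand[of g, symmetric]) (simp add: sum_product mult_single)
  then have "mhom_eval n c s t (f * g) = (\<Sum>e\<in>keys f. \<Sum>e'\<in>keys g.
      lookup f e * lookup g e' *
      (\<Prod>j<n. s j ^ nat (lookup (e + e') j) * t j ^ nat (c j - lookup (e + e') j)))"
    by (simp add: mhom_eval_sum mhom_eval_single)
  also have "\<dots> = (\<Sum>e\<in>keys f. \<Sum>e'\<in>keys g.
      (lookup f e * (\<Prod>j<n. s j ^ nat (lookup e j) * t j ^ nat (a j - lookup e j))) *
      (lookup g e' * (\<Prod>j<n. s j ^ nat (lookup e' j) * t j ^ nat (b j - lookup e' j))))"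
  proof (intro sum.cong refl)
    fix e e' assume e: "e \<in> keys f" "e' \<in> keys g"
    have "(\<Prod>j<n. s j ^ nat (lookup (e + e') j) * t j ^ nat (c j - lookup (e + e') j)) =
      (\<Prod>j<n. (s j ^ nat (lookup e j) * t j ^ nat (a j - lookup e j)) *
        (s j ^ nat (lookup e' j) * t j ^ nat (b j - lookup e' j)))"
    proof (intro prod.cong refl)
      fix j assume j: "j \<in> {..<n}"
      then have b: "0 \<le> lookup e j" "lookup e j \<le> a j"
          "0 \<le> lookup e' j" "lookup e' j \<le> b j"
        using assms(1,2) e by (auto simp: laur_def)
      have "nat (lookup (e + e') j) = nat (lookup e j) + nat (lookup e' j)"
        using b by (simp add: lookup_add nat_add_distrib)
      moreover have "nat (c j - lookup (e + e') j) =
          nat (a j - lookup e j) + nat (b j - lookup e' j)"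
        using b assms(3)[of j] j by (simp add: lookup_add)
      ultimately show "s j ^ nat (lookup (e + e') j) * t j ^ nat (c j - lookup (e + e') j) =
        (s j ^ nat (lookup e j) * t j ^ nat (a j - lookup e j)) *
        (s j ^ nat (lookup e' j) * t j ^ nat (b j - lookup e' j))"
        by (simp add: power_add ac_simps)
    qed
    then show "lookup f e * lookup g e' *
      (\<Prod>j<n. s j ^ nat (lookup (e + e') j) * t j ^ nat (c j - lookup (e + e') j)) =
      (lookup f e * (\<Prod>j<n. s j ^ nat (lookup e j) * t j ^ nat (a j - lookup e j))) *
      (lookup g e' * (\<Prod>j<n. s j ^ nat (lookup e' j) * t j ^ nat (b j - lookup e' j)))"
      by (simp add: prod.distrib ac_simps)
  qed
  also have "\<dots> = mhom_eval n a s t f * mhom_eval n b s t g"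
    by (simp add: mhom_eval_def sum_product)
  finally show ?thesis .
qed

lemma mhom_eval_lcst_mult: "mhom_eval n a s t (lcst c * f) = c * mhom_eval n a s t f"
proof -
  have "keys (lcst c * f) \<subseteq> keys f"
    by (auto simp: in_keys_iff lookup_lcst_mult)
  then show ?thesis
    by (subst mhom_eval_superset[of "keys f"])
      (auto simp: mhom_eval_def lookup_lcst_mult sum_distrib_left mult.assoc)
qed

lemma mhom_eval_mon:
  assumes "\<And>v. f v \<in> box n (\<lambda>_. 1)"
  shows "mhom_eval n (\<lambda>_. int (mdeg m)) s t (mon f m) = mon (\<lambda>v. mhom_eval n (\<lambda>_. 1) s t (f v)) m"
  using subset_UNIV[of "keys m"]
proof (induction rule: monom_induct)
  case zero
  show ?case using mhom_eval_single[of n _ s t 0 1] by simp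
next
  case (add v m)
  then show ?case unfolding mon_add mon_single mdeg_add
    using mhom_eval_mult[of "f v" n "\<lambda>_. 1" "mon f m" "\<lambda>_. int (mdeg m)"] assms[of v] mon_in_box[of f n m] assms
    by simp
qed

lemma mhom_eval_msubst:
  assumes "q \<in> forms V d" "\<And>v. f v \<in> box n (\<lambda>_. 1)"
  shows "mhom_eval n (\<lambda>_. int d) s t (msubst (\<lambda>c. lcst (h c)) f q) =
    msubst h (\<lambda>v. mhom_eval n (\<lambda>_. 1) s t (f v)) q"
  unfolding msubst_def mon_def[symmetric] mhom_eval_sum mhom_eval_lcst_mult
proof (intro sum.cong refl)
  fix m assume "m \<in> keys q"
  then have "mdeg m = d" using forms_keysD[OF assms(1)] by blast
  then show "h (lookup q m) * mhom_eval n (\<lambda>_. int d) s t (mon f m) =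
    h (lookup q m) * mon (\<lambda>v. mhom_eval n (\<lambda>_. 1) s t (f v)) m"
    using mhom_eval_mon[of f n m s t] assms(2) by simp
qed

lemma mhom_eval_root_coeff:
  "mhom_eval m (\<lambda>_. 1) s t (root_coeff m \<beta> l) = coeff (\<beta> * (\<Prod>j<m. [:t j, s j:])) l"
proof (induction m arbitrary: l)
  case 0
  show ?case by (simp add: mhom_eval_single)
next
  case (Suc m)
  have *: "root_coeff m \<beta> l \<in> box (Suc m) (\<lambda>j. if j = m then 0 else 1)" for l
    using root_coeff_in_box by (rule laur_extend) auto
  have ext: "mhom_eval (Suc m) (\<lambda>_. 1) s t g = mhom_eval m (\<lambda>_. 1) s t g * t m"
    "mhom_eval (Suc m) (\<lambda>j. if j = m then 0 else 1) s t g = mhom_eval m (\<lambda>_. 1) s t g"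
    if "g \<in> box m (\<lambda>_. 1)" for g
    using that unfolding mhom_eval_def sum_distrib_right
    by (auto simp: laur_def mult.assoc intro!: sum.cong prod.cong arg_cong2[where f = "(*)"])
  have "mhom_eval (Suc m) (\<lambda>_. 1) s t (lvar m * root_coeff m \<beta> l) = s m * mhom_eval m (\<lambda>_. 1) s t (root_coeff m \<beta> l)" for l
  proof -
    have "mhom_eval (Suc m) (\<lambda>j. if j = m then 1 else 0) s t (lvar m) = s m"
      by (simp add: mhom_eval_single lookup_single when_def)
    then show ?thesis
      using mhom_eval_mult[OF lvar_in_laur[of m "Suc m" "\<lambda>j. if j = m then 1 else 0"] *, of "\<lambda>_. 1" s t l]
        ext(2)[OF root_coeff_in_box] by simp
  qed
  moreover have "\<beta> * (\<Prod>j<Suc m. [:t j, s j:]) = [:t m, s m:] * (\<beta> * (\<Prod>j<m. [:t j, s j:]))"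
    by (simp only: prod.lessThan_Suc ac_simps)
  ultimately show ?case
    using ext(1)[OF root_coeff_in_box]
    by (cases l) (simp_all add: mhom_eval_add Suc coeff_pCons mult.commute)
qed

section \<open>Elimination\<close>

text \<open>The map from the product of lines reaches every point of n-space. A polynomial of too
  small a degree has roots at infinity, which contribute the factor with
  \<open>(s, t) = (0, 1)\<close>.\<close>

lemma linear_factorization:
  fixes \<beta> :: "'k::alg_closed_field poly"
  assumes "\<beta> \<noteq> 0" "Polynomial.degree \<beta> \<le> n"
  shows "\<exists>c s t. c \<noteq> 0 \<and> (\<forall>j<n. (s j, t j) \<noteq> (0, 0)) \<and> \<beta> = [:c:] * (\<Prod>j<n. [:t j, s j:])"
  using assms
proof (induction n arbitrary: \<beta>)
  case 0
  then obtain c where "\<beta> = [:c:]" "c \<noteq> 0"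
    by (metis degree_eq_zeroE le_zero_eq pCons_0_0)
  then show ?case by (intro exI[of _ c]) auto
next
  case (Suc n)
  have "\<exists>\<gamma> s' t'. \<gamma> \<noteq> 0 \<and> Polynomial.degree \<gamma> \<le> n \<and> (s', t') \<noteq> (0, 0) \<and> \<beta> = \<gamma> * [:t', s':]"
  proof (cases "Polynomial.degree \<beta> \<le> n")
    case True
    then show ?thesis using Suc.prems by (intro exI[of _ \<beta>] exI[of _ 0] exI[of _ 1]) auto
  next
    case False
    then obtain p where "poly \<beta> p = 0"
      using alg_closed_imp_poly_has_root[of \<beta>] by auto
    then obtain \<gamma> where \<gamma>: "\<beta> = [:- p, 1:] * \<gamma>"
      by (auto simp: poly_eq_0_iff_dvd)
    then have "\<gamma> \<noteq> 0" using Suc.prems by auto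
    then have "Polynomial.degree \<beta> = 1 + Polynomial.degree \<gamma>"
      unfolding \<gamma> by (subst degree_mult_eq) auto
    then show ?thesis
      using Suc.prems \<gamma> \<open>\<gamma> \<noteq> 0\<close> by (intro exI[of _ \<gamma>] exI[of _ 1] exI[of _ "- p"]) (auto simp: mult.commute)
  qed
  then obtain \<gamma> s' t' where \<gamma>: "\<gamma> \<noteq> 0" "Polynomial.degree \<gamma> \<le> n" "(s', t') \<noteq> (0, 0)" "\<beta> = \<gamma> * [:t', s':]"
    by blast
  obtain c s t where IH: "c \<noteq> 0" "\<forall>j<n. (s j, t j) \<noteq> (0, 0)" "\<gamma> = [:c:] * (\<Prod>j<n. [:t j, s j:])"
    using Suc.IH[OF \<gamma>(1,2)] by blast
  have "(\<Prod>j<n. [:(t(n := t')) j, (s(n := s')) j:]) = (\<Prod>j<n. [:t j, s j:])"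
    by (intro prod.cong) auto
  then have "\<beta> = [:c:] * (\<Prod>j<Suc n. [:(t(n := t')) j, (s(n := s')) j:])"
    unfolding prod.lessThan_Suc \<gamma>(4) IH(3) by (simp only: fun_upd_same mult.assoc)
  moreover have "\<forall>j<Suc n. ((s(n := s')) j, (t(n := t')) j) \<noteq> (0, 0)"
    using IH(2) \<gamma>(3) by (auto simp: less_Suc_eq)
  ultimately show ?case using IH(1) by blast
qed

text \<open>The coordinates are read as coefficients of a polynomial, which is factored. Its leading
  scalar \<open>c\<close> only contributes a power, by homogeneity.\<close>

lemma form_at_product:
  fixes x :: "nat \<Rightarrow> 'k::alg_closed_field"
  assumes "\<exists>j\<le>n. x j \<noteq> 0"
  obtains c s t where "c \<noteq> 0" "\<And>j. j < n \<Longrightarrow> (s j, t j) \<noteq> (0, 0)"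
    "\<And>d h (p :: (nat, 'r::comm_ring_1) mpoly). p \<in> forms {..n} d \<Longrightarrow> h 0 = 0 \<Longrightarrow>
      msubst h x p = c ^ d * msubst h (coeff (\<Prod>j<n. [:t j, s j:])) p"
proof -
  define \<beta> where "\<beta> = (\<Sum>j\<le>n. monom (x j) j)"
  have coeff: "coeff \<beta> l = (if l \<le> n then x l else 0)" for l
    by (simp add: \<beta>_def coeff_sum)
  have "\<beta> \<noteq> 0"
    using assms coeff by (metis coeff_0)
  moreover have "Polynomial.degree \<beta> \<le> n"
    by (rule degree_le) (simp add: coeff)
  ultimately obtain c s t where cst: "c \<noteq> 0" "\<forall>j<n. (s j, t j) \<noteq> (0, 0)" "\<beta> = [:c:] * (\<Prod>j<n. [:t j, s j:])"
    using linear_factorization by blast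
  show thesis
  proof (rule that[of c s t])
    fix d h and p :: "(nat, 'r) mpoly" assume p: "p \<in> forms {..n} d"
    have "msubst h x p = msubst h (\<lambda>l. c * coeff (\<Prod>j<n. [:t j, s j:]) l) p"
    proof (rule msubst_cong[OF p])
      fix l assume "l \<in> {..n}"
      then have "x l = coeff \<beta> l" by (simp add: coeff)
      then show "x l = c * coeff (\<Prod>j<n. [:t j, s j:]) l"
        unfolding cst(3) by simp
    qed
    then show "msubst h x p = c ^ d * msubst h (coeff (\<Prod>j<n. [:t j, s j:])) p"
      by (simp add: msubst_scale[OF p])
  qed (use cst in auto)
qed

text \<open>
  Column \<open>b\<close> lists the coefficients at the monomials \<open>eb\<close> of the combination of the pulled back forms with the
  multipliers \<open>v b\<close>. It is linear in the coefficients of the forms, which may themselves be polynomials in parameters.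
\<close>
definition elim_mat :: "nat \<Rightarrow> nat \<Rightarrow> ('k::comm_ring_1 \<Rightarrow> 'r::comm_ring_1) \<Rightarrow> (nat \<Rightarrow> (nat, 'r) mpoly) \<Rightarrow> nat \<Rightarrow>
    (nat \<Rightarrow> nat \<Rightarrow>\<^sub>0 int) \<Rightarrow> (nat \<Rightarrow> nat \<Rightarrow> 'k laurent) \<Rightarrow> 'r mat" where
  "elim_mat n r \<iota> g D eb v = mat D D (\<lambda>(c, b). \<Sum>i<r. \<Sum>m\<in>keys (g i).
     lookup (g i) m * \<iota> (lookup (v b i * mon (root_coeff n 1) m) (eb c)))"

abbreviation pullback :: "nat \<Rightarrow> ('r::zero \<Rightarrow> 'k) \<Rightarrow> (nat, 'r) mpoly \<Rightarrow> 'k::comm_ring_1 laurent" where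
  "pullback n h \<equiv> msubst (\<lambda>c. lcst (h c :: 'k)) (root_coeff n 1)"

lemma elim_mat_hom:
  assumes "comm_ring_hom h" "\<And>a. h (\<iota> a) = a" "c < D" "b < D"
  shows "h (elim_mat n r \<iota> g D eb v $$ (c, b)) =
    lookup (\<Sum>i<r. v b i * pullback n h (g i)) (eb c)"
proof -
  interpret comm_ring_hom h by (rule assms)
  have "h (elim_mat n r \<iota> g D eb v $$ (c, b)) = (\<Sum>i<r. \<Sum>m\<in>keys (g i).
     h (lookup (g i) m) * lookup (v b i * mon (root_coeff n 1) m) (eb c))"
    using assms by (simp add: elim_mat_def hom_sum hom_mult)
  also have "\<dots> = (\<Sum>i<r. lookup (v b i * pullback n h (g i)) (eb c))"
    by (simp add: msubst_def sum_distrib_left lookup_sum mult.left_commute[of "v _ _"] lookup_lcst_mult flip: mon_def)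
  finally show ?thesis by (simp add: lookup_sum)
qed

lemma root_coeff_box [simp]: "root_coeff n 1 l \<in> box n (\<lambda>_. 1)"
  by (rule root_coeff_in_box)

lemma combination_in_box:
  assumes "\<And>i. i < r \<Longrightarrow> g i \<in> forms V d" "\<And>i. i < r \<Longrightarrow> w i \<in> box n (sub_deg (int d))"
  shows "(\<Sum>i<r. w i * pullback n h (g i)) \<in> box n (top_deg (int d))"
proof (rule laur_sum)
  fix i assume "i \<in> {..<r}"
  then show "w i * pullback n h (g i) \<in> box n (top_deg (int d))"
    using assms by (intro laur_mult[OF _ msubst_in_box[of _ V d]]) (auto simp: sub_deg_def top_deg_def algebra_simps)
qed

lemma top_deg_nonneg: "d > 0 \<Longrightarrow> 0 \<le> top_deg (int d) j"
proof -
  assume d: "d > 0"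
  have "top_deg (int d) j = int j * int d + 2 * int d - 1" by (simp add: top_deg_def algebra_simps)
  moreover have "int j * int d \<ge> 0" by simp
  ultimately show ?thesis using d by linarith
qed

text \<open>
  A common zero defines a nonzero functional on the forms of the top multidegree which vanishes on
  all columns of the matrix.
\<close>
lemma det_elim_mat_zero:
  fixes h :: "'r::comm_ring_1 \<Rightarrow> 'k::alg_closed_field"
  assumes h: "comm_ring_hom h" "\<And>a. h (\<iota> a) = a" and d: "d > 0"
    and g: "\<And>i. i < r \<Longrightarrow> g i \<in> forms {..n} d"
    and eb: "bij_betw eb {..<D} (box_exps n (top_deg (int d)))"
    and v: "\<And>b i. b < D \<Longrightarrow> i < r \<Longrightarrow> v b i \<in> box n (sub_deg (int d))"
    and x: "\<exists>j\<le>n. x j \<noteq> 0" "\<And>i. i < r \<Longrightarrow> msubst h x (g i) = 0"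
  shows "h (det (elim_mat n r \<iota> g D eb v)) = 0"
proof -
  interpret comm_ring_hom h by (rule h)
  obtain c s t where cst: "c \<noteq> 0" "\<And>j. j < n \<Longrightarrow> (s j, t j) \<noteq> (0, 0)"
    "\<And>d h (p :: (nat, 'r) mpoly). p \<in> forms {..n} d \<Longrightarrow> h 0 = 0 \<Longrightarrow>
      msubst h x p = c ^ d * msubst h (coeff (\<Prod>j<n. [:t j, s j:])) p"
    by (rule form_at_product[OF x(1), where 'r = 'r]) blast
  let ?a = "top_deg (int d)"
  let ?M = "elim_mat n r \<iota> g D eb v"
  let ?ev = "mhom_eval n ?a s t"
  have M: "?M \<in> carrier_mat D D" by (simp add: elim_mat_def)
  have ev0: "mhom_eval n (\<lambda>_. int d) s t (pullback n h (g i)) = 0" if "i < r" for i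
  proof -
    have "mhom_eval n (\<lambda>_. int d) s t (pullback n h (g i)) = msubst h (coeff (\<Prod>j<n. [:t j, s j:])) (g i)"
      by (subst mhom_eval_msubst[OF g[OF that]]) (simp_all add: mhom_eval_root_coeff)
    moreover have "c ^ d * msubst h (coeff (\<Prod>j<n. [:t j, s j:])) (g i) = 0"
      using cst(3)[OF g[OF that], of h] x(2)[OF that] by simp
    ultimately show ?thesis using cst(1) by simp
  qed
  have col: "(\<Sum>c<D. h (?M $$ (c, b)) * ?ev (single (eb c) 1)) = 0" if b: "b < D" for b
  proof -
    let ?w = "\<Sum>i<r. v b i * pullback n h (g i)"
    have "(\<Sum>c<D. h (?M $$ (c, b)) * ?ev (single (eb c) 1)) =
        ?ev (\<Sum>c<D. lcst (lookup ?w (eb c)) * single (eb c) 1)"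
      unfolding mhom_eval_sum mhom_eval_lcst_mult using b
      by (intro sum.cong refl) (simp add: elim_mat_hom[of h \<iota>, OF h])
    also have "\<dots> = ?ev ?w"
      using box_expand[OF combination_in_box eb, of r g "{..n}" "v b" h] g v[OF b] by simp
    also have "\<dots> = (\<Sum>i<r. mhom_eval n (sub_deg (int d)) s t (v b i) * mhom_eval n (\<lambda>_. int d) s t (pullback n h (g i)))"
      unfolding mhom_eval_sum
    proof (intro sum.cong refl mhom_eval_mult)
      fix i assume i: "i \<in> {..<r}"
      then show "v b i \<in> box n (sub_deg (int d))" using v[OF b] by simp
      show "pullback n h (g i) \<in> box n (\<lambda>_. int d)"
        by (rule msubst_in_box[OF g]) (use i in auto)
    qed (auto simp: sub_deg_def top_deg_def algebra_simps)
    also have "\<dots> = 0" by (simp add: ev0)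
    finally show ?thesis .
  qed
  have zero: "h (det ?M) * ?ev (single (eb c) 1) = 0" if "c < D" for c
    using adj_mat_vec[OF M h(1) that, of "\<lambda>c. ?ev (single (eb c) 1)"] col by simp
  \<comment> \<open>The functional is not zero: at this corner monomial its value is a product of
    top powers of \<open>s j\<close> where \<open>s j\<close> is nonzero, and of \<open>t j\<close>
    elsewhere.\<close>
  define e where "e = Abs_poly_mapping (\<lambda>j. if j < n \<and> s j \<noteq> 0 then ?a j else 0)"
  have le: "lookup e = (\<lambda>j. if j < n \<and> s j \<noteq> 0 then ?a j else 0)"
    unfolding e_def by (rule lookup_Abs_poly_mapping) (rule finite_subset[of _ "{..<n}"], auto)
  have "e \<in> box_exps n ?a"
    using top_deg_nonneg[OF d] by (auto simp: box_exps_def le)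
  then obtain c where c: "c < D" "eb c = e"
    using eb unfolding bij_betw_def by (metis imageE lessThan_iff)
  have "?ev (single e 1) \<noteq> 0"
    unfolding mhom_eval_single using cst(2) by (auto simp: le)
  then show ?thesis using zero[OF c(1)] c(2) by simp
qed

text \<open>The multipliers are chosen to reach the monomials under \<open>h0\<close>, so the matrix
  becomes the identity and its determinant \<open>P\<close> becomes 1 there. With the multipliers
  fixed, the columns remain combinations of the forms under every other \<open>h\<close>, and a
  common zero forces the determinant to vanish.\<close>

theorem elimination:
  fixes g :: "nat \<Rightarrow> (nat, 'r::comm_ring_1) mpoly" and \<iota> :: "'k::alg_closed_field \<Rightarrow> 'r"
  assumes g: "\<And>i. i < r \<Longrightarrow> g i \<in> forms {..n} d" and d: "d > 0"
    and h0: "comm_ring_hom h0" "\<And>a. h0 (\<iota> a) = a"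
    and nz: "\<And>x. \<exists>j\<le>n. x j \<noteq> 0 \<Longrightarrow> \<exists>i<r. msubst h0 x (g i) \<noteq> 0"
  obtains P where "h0 P \<noteq> 0"
    "\<And>h x. comm_ring_hom h \<Longrightarrow> (\<And>a. h (\<iota> a) = a) \<Longrightarrow> \<exists>j\<le>n. x j \<noteq> 0 \<Longrightarrow>
       (\<And>i. i < r \<Longrightarrow> msubst h x (g i) = 0) \<Longrightarrow> h P = 0"
proof -
  interpret h0: comm_ring_hom h0 by (rule h0)
  define q where "q i = msubst (\<lambda>c. mconst (h0 c)) mvar (g i)" for i
  have q: "q i \<in> forms {..n} d" if "i < r" for i
  proof -
    have "q i \<in> forms {..n} (d * 1)"
      unfolding q_def by (rule msubst_forms[OF g[OF that]]) (auto simp: forms_mconst intro: forms_mvar[unfolded One_nat_def])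
    then show ?thesis by simp
  qed
  have mc: "(mconst 0 :: (nat, 'k) mpoly) = 0" by (simp add: mconst_def)
  have evq: "meval x (q i) = msubst h0 x (g i)" for x i
    unfolding q_def using hom_msubst[OF msubst_hom[OF id_hom], of "\<lambda>c. mconst (h0 c)" x mvar "g i"]
    by (simp add: mc)
  have pbq: "msubst lcst (root_coeff n 1) (q i) = pullback n h0 (g i)" for i
    unfolding q_def using hom_msubst[OF msubst_hom[OF lcst_hom], of "\<lambda>c. mconst (h0 c)" "root_coeff n 1" mvar "g i"]
    by (simp add: mc)
  have "no_common_zero r d n (\<lambda>i. msubst lcst (root_coeff n 1) (q i))"
    using nz by (intro no_common_zero_pullback[where n = n]) (auto simp: evq q)
  from no_common_zero_full_image[OF this d]
  have full: "full_image n r (int d) (\<lambda>i. pullback n h0 (g i))"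
    by (simp add: pbq)
  define D where "D = card (box_exps n (top_deg (int d)))"
  obtain eb where eb: "bij_betw eb {..<D} (box_exps n (top_deg (int d)))"
    unfolding D_def using ex_bij_betw_nat_finite[OF finite_box_exps] by (metis lessThan_atLeast0)
  have eb_in: "eb c \<in> box_exps n (top_deg (int d))" if "c < D" for c
    using eb that by (auto simp: bij_betw_def)
  have eb_inj: "eb c = eb b \<longleftrightarrow> c = b" if "c < D" "b < D" for c b
    using eb that by (auto simp: bij_betw_def inj_on_def)
  have "\<forall>b\<in>{..<D}. \<exists>v. (\<forall>i<r. v i \<in> box n (sub_deg (int d))) \<and>
      (\<Sum>i<r. v i * pullback n h0 (g i)) = single (eb b) 1"
    using full single_in_box[OF eb_in] unfolding full_image_def by blast
  from bchoice[OF this] obtain v where v: "\<And>b i. b < D \<Longrightarrow> i < r \<Longrightarrow> v b i \<in> box n (sub_deg (int d))"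
    "\<And>b. b < D \<Longrightarrow> (\<Sum>i<r. v b i * pullback n h0 (g i)) = single (eb b) 1"
    by auto
  let ?M = "elim_mat n r \<iota> g D eb v"
  have "map_mat h0 ?M = 1\<^sub>m D"
  proof (rule eq_matI)
    fix c b assume cb: "c < dim_row (1\<^sub>m D :: 'k mat)" "b < dim_col (1\<^sub>m D :: 'k mat)"
    then have "map_mat h0 ?M $$ (c, b) = h0 (?M $$ (c, b))"
      by (simp add: elim_mat_def)
    also have "\<dots> = lookup (single (eb b) 1) (eb c)"
      using cb v(2)[of b] by (simp add: elim_mat_hom[of h0 \<iota>, OF h0])
    also have "\<dots> = 1\<^sub>m D $$ (c, b)"
      using cb eb_inj[of b c] by (auto simp: lookup_single when_def)
    finally show "map_mat h0 ?M $$ (c, b) = 1\<^sub>m D $$ (c, b)" .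
  qed (auto simp: elim_mat_def)
  then have "h0 (det ?M) = 1"
    using h0.hom_det[of ?M] by simp
  show thesis
  proof (rule that[of "det ?M"])
    show "h0 (det ?M) \<noteq> 0" using \<open>h0 (det ?M) = 1\<close> by simp
    show "h (det ?M) = 0"
      if "comm_ring_hom h" "\<And>a. h (\<iota> a) = a" "\<exists>j\<le>n. x j \<noteq> 0" "\<And>i. i < r \<Longrightarrow> msubst h x (g i) = 0" for h x
      using that(1,2) d g eb v(1) that(3,4) by (rule det_elim_mat_zero)
  qed
qed

section \<open>The resultant\<close>

lemma eval_coords_hom: "comm_ring_hom (\<lambda>F. eval_coords F q)"
  unfolding eval_coords_def by (rule msubst_hom[OF id_hom])

lemma eval_coords_mconst [simp]: "eval_coords (mconst a) q = a"
  by (simp add: eval_coords_def)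

lemma eval_coords_mvar [simp]: "eval_coords (mvar (i, m)) q = lookup (q $ i) m"
  by (simp add: eval_coords_def)

definition generic_form :: "nat \<Rightarrow> nat \<Rightarrow> nat \<Rightarrow> (nat, (coord, 'k::comm_ring_1) mpoly) mpoly" where
  "generic_form n d i = (\<Sum>m\<in>monoms {..n} d. single m (mvar (i, m)))"

lemma lookup_generic_form: "lookup (generic_form n d i) m = (mvar (i, m) when m \<in> monoms {..n} d)"
proof -
  have "lookup (generic_form n d i) m = (\<Sum>m'\<in>monoms {..n} d. if m' = m then mvar (i, m) else 0)"
    unfolding generic_form_def lookup_sum by (intro sum.cong) (auto simp: lookup_single when_def)
  then show ?thesis by (simp add: finite_monoms when_def)
qed

lemma keys_generic_form: "keys (generic_form n d i) \<subseteq> monoms {..n} d"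
  by (auto simp: in_keys_iff lookup_generic_form when_def split: if_split_asm)

lemma generic_form_forms: "generic_form n d i \<in> forms {..n} d"
  using keys_generic_form by (simp add: forms_def)

lemma msubst_generic_form:
  assumes "q $ i \<in> forms {..n} d" "f 0 = 0" "h 0 = 0"
    and h: "\<And>m. m \<in> monoms {..n} d \<Longrightarrow> h (mvar (i, m)) = lookup (q $ i) m"
  shows "msubst (\<lambda>c. f (h c)) x (generic_form n d i) = msubst f x (q $ i)"
proof -
  have "msubst (\<lambda>c. f (h c)) x (generic_form n d i) =
      (\<Sum>m\<in>monoms {..n} d. f (h (lookup (generic_form n d i) m)) * mon x m)"
    by (rule msubst_superset) (auto simp: finite_monoms keys_generic_form[THEN subsetD] assms)
  also have "\<dots> = (\<Sum>m\<in>monoms {..n} d. f (lookup (q $ i) m) * mon x m)"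
    by (simp add: lookup_generic_form h)
  also have "\<dots> = msubst f x (q $ i)"
    by (rule msubst_superset[symmetric]) (use assms in \<open>auto simp: finite_monoms forms_def\<close>)
  finally show ?thesis .
qed

text \<open>The two cardinalities are the products of \<open>(j + 1) d\<close> and of
  \<open>(j + 2) d\<close>, whose quotient telescopes to \<open>n + 1\<close>.\<close>

lemma card_sub_top:
  "(n + 1) * card (box_exps n (sub_deg (int d))) = card (box_exps n (top_deg (int d)))"
proof (induction n)
  case (Suc n)
  have "sub_deg (int d) j + 1 = int ((j + 1) * d)" "top_deg (int d) j + 1 = int ((j + 2) * d)" for j
    by (simp_all add: sub_deg_def top_deg_def algebra_simps)
  then have eq: "nat (sub_deg (int d) j + 1) = (j + 1) * d" "nat (top_deg (int d) j + 1) = (j + 2) * d" for j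
    by (metis nat_int)+
  have IH: "(\<Prod>j<n. (j + 2) * d) = (n + 1) * (\<Prod>j<n. (j + 1) * d)"
    using Suc unfolding card_box_exps eq by simp
  have "(Suc n + 1) * (P * ((n + 1) * d)) = (n + 1) * P * ((n + 2) * d)" for P
    by (simp add: algebra_simps)
  then show ?case unfolding card_box_exps prod.lessThan_Suc eq IH .
qed (simp add: card_box_exps)

lemma forms_det:
  fixes M :: "('v, 'a::comm_ring_1) mpoly mat"
  assumes "M \<in> carrier_mat D D" "\<And>i j. i < D \<Longrightarrow> j < D \<Longrightarrow> M $$ (i, j) \<in> forms V 1"
  shows "det M \<in> forms V D"
proof -
  have "signof p * (\<Prod>i = 0..<D. M $$ (i, p i)) \<in> forms V D" if "p permutes {0..<D}" for p
  proof -
    have "(\<Prod>i = 0..<D. M $$ (i, p i)) \<in> forms V (\<Sum>i = 0..<D. 1)"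
    proof (rule forms_prod)
      fix i assume i: "i \<in> {0..<D}"
      then have "p i \<in> {0..<D}" using permutes_in_image[OF that] by blast
      then show "M $$ (i, p i) \<in> forms V 1" using assms(2) i by simp
    qed
    then show ?thesis by (auto simp: sign_def intro: forms_uminus)
  qed
  then show ?thesis
    unfolding det_def'[OF assms(1)] by (intro forms_sum) auto
qed

text \<open>Columns are indexed by pairs of a form and a multiplier monomial, so the matrix is that
  of the whole multiplication map. A common zero makes it singular; without one the map is
  surjective, and a square matrix with a right inverse has nonzero determinant. The entries are
  linear in the coefficients, so the degree of \<open>F\<close> is the size
  \<open>D\<close>.\<close>

theorem resultant:
  assumes d: "d > 0"
  obtains r F where "r > 0" "F \<in> forms (coords n d) r"
    "\<And>q :: 'k::alg_closed_field tuple. q \<in> tuples n d \<Longrightarrow>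
      eval_coords F q \<noteq> 0 \<longleftrightarrow> (\<forall>x. (\<exists>j\<le>n. x j \<noteq> 0) \<longrightarrow> (\<exists>i<n + 1. meval x (q $ i) \<noteq> 0))"
proof -
  let ?top = "box_exps n (top_deg (int d))" and ?sub = "box_exps n (sub_deg (int d))"
  define D where "D = card ?top"
  obtain eb where eb: "bij_betw eb {..<D} ?top"
    unfolding D_def using ex_bij_betw_nat_finite[OF finite_box_exps] by (metis lessThan_atLeast0)
  have "card ({..<n + 1} \<times> ?sub) = D"
    unfolding D_def card_sub_top[symmetric] by (simp add: card_cartesian_product)
  then obtain cb where cb: "bij_betw cb {..<D} ({..<n + 1} \<times> ?sub)"
    using ex_bij_betw_nat_finite[of "{..<n + 1} \<times> ?sub"] finite_box_exps by (metis finite_SigmaI finite_lessThan lessThan_atLeast0)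
  have eb_in: "eb c \<in> ?top" if "c < D" for c
    using eb that by (auto simp: bij_betw_def)
  have eb_inj: "eb c = eb b \<longleftrightarrow> c = b" if "c < D" "b < D" for c b
    using eb that by (auto simp: bij_betw_def inj_on_def)
  have cb_in: "fst (cb b) < n + 1" "snd (cb b) \<in> ?sub" if "b < D" for b
    using bij_betw_apply[OF cb, of b] that by (simp_all add: mem_Times_iff)
  define v :: "nat \<Rightarrow> nat \<Rightarrow> 'k laurent" where
    "v b i = (if i = fst (cb b) then single (snd (cb b)) 1 else 0)" for b i
  have v: "v b i \<in> box n (sub_deg (int d))" if "b < D" for b i
    unfolding v_def by (auto intro: single_in_box cb_in(2)[OF that])
  let ?g = "generic_form n d :: nat \<Rightarrow> (nat, (coord, 'k) mpoly) mpoly"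
  define M where "M = elim_mat n (n + 1) mconst ?g D eb v"
  have M: "M \<in> carrier_mat D D" by (simp add: M_def elim_mat_def)
  show thesis
  proof (rule that[of D "det M"])
    have "nat (top_deg (int d) j + 1) > 0" for j
      using top_deg_nonneg[OF d, of j] by simp
    then show "D > 0" unfolding D_def card_box_exps by (intro prod_pos) auto
    show "det M \<in> forms (coords n d) D"
    proof (rule forms_det[OF M])
      fix c b assume cb: "c < D" "b < D"
      have entry: "lookup (?g i) m * mconst a \<in> forms (coords n d) 1"
        if i: "i < n + 1" and m: "m \<in> keys (?g i)" for i m a
      proof -
        have "m \<in> monoms {..n} d" using keys_generic_form m by blast
        then have "mvar (i, m) \<in> (forms (coords n d) 1 :: (coord, 'k) mpoly set)"
          using i by (intro forms_mvar) (auto simp: coords_def)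
        then show ?thesis
          using forms_scale \<open>m \<in> monoms {..n} d\<close> by (simp add: lookup_generic_form mult.commute)
      qed
      have "M $$ (c, b) = (\<Sum>i<n + 1. \<Sum>m\<in>keys (?g i). lookup (?g i) m *
          mconst (lookup (v b i * mon (root_coeff n 1) m) (eb c)))"
        using cb by (simp add: M_def elim_mat_def del: sum.lessThan_Suc)
      also have "\<dots> \<in> forms (coords n d) 1"
        by (intro forms_sum entry) auto
      finally show "M $$ (c, b) \<in> forms (coords n d) 1" .
    qed
    fix q :: "'k tuple" assume q: "q \<in> tuples n d"
    then have qf: "q $ i \<in> forms {..n} d" if "i < n + 1" for i
      using that by (auto simp: tuples_def)
    let ?h = "\<lambda>F. eval_coords F q"
    interpret h: comm_ring_hom ?h by (rule eval_coords_hom)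
    have gen: "msubst (\<lambda>c. f (?h c)) x (?g i) = msubst f x (q $ i)" if "i < n + 1" "f 0 = 0" for f x i
      by (rule msubst_generic_form[OF qf]) (use that in auto)
    have gen': "msubst ?h x (?g i) = meval x (q $ i)" if "i < n + 1" for x i
      using gen[of i id x] that by (simp add: id_def)
    show "?h (det M) \<noteq> 0 \<longleftrightarrow> (\<forall>x. (\<exists>j\<le>n. x j \<noteq> 0) \<longrightarrow> (\<exists>i<n + 1. meval x (q $ i) \<noteq> 0))"
    proof (intro iffI allI impI)
      fix x :: "nat \<Rightarrow> 'k" assume ne: "?h (det M) \<noteq> 0" and x: "\<exists>j\<le>n. x j \<noteq> 0"
      show "\<exists>i<n + 1. meval x (q $ i) \<noteq> 0"
      proof (rule ccontr)
        assume "\<not> (\<exists>i<n + 1. meval x (q $ i) \<noteq> 0)"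
        then have zero: "msubst ?h x (?g i) = 0" if "i < n + 1" for i
          using gen'[OF that] that by auto
        have "?h (det (elim_mat n (n + 1) mconst ?g D eb v)) = 0"
          using eval_coords_hom eval_coords_mconst d generic_form_forms eb v x zero
          by (rule det_elim_mat_zero)
        with ne show False by (simp add: M_def)
      qed
    next
      assume nz: "\<forall>x. (\<exists>j\<le>n. x j \<noteq> 0) \<longrightarrow> (\<exists>i<n + 1. meval x (q $ i) \<noteq> 0)"
      define f where "f i = msubst lcst (root_coeff n 1) (q $ i)" for i
      have "no_common_zero (n + 1) d n f"
        unfolding f_def using nz by (intro no_common_zero_pullback[where n = n]) (auto simp: qf)
      from no_common_zero_full_image[OF this d] have full: "full_image n (n + 1) (int d) f" by blast
      have "\<forall>c\<in>{..<D}. \<exists>u. (\<forall>i<n + 1. u i \<in> box n (sub_deg (int d))) \<and>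
          (\<Sum>i<n + 1. u i * f i) = single (eb c) 1"
        using full single_in_box[OF eb_in] unfolding full_image_def by blast
      from bchoice[OF this] obtain u where u: "\<And>c i. c < D \<Longrightarrow> i < n + 1 \<Longrightarrow> u c i \<in> box n (sub_deg (int d))"
        "\<And>c. c < D \<Longrightarrow> (\<Sum>i<n + 1. u c i * f i) = single (eb c) 1"
        by auto
      \<comment> \<open>The coordinates of a preimage of each monomial form a column of the right
        inverse.\<close>
      define y where "y b c = lookup (u c (fst (cb b))) (snd (cb b))" for b c
      have comb: "(\<Sum>b<D. lcst (y b c) * (single (snd (cb b)) 1 * f (fst (cb b)))) = single (eb c) 1"
        if c: "c < D" for c
      proof -
        have "(\<Sum>b<D. lcst (y b c) * (single (snd (cb b)) 1 * f (fst (cb b)))) =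
            (\<Sum>(i, e)\<in>{..<n + 1} \<times> ?sub. single e (lookup (u c i) e) * f i)"
          by (subst sum.reindex_bij_betw[OF cb, symmetric])
            (auto simp: y_def case_prod_beta mult_single mult.assoc[symmetric])
        also have "\<dots> = (\<Sum>i<n + 1. (\<Sum>e\<in>?sub. single e (lookup (u c i) e)) * f i)"
          by (subst sum.cartesian_product[symmetric]) (simp add: sum_distrib_right)
        also have "\<dots> = (\<Sum>i<n + 1. u c i * f i)"
          using u(1)[OF c] by (intro sum.cong refl) (subst sum_singles, auto simp: finite_box_exps keys_box)
        finally show ?thesis using u(2)[OF c] by simp
      qed
      have "map_mat ?h M * mat D D (\<lambda>(b, c). y b c) = 1\<^sub>m D"
      proof (rule eq_matI)
        fix c' c assume cc: "c' < dim_row (1\<^sub>m D :: 'k mat)" "c < dim_col (1\<^sub>m D :: 'k mat)"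
        have entry: "?h (M $$ (c', b)) = lookup (single (snd (cb b)) 1 * f (fst (cb b))) (eb c')"
          if b: "b < D" for b
        proof -
          have "?h (M $$ (c', b)) = lookup (\<Sum>i<n + 1. v b i * pullback n ?h (?g i)) (eb c')"
            unfolding M_def using cc b
            by (intro elim_mat_hom[OF eval_coords_hom]) auto
          also have "(\<Sum>i<n + 1. v b i * pullback n ?h (?g i)) =
              (\<Sum>i<n + 1. if i = fst (cb b) then single (snd (cb b)) 1 * f (fst (cb b)) else 0)"
            by (intro sum.cong refl) (auto simp: v_def f_def gen)
          also have "\<dots> = single (snd (cb b)) 1 * f (fst (cb b))"
            using cb_in(1)[OF b] by simp
          finally show ?thesis .
        qed
        have "(map_mat ?h M * mat D D (\<lambda>(b, c). y b c)) $$ (c', c) = (\<Sum>b<D. ?h (M $$ (c', b)) * y b c)"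
          using cc M by (simp add: scalar_prod_def lessThan_atLeast0)
        also have "\<dots> = lookup (\<Sum>b<D. lcst (y b c) * (single (snd (cb b)) 1 * f (fst (cb b)))) (eb c')"
          unfolding lookup_sum lookup_lcst_mult by (intro sum.cong refl) (simp add: entry)
        also have "\<dots> = 1\<^sub>m D $$ (c', c)"
          using cc comb[of c] eb_inj[of c c'] by (auto simp: lookup_single when_def)
        finally show "(map_mat ?h M * mat D D (\<lambda>(b, c). y b c)) $$ (c', c) = 1\<^sub>m D $$ (c', c)" .
      qed (use M in auto)
      then have "det (map_mat ?h M) * det (mat D D (\<lambda>(b, c). y b c)) = 1"
        using M by (subst det_mult[symmetric]) auto
      then show "?h (det M) \<noteq> 0"
        by (auto simp: h.hom_det)
    qed
  qed
qed

declare sum.lessThan_Suc [simp del] sum.op_ivl_Suc [simp del]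

section \<open>Forms as functions\<close>

text \<open>Over a finite field, 1 plus the product of all \<open>X - a\<close> takes only the value
  1, so it is a nonconstant polynomial without a root.\<close>

lemma infinite_UNIV_alg_closed: "infinite (UNIV :: 'k::alg_closed_field set)"
proof
  assume fin: "finite (UNIV :: 'k set)"
  define P :: "'k poly" where "P = (\<Prod>a\<in>UNIV. [:- a, 1:])"
  have "P \<noteq> 0" unfolding P_def using fin by (simp add: prod_zero_iff)
  have one: "poly (1 + P) a = 1" for a
    unfolding P_def using fin by (simp add: poly_prod)
  have "Polynomial.degree (1 + P) = 0"
    using alg_closed_imp_poly_has_root[of "1 + P"] one by force
  then obtain c where "1 + P = [:c:]" by (auto elim: degree_eq_zeroE)
  then have "1 + P = 1" using one[of 0] by simp
  with \<open>P \<noteq> 0\<close> show False by simp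
qed

lemma digits_unique:
  fixes a b :: "nat \<Rightarrow> nat"
  assumes "\<And>j. a j < B" "\<And>j. b j < B" "(\<Sum>j<N. a j * B ^ j) = (\<Sum>j<N. b j * B ^ j)" "j < N"
  shows "a j = b j"
  using assms
proof (induction N arbitrary: a b j)
  case (Suc N)
  have split: "(\<Sum>j<Suc N. c j * B ^ j) = c 0 + B * (\<Sum>j<N. c (Suc j) * B ^ j)" for c
    by (subst sum.lessThan_Suc_shift) (simp add: sum_distrib_left ac_simps)
  have eq: "a 0 + B * (\<Sum>j<N. a (Suc j) * B ^ j) = b 0 + B * (\<Sum>j<N. b (Suc j) * B ^ j)"
    using Suc.prems(3) unfolding split .
  from arg_cong[OF eq, of "\<lambda>x. x mod B"] have a0: "a 0 = b 0"
    using Suc.prems(1,2) by simp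
  have "B \<noteq> 0" using Suc.prems(1)[of 0] by simp
  with eq a0 have "(\<Sum>j<N. a (Suc j) * B ^ j) = (\<Sum>j<N. b (Suc j) * B ^ j)" by simp
  then have "a (Suc i) = b (Suc i)" if "i < N" for i
    using Suc.IH[of "\<lambda>j. a (Suc j)" "\<lambda>j. b (Suc j)" i] Suc.prems(1,2) that by simp
  then show ?case using a0 Suc.prems(4) by (cases j) auto
qed simp

text \<open>
  Kronecker substitution: on the curve \<open>t \<mapsto> (t, t ^ B, t ^ (B ^ 2), \<dots>)\<close> with \<open>B = d + 1\<close>, distinct monomials of degree \<open>d\<close>
  restrict to distinct powers of \<open>t\<close>, so finitely many points of the curve detect all forms of degree \<open>d\<close>.
\<close>
lemma test_points:
  obtains T :: "(nat \<Rightarrow> 'k::alg_closed_field) set" where "finite T"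
    "\<And>p. p \<in> forms {..n} d \<Longrightarrow> (\<And>x. x \<in> T \<Longrightarrow> meval x p = 0) \<Longrightarrow> p = 0"
proof -
  let ?B = "d + 1"
  define wt where "wt m = (\<Sum>j<n + 1. lookup m j * ?B ^ j)" for m :: "nat monom"
  have inj: "m = m'" if m: "m \<in> monoms {..n} d" "m' \<in> monoms {..n} d" "wt m = wt m'" for m m'
  proof (rule poly_mapping_eqI)
    fix j
    have le: "lookup m j < ?B" if "m \<in> monoms {..n} d" for m and j :: nat
    proof (cases "j \<in> {..n}")
      case True
      have "lookup m j \<le> (\<Sum>v\<in>{..n}. lookup m v)"
        using True by (intro member_le_sum) auto
      then show ?thesis using that mdeg_superset[of "{..n}" m] by (simp add: monoms_iff)
    next
      case False
      then have "j \<notin> keys m" using that by (auto simp: monoms_iff)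
      then show ?thesis by (simp add: in_keys_iff)
    qed
    show "lookup m j = lookup m' j"
    proof (cases "j < n + 1")
      case True
      then show ?thesis
        using digits_unique[of "lookup m" ?B "lookup m'" "n + 1" j] le m
        by (simp add: wt_def)
    next
      case False
      then have "j \<notin> keys m" "j \<notin> keys m'" using m by (auto simp: monoms_iff)
      then show ?thesis by (simp add: in_keys_iff)
    qed
  qed
  define N where "N = (\<Sum>m\<in>monoms {..n} d. wt m)"
  have wtN: "wt m \<le> N" if "m \<in> monoms {..n} d" for m
    unfolding N_def using that by (intro member_le_sum) (auto simp: finite_monoms)
  \<comment> \<open>One point more than the bound \<open>N\<close> for the degree of the restriction
    to the curve.\<close>
  obtain S :: "'k set" where S: "finite S" "card S = Suc N"
    using infinite_arbitrarily_large[OF infinite_UNIV_alg_closed] by blast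
  let ?x = "\<lambda>t j. t ^ (?B ^ j) :: 'k"
  show thesis
  proof (rule that[of "?x ` S"])
    show "finite (?x ` S)" using S by simp
    fix p :: "(nat, 'k) mpoly" assume p: "p \<in> forms {..n} d" and zero: "\<And>x. x \<in> ?x ` S \<Longrightarrow> meval x p = 0"
    define P where "P = (\<Sum>m\<in>monoms {..n} d. monom (lookup p m) (wt m))"
    have mon: "mon (?x t) m = t ^ wt m" if "m \<in> monoms {..n} d" for t m
    proof -
      have "mon (?x t) m = (\<Prod>j<n + 1. ?x t j ^ lookup m j)"
        using that by (intro mon_superset) (auto simp: monoms_iff)
      also have "\<dots> = t ^ wt m"
        unfolding wt_def power_sum by (intro prod.cong) (auto simp: power_mult[symmetric] mult.commute)
      finally show ?thesis .
    qed
    have ev: "poly P t = meval (?x t) p" for t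
    proof -
      have "meval (?x t) p = (\<Sum>m\<in>monoms {..n} d. lookup p m * mon (?x t) m)"
        using p by (subst msubst_superset[of id "monoms {..n} d"]) (auto simp: finite_monoms forms_def)
      also have "\<dots> = (\<Sum>m\<in>monoms {..n} d. lookup p m * t ^ wt m)"
        by (intro sum.cong refl) (simp only: mon)
      finally show ?thesis by (simp add: P_def poly_sum poly_monom)
    qed
    have "P = 0"
    proof (rule ccontr)
      assume P0: "P \<noteq> 0"
      have "Polynomial.degree P \<le> N"
        unfolding P_def by (intro degree_sum_le) (auto simp: finite_monoms intro: order_trans[OF degree_monom_le wtN])
      moreover have "card S \<le> card {t. poly P t = 0}"
        using zero P0 by (intro card_mono poly_roots_finite) (auto simp: ev)
      moreover have "card {t. poly P t = 0} \<le> Polynomial.degree P"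
        using P0 by (rule card_poly_roots_bound)
      ultimately show False using S(2) by simp
    qed
    show "p = 0"
    proof (rule poly_mapping_eqI)
      fix m
      show "lookup p m = lookup 0 m"
      proof (cases "m \<in> monoms {..n} d")
        case True
        have "coeff P (wt m) = (\<Sum>m'\<in>monoms {..n} d. if m' = m then lookup p m' else 0)"
          unfolding P_def coeff_sum coeff_monom using inj True by (intro sum.cong) auto
        then show ?thesis using True \<open>P = 0\<close> by (simp add: finite_monoms)
      next
        case False
        then have "m \<notin> keys p" using p by (auto simp: forms_def)
        then show ?thesis by (simp add: in_keys_iff)
      qed
    qed
  qed
qed

lemma meval_hom: "comm_ring_hom (meval x :: (_, 'k::comm_ring_1) mpoly \<Rightarrow> 'k)"
  by (rule msubst_hom[OF id_hom])

lemma forms_eqI: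
  fixes p :: "(nat, 'k::alg_closed_field) mpoly"
  assumes "p \<in> forms {..n} d" "p' \<in> forms {..n} d" "\<And>x. meval x p = meval x p'"
  shows "p = p'"
proof -
  obtain T where T: "\<And>p :: (nat, 'k) mpoly. p \<in> forms {..n} d \<Longrightarrow> (\<And>x. x \<in> T \<Longrightarrow> meval x p = 0) \<Longrightarrow> p = 0"
    using test_points by metis
  have "meval x (p - p') = 0" for x
  proof -
    interpret comm_ring_hom "meval x :: (nat, 'k) mpoly \<Rightarrow> 'k" by (rule meval_hom)
    show ?thesis by (simp add: hom_minus assms(3))
  qed
  then show ?thesis using T[OF forms_diff[OF assms(1,2)]] by simp
qed

section \<open>The conjugation action on tuples\<close>

text \<open>Points are functions on all naturals of which only the values up to \<open>n\<close>
  count. Matrix entries beyond \<open>n\<close> are unspecified, so identities such as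
  \<open>mact_mult\<close> require \<open>i \<le> n\<close> and reach forms through
  \<open>meval_tuple_cong\<close>.\<close>

definition mact :: "nat \<Rightarrow> 'k::comm_ring_1 mat \<Rightarrow> (nat \<Rightarrow> 'k) \<Rightarrow> nat \<Rightarrow> 'k" where
  "mact n A x i = (\<Sum>j<n + 1. A $$ (i, j) * x j)"

lemma tuplesD: "q \<in> tuples n d \<Longrightarrow> i < n + 1 \<Longrightarrow> q $ i \<in> forms {..n} d"
  "q \<in> tuples n d \<Longrightarrow> q \<in> carrier_vec (n + 1)"
  by (auto simp: tuples_def)

lemma tuple_eqI:
  fixes q :: "'k::alg_closed_field tuple"
  assumes "q \<in> tuples n d" "q' \<in> tuples n d" "\<And>i x. i < n + 1 \<Longrightarrow> meval x (q $ i) = meval x (q' $ i)"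
  shows "q = q'"
proof (rule eq_vecI)
  fix i assume "i < dim_vec q'"
  then have "i < n + 1" using tuplesD(2)[OF assms(2)] by auto
  then show "q $ i = q' $ i"
    using assms by (intro forms_eqI[of _ n d] tuplesD(1)) auto
qed (use tuplesD(2)[OF assms(1)] tuplesD(2)[OF assms(2)] in auto)

lemma mact_mult:
  assumes "A \<in> carrier_mat (n + 1) (n + 1)" "B \<in> carrier_mat (n + 1) (n + 1)" "i \<le> n"
  shows "mact n (A * B) x i = mact n A (mact n B x) i"
proof -
  have "mact n (A * B) x i = (\<Sum>j<n + 1. \<Sum>l<n + 1. A $$ (i, l) * B $$ (l, j) * x j)"
    unfolding mact_def using assms
    by (intro sum.cong refl) (simp add: scalar_prod_def sum_distrib_right lessThan_atLeast0)
  also have "\<dots> = mact n A (mact n B x) i"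
    unfolding mact_def by (subst sum.swap) (simp add: sum_distrib_left mult.assoc)
  finally show ?thesis .
qed

lemma mact_1: "i \<le> n \<Longrightarrow> mact n (1\<^sub>m (Suc n)) x i = x i"
proof -
  assume i: "i \<le> n"
  have "mact n (1\<^sub>m (Suc n)) x i = (\<Sum>j<n + 1. if j = i then x i else 0)"
    unfolding mact_def using i by (intro sum.cong) auto
  then show ?thesis using i by simp
qed

lemma mact_scale: "mact n A (\<lambda>j. c * x j) = (\<lambda>i. c * mact n A x i)"
  by (rule ext) (simp add: mact_def sum_distrib_left ac_simps)

lemma mact_smult:
  "A \<in> carrier_mat (n + 1) (n + 1) \<Longrightarrow> i \<le> n \<Longrightarrow> mact n (c \<cdot>\<^sub>m A) x i = c * mact n A x i"
  by (simp add: mact_def sum_distrib_left ac_simps)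

lemma meval_tuple_cong:
  "q \<in> tuples n d \<Longrightarrow> i < n + 1 \<Longrightarrow> (\<And>j. j \<le> n \<Longrightarrow> x j = y j) \<Longrightarrow> meval x (q $ i) = meval y (q $ i)"
  using msubst_cong[of "q $ i" "{..n}" d x y] tuplesD(1)[of q n d i] by simp

lemma linear_form: "(\<Sum>l<n + 1. mconst (c l) * mvar l) \<in> forms {..n::nat} 1"
  by (intro forms_sum forms_scale forms_mvar) auto

lemma meval_linear_form: "meval (x :: nat \<Rightarrow> 'k) (\<Sum>l<n + 1. mconst (c l) * mvar l) = (\<Sum>l<n + 1. c l * x l :: 'k::comm_ring_1)"
proof -
  interpret comm_ring_hom "meval x :: (nat, 'k) mpoly \<Rightarrow> 'k" by (rule meval_hom)
  show ?thesis by (simp add: hom_sum hom_mult hom_add)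
qed

lemma precomp_tuples:
  assumes "q \<in> tuples n d"
  shows "precomp n q B \<in> tuples n d"
proof -
  have "precomp n q B $ i \<in> forms {..n} d" if "i < n + 1" for i
  proof -
    have "precomp n q B $ i \<in> forms {..n} (d * 1)"
      using that tuplesD(2)[OF assms] msubst_forms[OF tuplesD(1)[OF assms that], of _ "{..n}" 1 mconst, OF linear_form forms_mconst]
      by (simp add: precomp_def)
    then show ?thesis by simp
  qed
  then show ?thesis using tuplesD(2)[OF assms] by (auto simp: tuples_def precomp_def)
qed

lemma meval_precomp:
  assumes "q \<in> tuples n d" "i < n + 1"
  shows "meval x (precomp n q B $ i) = meval (mact n B x) (q $ i :: (nat, 'k::field) mpoly)"
proof -
  have "meval x (precomp n q B $ i) =
      msubst (\<lambda>c. meval x (mconst c)) (\<lambda>j. meval x (\<Sum>l<n + 1. mconst (B $$ (j, l)) * mvar l)) (q $ i)"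
    using assms tuplesD(2)[OF assms(1)] hom_msubst[OF meval_hom[of x], of mconst]
    by (simp add: precomp_def mconst_def)
  also have "\<dots> = msubst (\<lambda>c. c) (mact n B x) (q $ i)"
    unfolding meval_linear_form by (simp add: mact_def[abs_def])
  finally show ?thesis by (simp add: id_def)
qed

lemma SL_inverse:
  assumes "A \<in> SL m"
  obtains B where "mat_inverse A = Some B" "B \<in> SL m" "A * B = 1\<^sub>m m" "B * A = 1\<^sub>m m"
proof -
  have A: "A \<in> carrier_mat m m" "det A = 1" using assms by (auto simp: SL_def)
  have "mat_inverse A \<noteq> None"
    using mat_inverse(1)[OF A(1)] det_non_zero_imp_unit[OF A(1)] A(2) by fastforce
  then obtain B where B: "mat_inverse A = Some B" by blast
  from mat_inverse(2)[OF A(1) B] have B': "A * B = 1\<^sub>m m" "B * A = 1\<^sub>m m" "B \<in> carrier_mat m m" by auto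
  have "det A * det B = 1" using det_mult[OF A(1) B'(3)] B'(1) by simp
  then have "B \<in> SL m" using A B' by (simp add: SL_def)
  then show thesis using that B B' by blast
qed

lemma inverse_unique:
  fixes A :: "'a::comm_ring_1 mat"
  assumes "A \<in> carrier_mat m m" "B \<in> carrier_mat m m" "B' \<in> carrier_mat m m" "B * A = 1\<^sub>m m" "A * B' = 1\<^sub>m m"
  shows "B = B'"
proof -
  have "B = B * (A * B')" unfolding assms(5) using assms(2) by simp
  also have "\<dots> = (B * A) * B'" using assms by (intro assoc_mult_mat[symmetric]) auto
  also have "\<dots> = B'" using assms by simp
  finally show ?thesis .
qed

lemma conj_act_index:
  assumes "q \<in> tuples n d" "A \<in> carrier_mat (n + 1) (n + 1)" "i < n + 1"
  shows "conj_act n A q $ i = (\<Sum>j<n + 1. mconst (A $$ (i, j)) * (precomp n q (the (mat_inverse A)) $ j))"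
  using assms tuplesD(2)[OF precomp_tuples[OF assms(1)], of "the (mat_inverse A)"]
  by (simp add: conj_act_def scalar_prod_def lessThan_atLeast0)

lemma conj_act_tuples:
  assumes "q \<in> tuples n d" "A \<in> carrier_mat (n + 1) (n + 1)"
  shows "conj_act n A q \<in> tuples n d"
proof -
  have "conj_act n A q $ i \<in> forms {..n} d" if "i < n + 1" for i
    unfolding conj_act_index[OF assms that] using tuplesD(1)[OF precomp_tuples[OF assms(1)]]
    by (intro forms_sum forms_scale) auto
  moreover have "conj_act n A q \<in> carrier_vec (n + 1)"
    using assms(2) by (intro carrier_vecI) (simp add: conj_act_def)
  ultimately show ?thesis unfolding tuples_def by blast
qed

lemma meval_conj_act:
  assumes "q \<in> tuples n d" "A \<in> SL (n + 1)" "B \<in> carrier_mat (n + 1) (n + 1)" "A * B = 1\<^sub>m (n + 1)" "i < n + 1"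
  shows "meval x (conj_act n A q $ i) = (\<Sum>j<n + 1. A $$ (i, j) * meval (mact n B x) (q $ j :: (nat, 'k::field) mpoly))"
proof -
  interpret comm_ring_hom "meval x :: (nat, 'k) mpoly \<Rightarrow> 'k" by (rule meval_hom)
  have A: "A \<in> carrier_mat (n + 1) (n + 1)" using assms(2) by (simp add: SL_def)
  obtain B' where B': "mat_inverse A = Some B'" "B' \<in> SL (n + 1)" "B' * A = 1\<^sub>m (n + 1)"
    by (rule SL_inverse[OF assms(2)]) blast
  then have "B' = B"
    using inverse_unique[OF A _ assms(3) _ assms(4)] by (auto simp: SL_def)
  then show ?thesis
    unfolding conj_act_index[OF assms(1) A assms(5)] B'(1)
    by (simp add: hom_sum hom_mult hom_add meval_precomp[OF assms(1)] del: sum.lessThan_Suc)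
qed

lemma SL_1: "1\<^sub>m m \<in> SL m"
  by (simp add: SL_def)

lemma SL_mult: "A \<in> SL m \<Longrightarrow> B \<in> SL m \<Longrightarrow> A * B \<in> SL m"
  by (auto simp: SL_def det_mult)

lemma conj_act_1:
  fixes q :: "'k::alg_closed_field tuple"
  assumes "q \<in> tuples n d"
  shows "conj_act n (1\<^sub>m (n + 1)) q = q"
proof (rule tuple_eqI[OF conj_act_tuples[OF assms] assms])
  fix i x assume i: "i < n + 1"
  have "meval (mact n (1\<^sub>m (n + 1)) x) (q $ j) = meval x (q $ j)" if "j < n + 1" for j
    using that by (intro meval_tuple_cong[OF assms]) (auto simp: mact_1)
  then have "meval x (conj_act n (1\<^sub>m (n + 1)) q $ i) = mact n (1\<^sub>m (n + 1)) (\<lambda>j. meval x (q $ j)) i"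
    unfolding meval_conj_act[OF assms SL_1 one_carrier_mat right_mult_one_mat[OF one_carrier_mat] i] mact_def
    by (intro sum.cong) auto
  then show "meval x (conj_act n (1\<^sub>m (n + 1)) q $ i) = meval x (q $ i)"
    using i by (simp add: mact_1)
qed simp

lemma conj_act_mult:
  fixes q :: "'k::alg_closed_field tuple"
  assumes q: "q \<in> tuples n d" and A: "A \<in> SL (n + 1)" and B: "B \<in> SL (n + 1)"
  shows "conj_act n (A * B) q = conj_act n A (conj_act n B q)"
proof -
  obtain A' where A': "A' \<in> SL (n + 1)" "A * A' = 1\<^sub>m (n + 1)" "A' * A = 1\<^sub>m (n + 1)"
    by (rule SL_inverse[OF A]) blast
  obtain B' where B': "B' \<in> SL (n + 1)" "B * B' = 1\<^sub>m (n + 1)" "B' * B = 1\<^sub>m (n + 1)"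
    by (rule SL_inverse[OF B]) blast
  have car: "A \<in> carrier_mat (n + 1) (n + 1)" "B \<in> carrier_mat (n + 1) (n + 1)"
    "A' \<in> carrier_mat (n + 1) (n + 1)" "B' \<in> carrier_mat (n + 1) (n + 1)"
    using A B A' B' by (auto simp: SL_def)
  have inv: "(A * B) * (B' * A') = 1\<^sub>m (n + 1)"
  proof -
    have "(A * B) * (B' * A') = A * (B * B') * A'"
      using car by (simp add: assoc_mult_mat[of _ "n + 1" "n + 1" _ "n + 1" _ "n + 1"])
    then show ?thesis using car A'(2) B'(2) by simp
  qed
  have qB: "conj_act n B q \<in> tuples n d" by (rule conj_act_tuples[OF q car(2)])
  show ?thesis
  proof (rule tuple_eqI[OF conj_act_tuples[OF q] conj_act_tuples[OF qB car(1)]])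
    show "A * B \<in> carrier_mat (n + 1) (n + 1)" using car by simp
    fix i x assume i: "i < n + 1"
    have "meval (mact n (B' * A') x) (q $ j) = meval (mact n B' (mact n A' x)) (q $ j)" if "j < n + 1" for j
      using car by (intro meval_tuple_cong[OF q that] mact_mult) auto
    then have "meval x (conj_act n (A * B) q $ i) = mact n (A * B) (\<lambda>j. meval (mact n B' (mact n A' x)) (q $ j)) i"
      using meval_conj_act[OF q SL_mult[OF A B] _ inv i, of x] car
      unfolding mact_def by simp
    also have "\<dots> = mact n A (mact n B (\<lambda>j. meval (mact n B' (mact n A' x)) (q $ j))) i"
      using i by (intro mact_mult car) auto
    also have "\<dots> = meval x (conj_act n A (conj_act n B q) $ i)"
      unfolding meval_conj_act[OF qB A car(3) A'(2) i] mact_def[of n A]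
    proof (intro sum.cong refl arg_cong2[where f = "(*)"])
      fix j assume "j \<in> {..<n + 1}"
      then show "mact n B (\<lambda>j. meval (mact n B' (mact n A' x)) (q $ j)) j = meval (mact n A' x) (conj_act n B q $ j)"
        by (subst meval_conj_act[OF q B car(4) B'(2)]) (auto simp: mact_def)
    qed
    finally show "meval x (conj_act n (A * B) q $ i) = meval x (conj_act n A (conj_act n B q) $ i)" .
  qed
qed

text \<open>The condition in \<open>Hom\<close>, with functions in place of vectors as points;
  \<open>HomE\<close> translates.\<close>

definition nozero :: "nat \<Rightarrow> 'k::field tuple \<Rightarrow> bool" where
  "nozero n q \<longleftrightarrow> (\<forall>x. (\<exists>j\<le>n. x j \<noteq> 0) \<longrightarrow> (\<exists>i<n + 1. meval x (q $ i) \<noteq> 0))"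

lemma mact_inj:
  assumes "A \<in> carrier_mat (n + 1) (n + 1)" "B \<in> carrier_mat (n + 1) (n + 1)" "B * A = 1\<^sub>m (n + 1)"
    and "\<And>j. j \<le> n \<Longrightarrow> mact n A x j = 0" "i \<le> n"
  shows "x i = 0"
proof -
  have "x i = mact n B (mact n A x) i"
    using mact_mult[OF assms(2,1,5), of x] assms(3,5) by (simp add: mact_1)
  also have "\<dots> = 0" unfolding mact_def[of n B] using assms(4) by (intro sum.neutral) auto
  finally show ?thesis .
qed

lemma nozero_conj_act:
  fixes q :: "'k::alg_closed_field tuple"
  assumes q: "q \<in> tuples n d" and A: "A \<in> SL (n + 1)" and nz: "nozero n q"
  shows "nozero n (conj_act n A q)"
  unfolding nozero_def
proof (intro allI impI)
  fix x :: "nat \<Rightarrow> 'k" assume "\<exists>j\<le>n. x j \<noteq> 0"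
  then obtain j where j: "j \<le> n" "x j \<noteq> 0" by blast
  obtain B where B: "B \<in> SL (n + 1)" "A * B = 1\<^sub>m (n + 1)" "B * A = 1\<^sub>m (n + 1)"
    by (rule SL_inverse[OF A]) blast
  have car: "A \<in> carrier_mat (n + 1) (n + 1)" "B \<in> carrier_mat (n + 1) (n + 1)"
    using A B by (auto simp: SL_def)
  have "\<exists>i\<le>n. mact n B x i \<noteq> 0"
    using mact_inj[OF car(2,1) B(2) _ j(1), of x] j(2) by blast
  with nz have "\<exists>i<n + 1. meval (mact n B x) (q $ i) \<noteq> 0"
    unfolding nozero_def by blast
  then obtain i where i: "i \<le> n" "meval (mact n B x) (q $ i) \<noteq> 0"
    by (metis Suc_eq_plus1 less_Suc_eq_le)
  then have "\<exists>i\<le>n. mact n A (\<lambda>j. meval (mact n B x) (q $ j)) i \<noteq> 0"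
    using mact_inj[OF car B(3) _ i(1), of "\<lambda>j. meval (mact n B x) (q $ j)"] by blast
  then obtain i' where "i' \<le> n" "mact n A (\<lambda>j. meval (mact n B x) (q $ j)) i' \<noteq> 0" by blast
  then show "\<exists>i<n + 1. meval x (conj_act n A q $ i) \<noteq> 0"
    using meval_conj_act[OF q A car(2) B(2), of i' x] by (intro exI[of _ i']) (auto simp: mact_def)
qed

section \<open>Invariance of the resultant\<close>

lemma addrow_mat_SL: "k \<noteq> l \<Longrightarrow> addrow_mat m a k l \<in> SL m"
  by (simp add: SL_def det_addrow_mat)

text \<open>Gaussian elimination in which rows are only added to each other. No pivot is scaled: a
  nonzero entry below brings it to 1, and if there is none, adding the pivot row to the next row
  creates one. In the last column the determinant says that the pivot is already 1.\<close>

lemma SL_transvection_induct: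
  fixes A :: "'k::field mat"
  assumes "A \<in> SL m" and one: "P (1\<^sub>m m)"
    and step: "\<And>A a k l. A \<in> SL m \<Longrightarrow> k < m \<Longrightarrow> l < m \<Longrightarrow> k \<noteq> l \<Longrightarrow> P (addrow_mat m a k l * A) \<Longrightarrow> P A"
  shows "P A"
proof -
  define unit_cols where "unit_cols j A \<longleftrightarrow> (\<forall>c<j. \<forall>i<m. A $$ (i, c) = (if i = c then 1 else 0 :: 'k))" for j A
  have car: "A \<in> carrier_mat m m" if "A \<in> SL m" for A :: "'k mat" using that by (simp add: SL_def)
  have add_SL: "addrow a k l A \<in> SL m" if "A \<in> SL m" "l < m" "k \<noteq> l" for A :: "'k mat" and a k l
    unfolding addrow_mat[OF car[OF that(1)] that(2)] by (rule SL_mult[OF addrow_mat_SL[OF that(3)] that(1)])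
  have stepP: "P A" if "A \<in> SL m" "k < m" "l < m" "k \<noteq> l" "P (addrow a k l A)" for A a k l
    using step[OF that(1-4)] that(5) addrow_mat[OF car[OF that(1)] that(3)] by metis
  have entry: "addrow a k l A $$ (i, c) = (if k = i then a * A $$ (l, c) + A $$ (i, c) else A $$ (i, c))"
    if "A \<in> SL m" "i < m" "c < m" for A :: "'k mat" and a k l i c
    using car[OF that(1)] that by simp
  have cols_add: "unit_cols j (addrow a k l A)"
    if "A \<in> SL m" "unit_cols j A" "j \<le> l" "l < m" for A a j k l
    unfolding unit_cols_def
  proof (intro allI impI)
    fix c i assume "c < j" "i < m"
    then show "addrow a k l A $$ (i, c) = (if i = c then 1 else 0)"
      using that entry[OF that(1), of i c a k l] unfolding unit_cols_def by auto
  qed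
  have "P A" if "j \<le> m" "A \<in> SL m" "unit_cols j A" for j A
    using that
  proof (induction "m - j" arbitrary: j A)
    case 0
    then have "A = 1\<^sub>m m"
      using car[of A] by (intro eq_matI) (auto simp: unit_cols_def)
    then show ?case using one by simp
  next
    case (Suc k)
    then have j: "j < m" by simp
    \<comment> \<open>Once the pivot is 1, the other nonzero entries of the column are removed one
      at a time; their number is the measure.\<close>
    have clear: "P A" if "A \<in> SL m" "unit_cols j A" "A $$ (j, j) = 1" for A
      using that
    proof (induction "card {i. i < m \<and> i \<noteq> j \<and> A $$ (i, j) \<noteq> 0}" arbitrary: A rule: less_induct)
      case less
      let ?Z = "\<lambda>A. {i. i < m \<and> i \<noteq> j \<and> A $$ (i, j) \<noteq> 0}"
      show ?case
      proof (cases "?Z A = {}")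
        case True
        then have "unit_cols (Suc j) A"
          using less.prems(2,3) unfolding unit_cols_def by (auto simp: less_Suc_eq)
        then show ?thesis using Suc.hyps(1)[of "Suc j" A] Suc.hyps(2) j less.prems(1) by simp
      next
        case False
        then obtain i where i: "i < m" "i \<noteq> j" "A $$ (i, j) \<noteq> 0" by blast
        let ?A = "addrow (- A $$ (i, j)) i j A"
        have e: "?A $$ (i', j) = (if i' = i then 0 else A $$ (i', j))" if "i' < m" for i'
          using entry[OF less.prems(1) that j] less.prems(3) by simp
        have "?Z ?A \<subseteq> ?Z A" using e by (auto split: if_split_asm)
        moreover have "i \<in> ?Z A" "i \<notin> ?Z ?A" using i e[OF i(1)] by simp_all
        ultimately have "?Z ?A \<subset> ?Z A" by blast
        then have "card (?Z ?A) < card (?Z A)" by (intro psubset_card_mono) auto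
        then have "P ?A"
        proof (rule less.hyps)
          show "?A \<in> SL m" using less.prems(1) j i(2) by (rule add_SL)
          show "unit_cols j ?A" using less.prems(1,2) order_refl j by (rule cols_add)
          show "?A $$ (j, j) = 1" using e[OF j] i(2) less.prems(3) by simp
        qed
        then show ?thesis using stepP[OF less.prems(1) i(1) j i(2)] by blast
      qed
    qed
    have below: "P A" if A: "A \<in> SL m" "unit_cols j A" and i: "j < i" "i < m" "A $$ (i, j) \<noteq> 0" for A i
    proof (rule stepP[OF A(1) j i(2), of "(1 - A $$ (j, j)) / A $$ (i, j)"])
      show "P (addrow ((1 - A $$ (j, j)) / A $$ (i, j)) j i A)"
      proof (rule clear)
        show "addrow ((1 - A $$ (j, j)) / A $$ (i, j)) j i A $$ (j, j) = 1"
          using entry[OF A(1) j j] i(3) by simp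
      qed (use A i in \<open>auto intro: add_SL cols_add\<close>)
    qed (use i in auto)
    show ?case
    proof (cases "\<exists>i. j < i \<and> i < m \<and> A $$ (i, j) \<noteq> 0")
      case True
      then show ?thesis using below[OF Suc.prems(2,3)] by blast
    next
      case False
      have A: "A \<in> carrier_mat m m" "det A = 1" using Suc.prems(2) by (auto simp: SL_def)
      \<comment> \<open>If the pivot vanished together with all entries below it, the column would
        be a combination of the unit columns before it, and \<open>v\<close> would lie in the
        kernel.\<close>
      have jj: "A $$ (j, j) \<noteq> 0"
      proof
        assume z: "A $$ (j, j) = 0"
        define v where "v = vec m (\<lambda>c. if c = j then 1 else if c < j then - A $$ (c, j) else 0)"
        have "A *\<^sub>v v = 0\<^sub>v m"
        proof (rule eq_vecI)
          fix i assume "i < dim_vec (0\<^sub>v m :: 'k vec)"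
          then have i: "i < m" by simp
          have "(A *\<^sub>v v) $ i = (\<Sum>c<m. A $$ (i, c) * v $ c)"
            using A(1) i by (simp add: scalar_prod_def v_def lessThan_atLeast0)
          also have "\<dots> = (\<Sum>c<m. (if c = j then A $$ (i, j) else 0) - (if c = i \<and> i < j then A $$ (i, j) else 0))"
            using Suc.prems(3) i unfolding unit_cols_def by (intro sum.cong) (auto simp: v_def)
          also have "\<dots> = A $$ (i, j) - (if i < j then A $$ (i, j) else 0)"
            using i j by (cases "i < j") (simp_all add: sum_subtractf)
          also have "\<dots> = 0"
            using False z i by (cases "i = j") auto
          finally show "(A *\<^sub>v v) $ i = 0\<^sub>v m $ i" using i by simp
        qed (use A in auto)
        moreover have "v \<in> carrier_vec m" "v \<noteq> 0\<^sub>v m"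
          using j by (auto simp: v_def dest!: arg_cong[where f = "\<lambda>w. w $ j"])
        ultimately have "det A = 0" using det_0_iff_vec_prod_zero_field[OF A(1)] by blast
        then show False using A(2) by simp
      qed
      show ?thesis
      proof (cases "Suc j < m")
        case True
        show ?thesis
        proof (rule stepP[OF Suc.prems(2) True j, of 1])
          show "P (addrow 1 (Suc j) j A)"
          proof (rule below)
            show "addrow 1 (Suc j) j A $$ (Suc j, j) \<noteq> 0"
              using entry[OF Suc.prems(2) True j] jj False True by auto
          qed (use Suc.prems True j in \<open>auto intro: add_SL cols_add\<close>)
        qed simp
      next
        case False
        with j have m: "m = Suc j" by simp
        have "upper_triangular A"
          using A(1) Suc.prems(3) unfolding unit_cols_def by (intro upper_triangularI) (auto simp: m)
        from det_upper_triangular[OF this A(1)] A(1)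
        have "1 = (\<Prod>i = 0..<m. A $$ (i, i))"
          by (simp add: A(2) prod_list_diag_prod)
        also have "\<dots> = A $$ (j, j)"
          using Suc.prems(3) unfolding unit_cols_def by (simp add: m)
        finally show ?thesis using clear[OF Suc.prems(2,3)] by simp
      qed
    qed
  qed
  from this[of 0 A] show ?thesis using assms(1) by (simp add: unit_cols_def)
qed

section \<open>Polynomial dependence on one parameter\<close>

definition poly_family :: "('k \<Rightarrow> 'r::comm_ring_1) \<Rightarrow> ('k \<Rightarrow> 'r) \<Rightarrow> bool" where
  "poly_family \<iota> f \<longleftrightarrow> (\<exists>p. \<forall>s. f s = poly p (\<iota> s))"

lemma poly_family_const: "poly_family \<iota> (\<lambda>_. c)"
  unfolding poly_family_def by (rule exI[of _ "[:c:]"]) simp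

lemma poly_family_param: "poly_family \<iota> \<iota>"
  unfolding poly_family_def by (rule exI[of _ "[:0, 1:]"]) simp

lemma poly_family_add: "poly_family \<iota> f \<Longrightarrow> poly_family \<iota> g \<Longrightarrow> poly_family \<iota> (\<lambda>s. f s + g s)"
  unfolding poly_family_def by (metis poly_add)

lemma poly_family_mult: "poly_family \<iota> f \<Longrightarrow> poly_family \<iota> g \<Longrightarrow> poly_family \<iota> (\<lambda>s. f s * g s)"
  unfolding poly_family_def by (metis poly_mult)

lemma poly_family_uminus: "poly_family \<iota> f \<Longrightarrow> poly_family \<iota> (\<lambda>s. - f s)"
  unfolding poly_family_def by (metis poly_minus)

lemma poly_family_sum: "(\<And>i. i \<in> S \<Longrightarrow> poly_family \<iota> (f i)) \<Longrightarrow> poly_family \<iota> (\<lambda>s. \<Sum>i\<in>S. f i s)"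
  by (induction S rule: infinite_finite_induct) (auto intro: poly_family_const poly_family_add)

lemma poly_family_prod: "(\<And>i. i \<in> S \<Longrightarrow> poly_family \<iota> (f i)) \<Longrightarrow> poly_family \<iota> (\<lambda>s. \<Prod>i\<in>S. f i s)"
  by (induction S rule: infinite_finite_induct) (auto intro: poly_family_const poly_family_mult)

lemma poly_family_power: "poly_family \<iota> f \<Longrightarrow> poly_family \<iota> (\<lambda>s. f s ^ k)"
  by (induction k) (auto intro: poly_family_const poly_family_mult)

lemma poly_family_msubst:
  assumes "\<And>m v. m \<in> keys q \<Longrightarrow> v \<in> keys m \<Longrightarrow> poly_family \<iota> (\<lambda>s. f s v)"
  shows "poly_family \<iota> (\<lambda>s. msubst h (f s) q)"
  unfolding msubst_def
  by (intro poly_family_sum poly_family_mult poly_family_const poly_family_prod poly_family_power assms)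

lemma poly_family_lookup:
  fixes f :: "'k::comm_ring_1 \<Rightarrow> ('v, 'k) mpoly"
  assumes "poly_family mconst f"
  shows "poly_family id (\<lambda>s. lookup (f s) m)"
proof -
  obtain p where p: "\<And>s. f s = poly p (mconst s)" using assms unfolding poly_family_def by blast
  interpret comm_ring_hom "mconst :: 'k \<Rightarrow> ('v, 'k) mpoly" by (rule mconst_hom)
  have lk: "lookup (g * mconst c) m = lookup g m * c" for g :: "('v, 'k) mpoly" and c
  proof -
    have "mconst c * g = Poly_Mapping.map ((*) c) g"
      by (simp add: mult_map_scale_conv_mult mconst_def)
    then show ?thesis by (simp add: map.rep_eq when_def mult.commute)
  qed
  have eq: "lookup (f s) m = (\<Sum>k\<le>Polynomial.degree p. lookup (coeff p k) m * s ^ k)" for s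
    unfolding p poly_altdef lookup_sum by (simp add: lk flip: hom_power)
  show ?thesis
    unfolding eq using poly_family_param[of id]
    by (intro poly_family_sum poly_family_mult poly_family_const poly_family_power) (simp add: id_def)
qed

lemma addrow_mat_0: "k \<noteq> l \<Longrightarrow> addrow_mat m 0 k l = (1\<^sub>m m :: 'a::comm_ring_1 mat)"
  by (rule eq_matI) (auto simp: addrow_mat_def)

text \<open>
  Along the one-parameter group of a transvection the resultant of a morphism is a polynomial in the
  parameter which never vanishes, hence constant. This replaces an explicit transformation formula.
\<close>
lemma eval_coords_transvection:
  fixes q :: "'k::alg_closed_field tuple"
  assumes F: "F \<in> forms (coords n d) r"
    and nz: "\<And>q. q \<in> tuples n d \<Longrightarrow> eval_coords F q \<noteq> 0 \<longleftrightarrow> nozero n q"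
    and q: "q \<in> tuples n d" "nozero n q" and kl: "k < n + 1" "l < n + 1" "k \<noteq> l"
  shows "eval_coords F (conj_act n (addrow_mat (n + 1) a k l) q) = eval_coords F q"
proof -
  let ?E = "\<lambda>a. addrow_mat (n + 1) a k l :: 'k mat"
  \<comment> \<open>The inverse transvection has parameter \<open>- a\<close>, so conjugation
    depends polynomially, and not just rationally, on \<open>a\<close>.\<close>
  have inv: "the (mat_inverse (?E a)) = ?E (- a)" for a
  proof -
    obtain B where B: "mat_inverse (?E a) = Some B" "B \<in> SL (n + 1)" "B * ?E a = 1\<^sub>m (n + 1)"
      by (rule SL_inverse[OF addrow_mat_SL[OF kl(3), of "n + 1" a]]) blast
    have "B \<in> carrier_mat (n + 1) (n + 1)" using B(2) by (simp add: SL_def)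
    then have "B = ?E (- a)"
      by (rule inverse_unique[OF addrow_mat_carrier _ addrow_mat_carrier B(3) addrow_mat_inv[OF kl]])
    then show ?thesis using B(1) by simp
  qed
  have entry: "poly_family (mconst :: 'k \<Rightarrow> (nat, 'k) mpoly) (\<lambda>a. mconst (?E a $$ (i, j)))"
    "poly_family (mconst :: 'k \<Rightarrow> (nat, 'k) mpoly) (\<lambda>a. mconst (?E (- a) $$ (i, j)))" if "i < n + 1" "j < n + 1" for i j
  proof -
    interpret comm_ring_hom "mconst :: 'k \<Rightarrow> (nat, 'k) mpoly" by (rule mconst_hom)
    show "poly_family mconst (\<lambda>a. mconst (?E a $$ (i, j)))"
      using that kl poly_family_param[of mconst] poly_family_const[of mconst]
      by (cases "i = k \<and> j = l") (auto simp: addrow_mat_def)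
    show "poly_family mconst (\<lambda>a. mconst (?E (- a) $$ (i, j)))"
      using that kl poly_family_uminus[OF poly_family_param[of mconst]] poly_family_const[of mconst]
      by (cases "i = k \<and> j = l") (auto simp: addrow_mat_def mconst_def single_uminus)
  qed
  have pre: "poly_family mconst (\<lambda>a. precomp n q (?E (- a)) $ j)" if j: "j < n + 1" for j
  proof -
    have "poly_family mconst (\<lambda>a. msubst mconst (\<lambda>j. \<Sum>l<n + 1. mconst (?E (- a) $$ (j, l)) * mvar l) (q $ j))"
    proof (rule poly_family_msubst)
      fix m v assume "m \<in> keys (q $ j)" "v \<in> keys m"
      then have "v < n + 1" using forms_keysD[OF tuplesD(1)[OF q(1) j]] by fastforce
      then show "poly_family mconst (\<lambda>a. \<Sum>l<n + 1. mconst (?E (- a) $$ (v, l)) * mvar l)"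
        by (intro poly_family_sum poly_family_mult poly_family_const entry) auto
    qed
    then show ?thesis using tuplesD(2)[OF q(1)] j by (simp add: precomp_def)
  qed
  have coord: "poly_family id (\<lambda>a. lookup (conj_act n (?E a) q $ i) m)" if i: "i < n + 1" for i m
  proof (rule poly_family_lookup)
    show "poly_family mconst (\<lambda>a. conj_act n (?E a) q $ i)"
      unfolding conj_act_index[OF q(1) addrow_mat_carrier i] inv
      using i by (intro poly_family_sum poly_family_mult entry pre) auto
  qed
  have "poly_family id (\<lambda>a. eval_coords F (conj_act n (?E a) q))"
    unfolding eval_coords_def
  proof (rule poly_family_msubst)
    fix m v assume "m \<in> keys F" "v \<in> keys m"
    then have "v \<in> coords n d" using forms_keysD[OF F] by blast
    then show "poly_family id (\<lambda>a. case v of (i, m) \<Rightarrow> lookup (conj_act n (?E a) q $ i) m)"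
      using coord by (cases v) (simp add: coords_def)
  qed
  then obtain p where p: "\<And>a. eval_coords F (conj_act n (?E a) q) = poly p a"
    unfolding poly_family_def by auto
  have "poly p a \<noteq> 0" for a
    unfolding p[symmetric]
    using nz[OF conj_act_tuples[OF q(1) addrow_mat_carrier]] nozero_conj_act[OF q(1) addrow_mat_SL[OF kl(3)] q(2)]
    by blast
  then have "Polynomial.degree p = 0"
    using alg_closed_imp_poly_has_root[of p] by blast
  then obtain c where c: "p = [:c:]" by (auto elim: degree_eq_zeroE)
  have "eval_coords F (conj_act n (?E a) q) = eval_coords F (conj_act n (?E 0) q)"
    unfolding p c by simp
  then show ?thesis
    by (simp only: addrow_mat_0[OF kl(3)] conj_act_1[OF q(1)])
qed

text \<open>On morphisms this is the constancy along transvections. Elsewhere both values are zero,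
  because conjugation and its inverse preserve the absence of common zeros.\<close>

lemma invariant_if_zero_locus:
  fixes F :: "(coord, 'k::alg_closed_field) mpoly"
  assumes F: "F \<in> forms (coords n d) r"
    and nz: "\<And>q. q \<in> tuples n d \<Longrightarrow> eval_coords F q \<noteq> 0 \<longleftrightarrow> nozero n q"
  shows "invariant n d F"
  unfolding invariant_def
proof (intro ballI)
  fix A :: "'k mat" and q :: "'k tuple" assume A: "A \<in> SL (n + 1)" and q: "q \<in> tuples n d"
  have car: "A \<in> carrier_mat (n + 1) (n + 1)" if "A \<in> SL (n + 1)" for A :: "'k mat"
    using that by (simp add: SL_def)
  show "eval_coords F (conj_act n A q) = eval_coords F q"
  proof (cases "nozero n q")
    case True
    show ?thesis using A
    proof (rule SL_transvection_induct)
      show "eval_coords F (conj_act n (1\<^sub>m (n + 1)) q) = eval_coords F q"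
        by (simp only: conj_act_1[OF q])
      fix A :: "'k mat" and a k l
      assume A: "A \<in> SL (n + 1)" and kl: "k < n + 1" "l < n + 1" "k \<noteq> l"
        and eq: "eval_coords F (conj_act n (addrow_mat (n + 1) a k l * A) q) = eval_coords F q"
      have "eval_coords F (conj_act n (addrow_mat (n + 1) a k l) (conj_act n A q)) = eval_coords F (conj_act n A q)"
        by (rule eval_coords_transvection[OF F nz conj_act_tuples[OF q car[OF A]] nozero_conj_act[OF q A True] kl])
      with eq show "eval_coords F (conj_act n A q) = eval_coords F q"
        by (simp only: conj_act_mult[OF q addrow_mat_SL[OF kl(3)] A])
    qed
  next
    case False
    obtain B where B: "B \<in> SL (n + 1)" "B * A = 1\<^sub>m (n + 1)"
      by (rule SL_inverse[OF A]) blast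
    have Aq: "conj_act n A q \<in> tuples n d" by (rule conj_act_tuples[OF q car[OF A]])
    have "nozero n q" if "nozero n (conj_act n A q)"
      using nozero_conj_act[OF Aq B(1) that]
      unfolding conj_act_mult[OF q B(1) A, symmetric] B(2) conj_act_1[OF q] .
    with False have "\<not> nozero n (conj_act n A q)" by blast
    then show ?thesis using nz[OF Aq] nz[OF q] False by simp
  qed
qed

section \<open>Points of projective space\<close>

abbreviation scale :: "'k::field \<Rightarrow> 'k tuple \<Rightarrow> 'k tuple" where
  "scale c q \<equiv> mconst c \<cdot>\<^sub>v q"

definition tuple_class :: "'k::field tuple \<Rightarrow> 'k tuple set" where
  "tuple_class q = {scale c q | c. c \<noteq> 0}"

lemma scale_index: "q \<in> tuples n d \<Longrightarrow> i < n + 1 \<Longrightarrow> scale c q $ i = mconst c * q $ i"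
  using tuplesD(2)[of q n d] by simp

lemma scale_tuples:
  assumes "q \<in> tuples n d"
  shows "scale c q \<in> tuples n d"
proof -
  have "scale c q $ i \<in> forms {..n} d" if "i < n + 1" for i
    unfolding scale_index[OF assms that] by (rule forms_scale[OF tuplesD(1)[OF assms that]])
  then show ?thesis using tuplesD(2)[OF assms] by (simp add: tuples_def)
qed

lemma mconst_0 [simp]: "mconst 0 = 0"
  by (simp add: mconst_def)

lemma meval_scale:
  assumes "q \<in> tuples n d" "i < n + 1"
  shows "meval x (scale c q $ i) = c * meval x (q $ i)"
proof -
  interpret comm_ring_hom "meval x :: (nat, 'a) mpoly \<Rightarrow> 'a" by (rule meval_hom)
  show ?thesis unfolding scale_index[OF assms] by (simp add: hom_mult)
qed

lemma scale_1: "scale 1 q = q"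
  by (simp add: mconst_def)

lemma scale_scale: "scale a (scale b q) = scale (a * b) q"
  by (simp add: mconst_def mult_single smult_smult_assoc)

lemma scale_nonzero:
  assumes "q \<in> nonzero_tuples n d" "c \<noteq> 0"
  shows "scale c q \<in> nonzero_tuples n d"
proof -
  have "scale c q \<noteq> 0\<^sub>v (n + 1)"
  proof
    assume "scale c q = 0\<^sub>v (n + 1)"
    moreover have "scale (1 / c) (0\<^sub>v (n + 1)) = 0\<^sub>v (n + 1)" by (rule eq_vecI) auto
    ultimately have "scale (1 / c) (scale c q) = 0\<^sub>v (n + 1)" by simp
    then show False using assms by (simp add: scale_scale scale_1 nonzero_tuples_def)
  qed
  then show ?thesis using assms(1) by (auto simp: nonzero_tuples_def intro: scale_tuples)
qed

lemma proj_rel_class: "q \<in> nonzero_tuples n d \<Longrightarrow> proj_rel n d `` {q} = tuple_class q"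
  using scale_nonzero[of q n d] by (auto simp: proj_rel_def tuple_class_def)

lemma rat_maps_iff: "\<phi> \<in> rat_maps n d \<longleftrightarrow> (\<exists>q \<in> nonzero_tuples n d. \<phi> = tuple_class q)"
  unfolding rat_maps_def quotient_def using proj_rel_class by blast

lemma tuple_class_self: "q \<in> tuple_class q"
  unfolding tuple_class_def using scale_1[of q] by (metis (mono_tags, lifting) mem_Collect_eq one_neq_zero)

lemma tuple_class_eq:
  assumes "c \<noteq> 0"
  shows "tuple_class (scale c q) = tuple_class q"
  unfolding tuple_class_def
proof (intro Collect_cong iffI)
  fix p assume "\<exists>a. p = scale a (scale c q) \<and> a \<noteq> 0"
  then show "\<exists>a. p = scale a q \<and> a \<noteq> 0" using assms by (metis mult_eq_0_iff scale_scale)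
next
  fix p assume "\<exists>a. p = scale a q \<and> a \<noteq> 0"
  then obtain a where "p = scale a q" "a \<noteq> 0" by blast
  then show "\<exists>a. p = scale a (scale c q) \<and> a \<noteq> 0"
    using assms by (intro exI[of _ "a / c"]) (simp add: scale_scale)
qed

lemma nozero_nonzero:
  assumes "q \<in> tuples n d" "nozero n q"
  shows "q \<in> nonzero_tuples n d"
proof -
  have "q \<noteq> 0\<^sub>v (n + 1)"
  proof
    assume "q = 0\<^sub>v (n + 1)"
    then have "meval (\<lambda>_. 1) (q $ i) = 0" if "i < n + 1" for i
      using that by (simp add: msubst_def)
    then show False using assms(2) unfolding nozero_def by (metis le0 one_neq_zero)
  qed
  then show ?thesis using assms(1) by (simp add: nonzero_tuples_def)
qed

lemma HomE:
  assumes "\<phi> \<in> Hom n d"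
  obtains q where "q \<in> tuples n d" "nozero n q" "\<phi> = tuple_class q"
proof -
  obtain q where q: "q \<in> nonzero_tuples n d" "\<phi> = tuple_class q"
    using assms unfolding Hom_def rat_maps_iff by blast
  have no: "\<not> (\<exists>x \<in> carrier_vec (n + 1). x \<noteq> 0\<^sub>v (n + 1) \<and> (\<forall>i<n + 1. meval (\<lambda>j. x $ j) (q $ i) = 0))"
    using assms tuple_class_self[of q] q(2) unfolding Hom_def by blast
  have qt: "q \<in> tuples n d" using q(1) by (simp add: nonzero_tuples_def)
  have "nozero n q"
    unfolding nozero_def
  proof (intro allI impI)
    fix x :: "nat \<Rightarrow> 'a" assume "\<exists>j\<le>n. x j \<noteq> 0"
    then obtain j where j: "j \<le> n" "x j \<noteq> 0" by blast
    let ?x = "vec (n + 1) x"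
    have "?x \<noteq> 0\<^sub>v (n + 1)"
    proof
      assume "?x = 0\<^sub>v (n + 1)"
      then have "?x $ j = 0\<^sub>v (n + 1) $ j" by simp
      then show False using j by simp
    qed
    then obtain i where i: "i < n + 1" "meval (\<lambda>j. ?x $ j) (q $ i) \<noteq> 0"
      using no by (metis vec_carrier)
    have "meval (\<lambda>j. ?x $ j) (q $ i) = meval x (q $ i)"
      by (rule meval_tuple_cong[OF qt i(1)]) simp
    then show "\<exists>i<n + 1. meval x (q $ i) \<noteq> 0" using i by metis
  qed
  with that qt q(2) show thesis by blast
qed

lemma conj_act_scale:
  fixes q :: "'k::alg_closed_field tuple"
  assumes q: "q \<in> tuples n d" and A: "A \<in> SL (n + 1)"
  shows "conj_act n A (scale c q) = scale c (conj_act n A q)"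
proof -
  obtain B where B: "B \<in> SL (n + 1)" "A * B = 1\<^sub>m (n + 1)"
    by (rule SL_inverse[OF A]) blast
  have car: "A \<in> carrier_mat (n + 1) (n + 1)" "B \<in> carrier_mat (n + 1) (n + 1)"
    using A B by (auto simp: SL_def)
  have cq: "scale c q \<in> tuples n d" by (rule scale_tuples[OF q])
  have Aq: "conj_act n A q \<in> tuples n d" by (rule conj_act_tuples[OF q car(1)])
  show ?thesis
  proof (rule tuple_eqI[OF conj_act_tuples[OF cq car(1)] scale_tuples[OF Aq]])
    fix i x assume i: "i < n + 1"
    show "meval x (conj_act n A (scale c q) $ i) = meval x (scale c (conj_act n A q) $ i)"
      unfolding meval_scale[OF Aq i] meval_conj_act[OF q A car(2) B(2) i] meval_conj_act[OF cq A car(2) B(2) i]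
        sum_distrib_left
      by (intro sum.cong refl) (simp add: meval_scale[OF q] del: One_nat_def)
  qed
qed

lemma conj_act_class:
  fixes q :: "'k::alg_closed_field tuple"
  assumes "q \<in> tuples n d" "A \<in> SL (n + 1)"
  shows "conj_act n A ` tuple_class q = tuple_class (conj_act n A q)"
  unfolding tuple_class_def using conj_act_scale[OF assms] by (auto simp: image_iff) metis+

lemma eval_coords_scale:
  assumes "F \<in> forms (coords n d) r" "q \<in> tuples n d"
  shows "eval_coords F (scale c q) = c ^ r * eval_coords F q"
proof -
  have lk: "lookup (mconst c * g) m = c * lookup g m" for g :: "(nat, 'a) mpoly" and m
  proof -
    have "mconst c * g = Poly_Mapping.map ((*) c) g"
      by (simp add: mult_map_scale_conv_mult mconst_def)
    then show ?thesis by (simp add: map.rep_eq when_def)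
  qed
  have "eval_coords F (scale c q) = meval (\<lambda>v. c * (case v of (i, m) \<Rightarrow> lookup (q $ i) m)) F"
    unfolding eval_coords_def
  proof (rule msubst_cong[OF assms(1)])
    fix v assume "v \<in> coords n d"
    then show "(case v of (i, m) \<Rightarrow> lookup (scale c q $ i) m) =
        c * (case v of (i, m) \<Rightarrow> lookup (q $ i) m)"
      using scale_index[OF assms(2)] by (cases v) (simp add: coords_def lk)
  qed
  then show ?thesis unfolding eval_coords_def msubst_scale[OF assms(1)] .
qed

lemma vanishes_at_class:
  assumes "F \<in> forms (coords n d) r" "q \<in> tuples n d"
  shows "vanishes_at F (tuple_class q) \<longleftrightarrow> eval_coords F q = 0"
proof
  show "vanishes_at F (tuple_class q) \<Longrightarrow> eval_coords F q = 0"
    using tuple_class_self[of q] by (auto simp: vanishes_at_def)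
  show "eval_coords F q = 0 \<Longrightarrow> vanishes_at F (tuple_class q)"
    by (auto simp: vanishes_at_def tuple_class_def eval_coords_scale[OF assms])
qed

section \<open>Semiconjugacies\<close>

lemma elimination_set:
  fixes G :: "(nat, 'r::comm_ring_1) mpoly set" and \<iota> :: "'k::alg_closed_field \<Rightarrow> 'r"
  assumes fin: "finite G" and g: "G \<subseteq> forms {..n} d" and d: "d > 0"
    and h0: "comm_ring_hom h0" "\<And>a. h0 (\<iota> a) = a"
    and nz: "\<And>x. \<exists>j\<le>n. x j \<noteq> 0 \<Longrightarrow> \<exists>g\<in>G. msubst h0 x g \<noteq> 0"
  obtains P where "h0 P \<noteq> 0"
    "\<And>h x. comm_ring_hom h \<Longrightarrow> (\<And>a. h (\<iota> a) = a) \<Longrightarrow> \<exists>j\<le>n. x j \<noteq> 0 \<Longrightarrow>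
       (\<And>g. g \<in> G \<Longrightarrow> msubst h x g = 0) \<Longrightarrow> h P = 0"
proof -
  obtain gs where gs: "set gs = G" using finite_list[OF fin] by blast
  have mem: "gs ! i \<in> G" if "i < length gs" for i using gs that by auto
  have ex: "\<exists>i<length gs. msubst h0 x (gs ! i) \<noteq> 0" if "\<exists>j\<le>n. x j \<noteq> 0" for x
    using nz[OF that] gs by (metis in_set_conv_nth)
  have forms: "gs ! i \<in> forms {..n} d" if "i < length gs" for i using mem[OF that] g by blast
  obtain P where P: "h0 P \<noteq> 0"
    "\<And>h x. comm_ring_hom h \<Longrightarrow> (\<And>a. h (\<iota> a) = a) \<Longrightarrow> \<exists>j\<le>n. x j \<noteq> 0 \<Longrightarrow>
       (\<And>i. i < length gs \<Longrightarrow> msubst h x (gs ! i) = 0) \<Longrightarrow> h P = 0"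
    by (rule elimination[of "length gs" "\<lambda>i. gs ! i" n d h0 \<iota>, OF forms d h0 ex]) auto
  show thesis
    by (rule that[OF P(1)]) (use P(2) mem in blast)
qed

text \<open>
  The variables \<open>s + i (n + 1) + j\<close> are the entries of a square matrix \<open>A\<close>, and \<open>z\<close> homogenises. The form is
  the \<open>i\<close>-th component of \<open>q'(A x) - z\<^sup>d\<^sup>-\<^sup>1 A q(x)\<close>.
\<close>
definition mat_var :: "nat \<Rightarrow> nat \<Rightarrow> nat \<Rightarrow> nat \<Rightarrow> nat" where
  "mat_var n s i j = s + i * (n + 1) + j"

definition semiconj_form :: "nat \<Rightarrow> nat \<Rightarrow> ('k \<Rightarrow> 'r::comm_ring_1) \<Rightarrow> nat \<Rightarrow> nat \<Rightarrow> (nat \<Rightarrow> (nat, 'r) mpoly) \<Rightarrow>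
    (nat \<Rightarrow> (nat, 'r) mpoly) \<Rightarrow> (nat \<Rightarrow> 'k) \<Rightarrow> nat \<Rightarrow> (nat, 'r) mpoly" where
  "semiconj_form n d \<iota> z s Q' Q x i =
     msubst mconst (\<lambda>j. \<Sum>l<n + 1. mconst (\<iota> (x l)) * mvar (mat_var n s j l)) (Q' i) -
     mvar z ^ (d - 1) * (\<Sum>j<n + 1. mconst (meval (\<lambda>l. \<iota> (x l)) (Q j)) * mvar (mat_var n s i j))"

definition point_mat :: "nat \<Rightarrow> nat \<Rightarrow> (nat \<Rightarrow> 'k) \<Rightarrow> 'k mat" where
  "point_mat n s X = mat (n + 1) (n + 1) (\<lambda>(i, j). X (mat_var n s i j))"

lemma point_mat_carrier [simp]: "point_mat n s X \<in> carrier_mat (n + 1) (n + 1)"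
  by (simp add: point_mat_def)

lemma mat_var_less: "i < n + 1 \<Longrightarrow> j < n + 1 \<Longrightarrow> mat_var n s i j < s + (n + 1) * (n + 1)"
proof -
  assume "i < n + 1" "j < n + 1"
  then have "i * (n + 1) + j < (i + 1) * (n + 1)" "(i + 1) * (n + 1) \<le> (n + 1) * (n + 1)"
    by (simp, intro mult_le_mono1) simp
  then show ?thesis unfolding mat_var_def by simp
qed

lemma mat_var_div_mod:
  assumes "j < n + 1"
  shows "mat_var n 0 i j div (n + 1) = i" "mat_var n 0 i j mod (n + 1) = j"
proof -
  have eq: "mat_var n 0 i j = j + i * (n + 1)" by (simp add: mat_var_def)
  have "(j + i * (n + 1)) div (n + 1) = i + j div (n + 1)" by (rule div_mult_self1) simp
  then show "mat_var n 0 i j div (n + 1) = i" unfolding eq using assms by simp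
  have "(j + i * (n + 1)) mod (n + 1) = j mod (n + 1)" by (rule mod_mult_self1)
  then show "mat_var n 0 i j mod (n + 1) = j" unfolding eq using assms by simp
qed

lemma semiconj_form_forms:
  assumes "d > 0" "z \<le> N" "s + (n + 1) * (n + 1) \<le> N + 1" "\<And>i. i < n + 1 \<Longrightarrow> Q' i \<in> forms {..n} d" "i < n + 1"
  shows "semiconj_form n d \<iota> z s Q' Q x i \<in> forms {..N} d"
proof -
  have v: "mat_var n s i j \<in> {..N}" if "i < n + 1" "j < n + 1" for i j
    using mat_var_less[OF that, of s] assms(3) by simp
  have "msubst mconst (\<lambda>j. \<Sum>l<n + 1. mconst (\<iota> (x l)) * mvar (mat_var n s j l)) (Q' i) \<in> forms {..N} (d * 1)"
    by (rule msubst_forms[OF assms(4)[OF assms(5)] _ forms_mconst]) (auto intro!: forms_sum forms_scale forms_mvar[unfolded One_nat_def] v[unfolded atMost_iff])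
  moreover have "mvar z ^ (d - 1) * (\<Sum>j<n + 1. mconst (meval (\<lambda>l. \<iota> (x l)) (Q j)) * mvar (mat_var n s i j))
      \<in> forms {..N} ((d - 1) * 1 + 1)"
    using assms(2) by (intro forms_mult forms_power forms_sum forms_scale forms_mvar v assms(5)) auto
  ultimately show ?thesis
    using assms(1) unfolding semiconj_form_def by (intro forms_diff) auto
qed

lemma msubst_semiconj_form:
  assumes h: "comm_ring_hom h" "\<And>a. h (\<iota> a) = a" and Q': "Q' i \<in> forms {..n} d" and i: "i < n + 1"
  shows "msubst h X (semiconj_form n d \<iota> z s Q' Q x i) =
    msubst h (mact n (point_mat n s X) x) (Q' i) -
      X z ^ (d - 1) * mact n (point_mat n s X) (\<lambda>j. msubst h x (Q j)) i"
proof -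
  interpret h: comm_ring_hom h by (rule h)
  interpret H: comm_ring_hom "msubst h X" by (rule msubst_hom[OF h(1)])
  have sum: "msubst h X (\<Sum>l<n + 1. mconst (c l) * mvar (mat_var n s j l)) = (\<Sum>l<n + 1. h (c l) * X (mat_var n s j l))" for c j
    by (simp add: H.hom_sum H.hom_mult)
  have "msubst h X (msubst mconst (\<lambda>j. \<Sum>l<n + 1. mconst (\<iota> (x l)) * mvar (mat_var n s j l)) (Q' i)) =
      msubst h (\<lambda>j. \<Sum>l<n + 1. x l * X (mat_var n s j l)) (Q' i)"
    by (subst hom_msubst[OF msubst_hom[OF h(1)]]) (simp_all add: sum[unfolded Suc_eq_plus1[symmetric]] h(2))
  also have "\<dots> = msubst h (mact n (point_mat n s X) x) (Q' i)"
    by (rule msubst_cong[OF Q']) (simp add: mact_def point_mat_def mult.commute)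
  finally have 1: "msubst h X (msubst mconst (\<lambda>j. \<Sum>l<n + 1. mconst (\<iota> (x l)) * mvar (mat_var n s j l)) (Q' i)) =
      msubst h (mact n (point_mat n s X) x) (Q' i)" .
  have ev: "h (meval (\<lambda>l. \<iota> (x l)) (Q j)) = msubst h x (Q j)" for j
    using hom_msubst[OF h(1), of id "\<lambda>l. \<iota> (x l)" "Q j"] by (simp add: h(2))
  have 2: "(\<Sum>j<n + 1. h (meval (\<lambda>l. \<iota> (x l)) (Q j)) * X (mat_var n s i j)) =
      mact n (point_mat n s X) (\<lambda>j. msubst h x (Q j)) i"
    unfolding ev mact_def using i by (intro sum.cong) (auto simp: point_mat_def mult.commute)
  show ?thesis
    unfolding semiconj_form_def H.hom_minus 1 H.hom_mult sum 2 by (simp add: H.hom_power)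
qed

definition lift_form :: "('k::comm_ring_1 \<Rightarrow> 'r::comm_ring_1) \<Rightarrow> 'k tuple \<Rightarrow> nat \<Rightarrow> (nat, 'r) mpoly" where
  "lift_form \<iota> q i = msubst (\<lambda>a. mconst (\<iota> a)) mvar (q $ i)"

lemma lift_form_forms: "q $ i \<in> forms {..n} d \<Longrightarrow> lift_form \<iota> q i \<in> forms {..n} d"
  unfolding lift_form_def
  using msubst_forms[of "q $ i" "{..n}" d mvar "{..n}" 1 "\<lambda>a. mconst (\<iota> a)"] forms_mvar[of _ "{..n}"] forms_mconst
  by fastforce

lemma msubst_lift_form:
  assumes "comm_ring_hom h" "\<And>a. h (\<iota> a) = a" "\<iota> 0 = 0"
  shows "msubst h x (lift_form \<iota> q i) = meval x (q $ i)"
proof -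
  interpret h: comm_ring_hom h by (rule assms)
  show ?thesis unfolding lift_form_def
    using hom_msubst[OF msubst_hom[OF assms(1)], of "\<lambda>a. mconst (\<iota> a)" x mvar "q $ i"] assms(2,3)
    by (simp add: mconst_def[of 0] id_def)
qed

text \<open>At \<open>z = 0\<close> the system \<open>q(A x) = z\<^sup>d\<^sup>-\<^sup>1 A q'(x)\<close> has only the solution \<open>A = 0\<close>.\<close>
lemma zero_mat_if_degenerate:
  fixes q :: "'k::alg_closed_field tuple"
  assumes q: "q \<in> tuples n d" "nozero n q"
    and T: "\<And>p :: (nat, 'k) mpoly. p \<in> forms {..n} d \<Longrightarrow> (\<And>x. x \<in> T \<Longrightarrow> meval x p = 0) \<Longrightarrow> p = 0"
    and zero: "\<And>x i. x \<in> T \<Longrightarrow> i < n + 1 \<Longrightarrow> meval (mact n A x) (q $ i) = 0" and ij: "i < n + 1" "j < n + 1"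
  shows "A $$ (i, j) = 0"
proof -
  have "precomp n q A $ i = 0" if "i < n + 1" for i
    using T[OF tuplesD(1)[OF precomp_tuples[OF q(1)] that]] zero that by (simp add: meval_precomp[OF q(1)])
  then have all: "meval (mact n A x) (q $ i) = 0" if "i < n + 1" for i x
    using meval_precomp[OF q(1) that, of x A] that by (simp add: msubst_def)
  have "mact n A x i = 0" for x
    using q(2) all ij(1) unfolding nozero_def by (metis Suc_eq_plus1 less_Suc_eq_le)
  from this[of "\<lambda>l. if l = j then 1 else 0"] show ?thesis
    using ij by (simp add: mact_def if_distrib[of "(*) _"] cong: if_cong)
qed

text \<open>Each entry takes finitely many values. A parameter \<open>\<mu>\<close> is tied to the
  entry at \<open>(a, b)\<close> by requiring \<open>\<mu>\<close> times the entry to equal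
  \<open>z\<close>. At \<open>\<mu> = 0\<close> this forces \<open>z = 0\<close> and then a zero
  matrix, so elimination gives a nonzero polynomial in \<open>\<mu>\<close>. A solution with
  \<open>z = 1\<close> and nonzero entry makes the reciprocal of the entry a root.\<close>

lemma finite_semiconj:
  fixes q :: "'k::alg_closed_field tuple"
  assumes q: "q \<in> tuples n d" "nozero n q" and d: "d > 1"
  shows "finite {A \<in> carrier_mat (n + 1) (n + 1).
    \<forall>x. \<forall>i<n + 1. meval (mact n A x) (q $ i) = mact n A (\<lambda>j. meval x (q $ j)) i}" (is "finite ?X")
proof -
  let ?z = "(n + 1) * (n + 1)"
  let ?\<iota> = "\<lambda>a :: 'k. [:a:]"
  obtain T :: "(nat \<Rightarrow> 'k) set" where T: "finite T"
    "\<And>p. p \<in> forms {..n} d \<Longrightarrow> (\<And>x. x \<in> T \<Longrightarrow> meval x p = 0) \<Longrightarrow> p = 0"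
    by (rule test_points) blast
  have ev: "comm_ring_hom (\<lambda>p :: 'k poly. poly p \<mu>)" for \<mu> by unfold_locales auto
  have finite_entries: "finite {A $$ (a, b) | A. A \<in> ?X}" if ab: "a < n + 1" "b < n + 1" for a b
  proof -
    let ?v = "mat_var n 0 a b"
    define S where "S = (\<lambda>(x, i). semiconj_form n d ?\<iota> ?z 0 (lift_form ?\<iota> q) (lift_form ?\<iota> q) x i) ` (T \<times> {..<n + 1})"
    \<comment> \<open>The linear equation is multiplied by powers of all variables to reach degree
      \<open>d\<close>; at a nontrivial point one of these powers is nonzero.\<close>
    define E where "E = (\<lambda>v. (mconst [:0, 1:] * mvar ?v - mvar ?z) * mvar v ^ (d - 1) :: (nat, 'k poly) mpoly) ` {..?z}"
    have vz: "?v < ?z" using mat_var_less[OF ab, of 0] by simp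
    have lf: "lift_form ?\<iota> q i \<in> forms {..n} d" if "i < n + 1" for i
      by (rule lift_form_forms[where n = n, OF tuplesD(1)[OF q(1) that]])
    have S: "S \<subseteq> forms {..?z} d"
      unfolding S_def using d lf by (auto intro!: semiconj_form_forms)
    have E: "E \<subseteq> forms {..?z} d"
    proof -
      have "(mconst [:0, 1:] * mvar ?v - mvar ?z) * mvar v ^ (d - 1) \<in> (forms {..?z} (1 + (d - 1) * 1) :: (nat, 'k poly) mpoly set)"
        if "v \<le> ?z" for v
        using that vz by (intro forms_mult forms_diff forms_power forms_scale forms_mvar) auto
      then show ?thesis using d by (auto simp: E_def)
    qed
    have evS: "msubst (\<lambda>p. poly p \<mu>) X (semiconj_form n d ?\<iota> ?z 0 (lift_form ?\<iota> q) (lift_form ?\<iota> q) x i) =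
        meval (mact n (point_mat n 0 X) x) (q $ i) - X ?z ^ (d - 1) * mact n (point_mat n 0 X) (\<lambda>j. meval x (q $ j)) i"
      if "i < n + 1" for \<mu> X x i
      using msubst_semiconj_form[where h = "\<lambda>p. poly p \<mu>" and \<iota> = ?\<iota> and Q' = "lift_form ?\<iota> q" and i = i and X = X
          and z = ?z and s = 0 and Q = "lift_form ?\<iota> q" and x = x, OF ev _ lf[OF that] that]
      by (simp add: msubst_lift_form[OF ev])
    have evE: "msubst (\<lambda>p. poly p \<mu>) X ((mconst [:0, 1:] * mvar ?v - mvar ?z) * mvar v ^ (d - 1)) =
        (\<mu> * X ?v - X ?z) * X v ^ (d - 1)" for \<mu> :: 'k and X v
    proof -
      interpret H: comm_ring_hom "msubst (\<lambda>p. poly p \<mu>) X" by (rule msubst_hom[OF ev])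
      show ?thesis by (simp add: H.hom_mult H.hom_minus H.hom_power)
    qed
    have nz: "\<exists>g\<in>S \<union> E. msubst (\<lambda>p. poly p 0) X g \<noteq> 0" if X: "\<exists>j\<le>?z. X j \<noteq> 0" for X
    proof (rule ccontr)
      assume "\<not> (\<exists>g\<in>S \<union> E. msubst (\<lambda>p. poly p 0) X g \<noteq> 0)"
      then have all: "msubst (\<lambda>p. poly p 0) X g = 0" if "g \<in> S \<union> E" for g using that by blast
      from X obtain v where v: "v \<le> ?z" "X v \<noteq> 0" by blast
      have "(0 * X ?v - X ?z) * X v ^ (d - 1) = 0"
        unfolding evE[symmetric] using v by (intro all) (auto simp: E_def)
      then have z0: "X ?z = 0" using v by simp
      have "meval (mact n (point_mat n 0 X) x) (q $ i) = 0" if "x \<in> T" "i < n + 1" for x i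
      proof -
        have "semiconj_form n d ?\<iota> ?z 0 (lift_form ?\<iota> q) (lift_form ?\<iota> q) x i \<in> S"
          unfolding S_def using that by (intro image_eqI[of _ _ "(x, i)"]) auto
        then have "meval (mact n (point_mat n 0 X) x) (q $ i) - 0 ^ (d - 1) * mact n (point_mat n 0 X) (\<lambda>j. meval x (q $ j)) i = 0"
          using all evS[OF that(2), of 0 X x] unfolding z0 by simp
        moreover have "(0 :: 'k) ^ (d - 1) = 0" using d by (simp add: power_0_left)
        ultimately show ?thesis by simp
      qed
      then have A0: "point_mat n 0 X $$ (i, j) = 0" if "i < n + 1" "j < n + 1" for i j
        using zero_mat_if_degenerate[OF q T(2) _ that] by blast
      have "v < ?z" using v z0 by (cases "v = ?z") auto
      then have dm: "v div (n + 1) < n + 1" "v mod (n + 1) < n + 1"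
        by (auto simp: less_mult_imp_div_less)
      have "mat_var n 0 (v div (n + 1)) (v mod (n + 1)) = v"
        by (simp only: mat_var_def add_0 div_mult_mod_eq)
      then show False using A0[OF dm] dm v(2) by (simp add: point_mat_def)
    qed
    obtain P where P: "poly P 0 \<noteq> 0"
      "\<And>\<mu> X. \<exists>j\<le>?z. X j \<noteq> 0 \<Longrightarrow> (\<And>g. g \<in> S \<union> E \<Longrightarrow> msubst (\<lambda>p. poly p \<mu>) X g = 0) \<Longrightarrow> poly P \<mu> = 0"
    proof (rule elimination_set[of "S \<union> E" ?z d "\<lambda>p. poly p 0" ?\<iota>])
      show "finite (S \<union> E)" using T(1) by (simp add: S_def E_def)
      fix P assume P: "poly P 0 \<noteq> 0" "\<And>h x. comm_ring_hom h \<Longrightarrow> (\<And>a. h [:a:] = a) \<Longrightarrow> \<exists>j\<le>?z. x j \<noteq> 0 \<Longrightarrow>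
        (\<And>g. g \<in> S \<union> E \<Longrightarrow> msubst h x g = 0) \<Longrightarrow> h P = 0"
      show thesis by (rule that[OF P(1)]) (rule P(2)[OF ev], auto)
    qed (use S E d nz ev in auto)
    have "A $$ (a, b) \<in> insert 0 ((\<lambda>y. 1 / y) ` {y. poly P y = 0})" if A: "A \<in> ?X" for A
    proof (cases "A $$ (a, b) = 0")
      case False
      define X where "X k = (if k = ?z then 1 else A $$ (k div (n + 1), k mod (n + 1)))" for k
      have XA: "X (mat_var n 0 i j) = A $$ (i, j)" if "i < n + 1" "j < n + 1" for i j
      proof -
        have "mat_var n 0 i j \<noteq> ?z" using mat_var_less[OF that, of 0] by simp
        then show ?thesis unfolding X_def mat_var_div_mod[OF that(2)] by (simp only: if_False)
      qed
      have pm: "point_mat n 0 X = A"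
        using A XA by (intro eq_matI) (auto simp: point_mat_def)
      have "poly P (1 / A $$ (a, b)) = 0"
      proof (rule P(2))
        show "\<exists>j\<le>?z. X j \<noteq> 0" by (intro exI[of _ ?z]) (simp add: X_def)
        fix g assume "g \<in> S \<union> E"
        then show "msubst (\<lambda>p. poly p (1 / A $$ (a, b))) X g = 0"
        proof
          assume "g \<in> S"
          then obtain xi where xi: "g = (\<lambda>(x, i). semiconj_form n d ?\<iota> ?z 0 (lift_form ?\<iota> q) (lift_form ?\<iota> q) x i) xi"
              "xi \<in> T \<times> {..<n + 1}"
            unfolding S_def by (rule imageE)
          obtain x i where "xi = (x, i)" by (cases xi)
          with xi have g: "g = semiconj_form n d ?\<iota> ?z 0 (lift_form ?\<iota> q) (lift_form ?\<iota> q) x i" "i < n + 1"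
            by simp_all
          have "X ?z = 1" by (simp add: X_def)
          then show ?thesis unfolding g(1) evS[OF g(2)] pm using A g(2) by simp
        next
          assume "g \<in> E"
          then obtain v where g: "g = (mconst [:0, 1:] * mvar ?v - mvar ?z) * mvar v ^ (d - 1)"
            unfolding E_def by (rule imageE)
          have "X ?z = 1" by (simp add: X_def)
          then show ?thesis unfolding g evE XA[OF ab] using False by simp
        qed
      qed
      then show ?thesis by (intro insertI2 image_eqI[of _ _ "1 / A $$ (a, b)"]) auto
    qed simp
    moreover have "finite {y. poly P y = 0}"
      using P(1) by (intro poly_roots_finite) auto
    then have "finite (insert 0 ((\<lambda>y. 1 / y) ` {y. poly P y = 0}))" by simp
    ultimately show ?thesis by (elim finite_subset[rotated]) blast
  qed
  define \<Lambda> where "\<Lambda> = (\<Union>(a, b)\<in>{..<n + 1} \<times> {..<n + 1}. {A $$ (a, b) | A. A \<in> ?X})"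
  have "finite \<Lambda>" unfolding \<Lambda>_def using finite_entries by auto
  then have "finite (mat (n + 1) (n + 1) ` (PiE ({..<n + 1} \<times> {..<n + 1}) (\<lambda>_. \<Lambda>)))"
    by (intro finite_imageI finite_PiE) auto
  moreover have "?X \<subseteq> mat (n + 1) (n + 1) ` (PiE ({..<n + 1} \<times> {..<n + 1}) (\<lambda>_. \<Lambda>))"
  proof
    fix A assume A: "A \<in> ?X"
    show "A \<in> mat (n + 1) (n + 1) ` (PiE ({..<n + 1} \<times> {..<n + 1}) (\<lambda>_. \<Lambda>))"
    proof (rule image_eqI)
      show "A = mat (n + 1) (n + 1) (\<lambda>ij\<in>{..<n + 1} \<times> {..<n + 1}. A $$ ij)"
        using A by (intro eq_matI) auto
      show "(\<lambda>ij\<in>{..<n + 1} \<times> {..<n + 1}. A $$ ij) \<in> PiE ({..<n + 1} \<times> {..<n + 1}) (\<lambda>_. \<Lambda>)"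
      proof (rule restrict_PiE_iff[THEN iffD2], rule ballI)
        fix ij assume ij: "ij \<in> {..<n + 1} \<times> {..<n + 1}"
        show "A $$ ij \<in> \<Lambda>" unfolding \<Lambda>_def by (rule UN_I[OF ij]) (use A in \<open>auto split: prod.splits\<close>)
      qed
    qed
  qed
  ultimately show ?thesis by (rule finite_subset[rotated])
qed

section \<open>Rescaling semiconjugacies, and the stabilizer\<close>

lemma mact_scaled_point: "mact n A (\<lambda>j. c * x j) i = c * mact n A x i"
  by (simp add: mact_scale)

lemma meval_scaled_point:
  assumes "q \<in> tuples n d" "i < n + 1"
  shows "meval (\<lambda>j. c * x j) (q $ i) = c ^ d * meval x (q $ i)"
  by (rule msubst_scale[OF tuplesD(1)[OF assms]])

lemma meval_smult_mat:
  assumes "q \<in> tuples n d" "i < n + 1" "A \<in> carrier_mat (n + 1) (n + 1)"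
  shows "meval (mact n (c \<cdot>\<^sub>m A) x) (q $ i) = c ^ d * meval (mact n A x) (q $ i)"
proof -
  have "meval (mact n (c \<cdot>\<^sub>m A) x) (q $ i) = meval (\<lambda>j. c * mact n A x j) (q $ i)"
    using mact_smult[OF assms(3)] by (intro meval_tuple_cong[OF assms(1,2)]) simp
  then show ?thesis by (simp add: meval_scaled_point[OF assms(1,2)])
qed

lemma smult_mult_smult_mat:
  assumes "A \<in> carrier_mat m m" "B \<in> carrier_mat m m"
  shows "(a \<cdot>\<^sub>m A) * (b \<cdot>\<^sub>m B) = (a * b :: 'k::comm_ring_1) \<cdot>\<^sub>m (A * B)"
proof -
  have "(a \<cdot>\<^sub>m A) * (b \<cdot>\<^sub>m B) = a \<cdot>\<^sub>m (b \<cdot>\<^sub>m (A * B))"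
    by (simp only: mult_smult_assoc_mat[OF assms(1) smult_carrier_mat[OF assms(2)]] mult_smult_distrib[OF assms])
  also have "\<dots> = (a * b) \<cdot>\<^sub>m (A * B)"
    by (rule eq_matI) (auto simp: mult.assoc)
  finally show ?thesis .
qed

lemma smult_mat_inverse_pair:
  fixes A B :: "'k::field mat"
  assumes "A \<in> carrier_mat m m" "B \<in> carrier_mat m m" "A * B = 1\<^sub>m m" "c \<noteq> 0"
  shows "(c \<cdot>\<^sub>m A) * ((1 / c) \<cdot>\<^sub>m B) = 1\<^sub>m m"
proof -
  show ?thesis
    unfolding smult_mult_smult_mat[OF assms(1,2)] assms(3) using assms(4) by (intro eq_matI) auto
qed

text \<open>An \<open>(n + 1)\<close>-st root of \<open>1 / det A\<close> scales \<open>A\<close>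
  into \<open>SL\<close>. As the forms have degree \<open>d\<close>, this changes the conjugate only
  by the factor \<open>\<mu> * (1 / \<mu>) ^ d\<close>.\<close>

lemma semiconj_imp_conj:
  fixes q q' :: "'k::alg_closed_field tuple"
  assumes q: "q \<in> tuples n d" and q': "q' \<in> tuples n d" and A: "A \<in> carrier_mat (n + 1) (n + 1)"
    and B: "B \<in> carrier_mat (n + 1) (n + 1)" "A * B = 1\<^sub>m (n + 1)"
    and semi: "\<And>x i. i < n + 1 \<Longrightarrow> meval (mact n A x) (q' $ i) = mact n A (\<lambda>j. meval x (q $ j)) i"
  obtains A' c where "A' \<in> SL (n + 1)" "c \<noteq> 0" "conj_act n A' q = scale c q'"
proof -
  have "det A * det B = 1" using det_mult[OF A B(1)] B(2) by simp
  then have det: "det A \<noteq> 0" by auto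
  obtain \<mu> where \<mu>: "\<mu> ^ (n + 1) = 1 / det A"
    using nth_root_exists[of "n + 1" "1 / det A"] by auto
  then have \<mu>0: "\<mu> \<noteq> 0" using det by (auto simp: power_0_left)
  let ?A = "\<mu> \<cdot>\<^sub>m A" and ?B = "(1 / \<mu>) \<cdot>\<^sub>m B"
  have SL: "?A \<in> SL (n + 1)"
    using A det \<mu> by (simp add: SL_def del: power_Suc)
  have car: "?A \<in> carrier_mat (n + 1) (n + 1)" "?B \<in> carrier_mat (n + 1) (n + 1)" using A B by auto
  have inv: "?A * ?B = 1\<^sub>m (n + 1)" by (rule smult_mat_inverse_pair[OF A B(1,2) \<mu>0])
  have "conj_act n ?A q = scale (\<mu> * (1 / \<mu>) ^ d) q'"
  proof (rule tuple_eqI[OF conj_act_tuples[OF q car(1)] scale_tuples[OF q']])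
    fix i x assume i: "i < n + 1"
    have "meval x (conj_act n ?A q $ i) = mact n ?A (\<lambda>j. meval (mact n ?B x) (q $ j)) i"
      unfolding meval_conj_act[OF q SL car(2) inv i] by (simp add: mact_def)
    also have "\<dots> = \<mu> * mact n A (\<lambda>j. meval (mact n ?B x) (q $ j)) i"
      using i by (intro mact_smult[OF A]) simp
    also have "\<dots> = \<mu> * meval (mact n A (mact n ?B x)) (q' $ i)"
      by (simp only: semi[OF i])
    also have "meval (mact n A (mact n ?B x)) (q' $ i) = meval (\<lambda>j. (1 / \<mu>) * x j) (q' $ i)"
    proof (rule meval_tuple_cong[OF q' i])
      fix j assume j: "j \<le> n"
      have "mact n A (mact n ?B x) j = mact n A (\<lambda>l. (1 / \<mu>) * mact n B x l) j"
        unfolding mact_def[of n A] using mact_smult[OF B(1)] by (intro sum.cong refl) simp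
      also have "\<dots> = (1 / \<mu>) * mact n (A * B) x j"
        by (simp only: mact_scaled_point mact_mult[OF A B(1) j])
      finally show "mact n A (mact n ?B x) j = (1 / \<mu>) * x j"
        using j by (simp add: B(2) mact_1)
    qed
    finally show "meval x (conj_act n ?A q $ i) = meval x (scale (\<mu> * (1 / \<mu>) ^ d) q' $ i)"
      unfolding meval_scaled_point[OF q' i] meval_scale[OF q' i] by (simp add: mult.assoc id_def)
  qed
  then show thesis using \<mu>0 by (intro that[OF SL]) auto
qed

lemma finite_roots: "k > 0 \<Longrightarrow> finite {x. x ^ k = (b::'k::field)}"
proof -
  assume k: "k > 0"
  have "coeff (monom 1 k - [:b:]) k = 1" using k by (cases k) auto
  then have "monom 1 k - [:b:] \<noteq> 0" by force
  then have "finite {x. poly (monom 1 k - [:b:]) x = 0}" by (rule poly_roots_finite)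
  then show ?thesis by (simp add: poly_monom)
qed

text \<open>A stabilizing matrix conjugates \<open>q\<close> to a multiple \<open>c q\<close>.
  Scaled by a \<open>(d - 1)\<close>-st root of \<open>c\<close> it is an exact semiconjugacy, and
  of these there are finitely many. Since \<open>A\<close> has determinant 1, the scalar satisfies
  \<open>\<mu> ^ (n + 1) = det A'\<close>, which leaves finitely many choices.\<close>

lemma finite_stabilizer:
  fixes q :: "'k::alg_closed_field tuple"
  assumes q: "q \<in> tuples n d" "nozero n q" and d: "d > 1"
  shows "finite (stabilizer n (tuple_class q))"
proof -
  let ?X = "{A \<in> carrier_mat (n + 1) (n + 1).
    \<forall>x. \<forall>i<n + 1. meval (mact n A x) (q $ i) = mact n A (\<lambda>j. meval x (q $ j)) i}"
  have "stabilizer n (tuple_class q) \<subseteq> (\<Union>A'\<in>?X. (\<lambda>\<mu>. (1 / \<mu>) \<cdot>\<^sub>m A') ` {\<mu>. \<mu> ^ (n + 1) = det A'})"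
  proof
    fix A assume "A \<in> stabilizer n (tuple_class q)"
    then have A: "A \<in> SL (n + 1)" "conj_act n A ` tuple_class q = tuple_class q"
      by (auto simp: stabilizer_def)
    then have "conj_act n A q \<in> tuple_class q" using tuple_class_self by blast
    then obtain c where c: "c \<noteq> 0" "conj_act n A q = scale c q" by (auto simp: tuple_class_def)
    obtain B where B: "B \<in> SL (n + 1)" "A * B = 1\<^sub>m (n + 1)" "B * A = 1\<^sub>m (n + 1)"
      by (rule SL_inverse[OF A(1)]) blast
    have car: "A \<in> carrier_mat (n + 1) (n + 1)" "B \<in> carrier_mat (n + 1) (n + 1)"
      using A B by (auto simp: SL_def)
    have semi: "mact n A (\<lambda>j. meval y (q $ j)) i = c * meval (mact n A y) (q $ i)" if i: "i < n + 1" for y i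
    proof -
      have "meval (mact n B (mact n A y)) (q $ j) = meval y (q $ j)" if "j < n + 1" for j
        using mact_mult[OF car(2,1), of _ y] by (intro meval_tuple_cong[OF q(1) that]) (simp add: B(3) mact_1)
      then have "mact n A (\<lambda>j. meval y (q $ j)) i = meval (mact n A y) (conj_act n A q $ i)"
        unfolding meval_conj_act[OF q(1) A(1) car(2) B(2) i] by (simp add: mact_def)
      then show ?thesis unfolding c(2) meval_scale[OF q(1) i] .
    qed
    obtain \<mu> where \<mu>: "\<mu> ^ (d - 1) = c"
      using nth_root_exists[of "d - 1" c] d by auto
    then have \<mu>0: "\<mu> \<noteq> 0" using c(1) d by (auto simp: power_0_left)
    have "\<mu> \<cdot>\<^sub>m A \<in> ?X"
    proof (intro CollectI conjI allI impI)
      fix x i assume i: "i < n + 1"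
      have "meval (mact n (\<mu> \<cdot>\<^sub>m A) x) (q $ i) = \<mu> ^ d * meval (mact n A x) (q $ i)"
        by (rule meval_smult_mat[OF q(1) i car(1)])
      also have "\<mu> ^ d = \<mu> * c"
        using d by (simp add: \<mu>[symmetric] flip: power_Suc)
      also have "\<mu> * c * meval (mact n A x) (q $ i) = \<mu> * mact n A (\<lambda>j. meval x (q $ j)) i"
        by (simp only: semi[OF i] mult.assoc)
      also have "\<dots> = mact n (\<mu> \<cdot>\<^sub>m A) (\<lambda>j. meval x (q $ j)) i"
        using i by (intro mact_smult[OF car(1), symmetric]) simp
      finally show "meval (mact n (\<mu> \<cdot>\<^sub>m A) x) (q $ i) = mact n (\<mu> \<cdot>\<^sub>m A) (\<lambda>j. meval x (q $ j)) i" .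
    qed (use car in simp)
    moreover have "det (\<mu> \<cdot>\<^sub>m A) = \<mu> ^ (n + 1)"
      using A(1) carrier_matD(2)[OF car(1)] by (simp add: SL_def)
    moreover have "A = (1 / \<mu>) \<cdot>\<^sub>m (\<mu> \<cdot>\<^sub>m A)"
      using \<mu>0 by (intro eq_matI) auto
    ultimately show "A \<in> (\<Union>A'\<in>?X. (\<lambda>\<mu>. (1 / \<mu>) \<cdot>\<^sub>m A') ` {\<mu>. \<mu> ^ (n + 1) = det A'})"
      by (intro UN_I[of "\<mu> \<cdot>\<^sub>m A"] image_eqI[of _ _ \<mu>]) auto
  qed
  moreover have "finite (\<Union>A'\<in>?X. (\<lambda>\<mu>. (1 / \<mu>) \<cdot>\<^sub>m A') ` {\<mu>. \<mu> ^ (n + 1) = det A'})"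
    using finite_semiconj[OF q d] by (intro finite_UN_I finite_imageI finite_roots) auto
  ultimately show ?thesis by (rule finite_subset)
qed

section \<open>Separating orbits\<close>

text \<open>
  Setting the variables other than the coordinates to zero, since elimination may return a polynomial
  which contains them.
\<close>
definition restrict_coords :: "nat \<Rightarrow> nat \<Rightarrow> (coord, 'k::comm_ring_1) mpoly \<Rightarrow> (coord, 'k) mpoly" where
  "restrict_coords n d = msubst mconst (\<lambda>v. if v \<in> coords n d then mvar v else 0)"

lemma eval_restrict_hom: "comm_ring_hom (\<lambda>F. eval_coords (restrict_coords n d F) q)"
  using comp_hom[OF eval_coords_hom msubst_hom[OF mconst_hom]]
  by (simp add: restrict_coords_def[abs_def] comp_def)

lemma eval_restrict_mconst: "eval_coords (restrict_coords n d (mconst a)) q = a"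
  by (simp add: restrict_coords_def)

lemma eval_restrict_mvar:
  "i < n + 1 \<Longrightarrow> m \<in> monoms {..n} d \<Longrightarrow>
    eval_coords (restrict_coords n d (mvar (i, m))) q = lookup (q $ i) m"
  by (simp add: restrict_coords_def mconst_def[of 1] coords_def)

lemma restrict_coords_components:
  fixes P :: "(coord, 'k::comm_ring_1) mpoly"
  obtains R H where "finite R" "\<And>r. H r \<in> forms (coords n d) r" "restrict_coords n d P = (\<Sum>r\<in>R. H r)"
proof -
  let ?\<rho> = "\<lambda>v. if v \<in> coords n d then mvar v else 0 :: (coord, 'k) mpoly"
  define H where "H r = (\<Sum>m\<in>{m \<in> keys P. mdeg m = r}. mconst (lookup P m) * mon ?\<rho> m)" for r
  show thesis
  proof (rule that[of "mdeg ` keys P" H])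
    show "H r \<in> forms (coords n d) r" for r
      unfolding H_def
    proof (intro forms_sum forms_scale)
      fix m assume "m \<in> {m \<in> keys P. mdeg m = r}"
      moreover have "?\<rho> v \<in> forms (coords n d) 1" for v
        by (simp add: forms_mvar[unfolded One_nat_def])
      then have "mon ?\<rho> m \<in> forms (coords n d) (mdeg m * 1)"
        by (intro forms_mon[of m UNIV]) simp_all
      ultimately have "mon ?\<rho> m \<in> forms (coords n d) (r * 1)" by simp
      then show "mon ?\<rho> m \<in> forms (coords n d) r" by simp
    qed
    have "restrict_coords n d P = (\<Sum>m\<in>keys P. mconst (lookup P m) * mon ?\<rho> m)"
      unfolding restrict_coords_def msubst_def mon_def ..
    also have "\<dots> = (\<Sum>r\<in>mdeg ` keys P. H r)"
      unfolding H_def by (rule sum.image_gen) simp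
    finally show "restrict_coords n d P = (\<Sum>r\<in>mdeg ` keys P. H r)" .
  qed simp
qed

text \<open>Here \<open>e r\<close> stands for the value of a component of degree \<open>r\<close>:
  a polynomial that vanishes on a punctured line through the origin has all its components vanishing
  there, because the field is infinite.\<close>

lemma homogeneous_components_vanish:
  fixes e :: "nat \<Rightarrow> 'k::alg_closed_field"
  assumes "finite R" "\<And>c. c \<noteq> 0 \<Longrightarrow> (\<Sum>r\<in>R. c ^ r * e r) = 0" "r \<in> R"
  shows "e r = 0"
proof -
  define p where "p = (\<Sum>r\<in>R. monom (e r) r)"
  have "poly p c = 0" if "c \<noteq> 0" for c
    using assms(2)[OF that] by (simp add: p_def poly_sum poly_monom mult.commute)
  then have "UNIV - {0} \<subseteq> {c. poly p c = 0}" by auto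
  moreover have "infinite (UNIV - {0} :: 'k set)"
    using infinite_UNIV_alg_closed by simp
  ultimately have "p = 0"
    using poly_roots_finite[of p] finite_subset by blast
  moreover have "coeff p r = e r"
    using assms(1,3) by (simp add: p_def coeff_sum)
  ultimately show ?thesis by simp
qed

text \<open>
  The orbit of \<open>q\<close> is the set of those \<open>q'\<close> for which the homogeneous system \<open>q'(A x) = z\<^sup>d\<^sup>-\<^sup>1 A q(x)\<close>,
  \<open>q(B x) = z\<^sup>d\<^sup>-\<^sup>1 B q'(x)\<close>, \<open>A B = z\<^sup>2\<close> has a nontrivial solution: solutions with \<open>z = 0\<close> are trivial because
  \<open>q\<close> and \<open>q'\<close> are morphisms. Without the inverse \<open>B\<close> the limit of a sequence of conjugating matrices
  could be a nonzero singular matrix.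
\<close>
lemma orbit_separation_poly:
  fixes q q' :: "'k::alg_closed_field tuple"
  assumes q: "q \<in> tuples n d" "nozero n q" and q': "q' \<in> tuples n d" "nozero n q'" and d: "d > 1"
    and sep: "\<And>A c. A \<in> SL (n + 1) \<Longrightarrow> c \<noteq> 0 \<Longrightarrow> conj_act n A q \<noteq> scale c q'"
  obtains P where "eval_coords (restrict_coords n d P) q' \<noteq> 0"
    "\<And>A c. A \<in> SL (n + 1) \<Longrightarrow> c \<noteq> 0 \<Longrightarrow> eval_coords (restrict_coords n d P) (scale c (conj_act n A q)) = 0"
proof -
  let ?N = "(n + 1) * (n + 1)"
  let ?z = "2 * ?N"
  let ?\<iota> = "mconst :: 'k \<Rightarrow> (coord, 'k) mpoly"
  let ?h = "\<lambda>p F. eval_coords (restrict_coords n d F) p"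
  let ?gen = "generic_form n d :: nat \<Rightarrow> (nat, (coord, 'k) mpoly) mpoly" and ?lift = "lift_form ?\<iota> q"
  obtain T :: "(nat \<Rightarrow> 'k) set" where T: "finite T"
    "\<And>p. p \<in> forms {..n} d \<Longrightarrow> (\<And>x. x \<in> T \<Longrightarrow> meval x p = 0) \<Longrightarrow> p = 0"
    by (rule test_points) blast
  define S1 where "S1 = (\<lambda>(x, i). semiconj_form n d ?\<iota> ?z 0 ?gen ?lift x i) ` (T \<times> {..<n + 1})"
  define S2 where "S2 = (\<lambda>(x, i). semiconj_form n d ?\<iota> ?z ?N ?lift ?gen x i) ` (T \<times> {..<n + 1})"
  define prod_form where "prod_form i j = (\<Sum>l<n + 1. mvar (mat_var n 0 i l) * mvar (mat_var n ?N l j)) -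
      (if i = j then mvar ?z ^ 2 else 0 :: (nat, (coord, 'k) mpoly) mpoly)" for i j
  \<comment> \<open>The entries of the matrix equation are quadratic and are raised to degree
    \<open>d\<close> by powers of all variables, which adds no nontrivial zeros.\<close>
  define S3 where "S3 = (\<lambda>((i, j), v). prod_form i j * mvar v ^ (d - 2)) ` (({..<n + 1} \<times> {..<n + 1}) \<times> {..?z})"
  have lift: "?lift i \<in> forms {..n} d" if "i < n + 1" for i
    by (rule lift_form_forms[OF tuplesD(1)[OF q(1) that]])
  have hom: "comm_ring_hom (?h p)" for p by (rule eval_restrict_hom)
  have h\<iota>: "?h p (?\<iota> a) = a" for p a by (rule eval_restrict_mconst)
  have mv: "mat_var n 0 i j \<le> ?z" "mat_var n ?N i j \<le> ?z" if "i < n + 1" "j < n + 1" for i j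
    using mat_var_less[OF that, of 0] mat_var_less[OF that, of ?N] by simp_all
  have S12: "S1 \<subseteq> forms {..?z} d" "S2 \<subseteq> forms {..?z} d"
    unfolding S1_def S2_def using d lift by (auto intro!: semiconj_form_forms generic_form_forms)
  have S3: "S3 \<subseteq> forms {..?z} d"
  proof
    fix g assume "g \<in> S3"
    then obtain i j v where g: "g = prod_form i j * mvar v ^ (d - 2)" "i < n + 1" "j < n + 1" "v \<le> ?z"
      unfolding S3_def by auto
    have "mvar ?z ^ 2 \<in> (forms {..?z} (1 + 1) :: (nat, (coord, 'k) mpoly) mpoly set)"
      unfolding power2_eq_square by (intro forms_mult forms_mvar) simp_all
    then have "prod_form i j \<in> forms {..?z} (1 + 1)"
      unfolding prod_form_def using mv g(2,3)
      by (intro forms_diff forms_sum forms_mult forms_mvar) auto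
    then have "g \<in> forms {..?z} (1 + 1 + (d - 2) * 1)"
      unfolding g(1) using g(4) by (intro forms_mult forms_power forms_mvar) auto
    moreover have "1 + 1 + (d - 2) * 1 = d" using d by simp
    ultimately show "g \<in> forms {..?z} d" by (simp only:)
  qed
  have gen: "msubst (?h p) y (?gen i) = meval y (p $ i)" if "p \<in> tuples n d" "i < n + 1" for p y i
  proof -
    interpret h: comm_ring_hom "?h p" by (rule hom)
    have "msubst (\<lambda>c. id (?h p c)) y (?gen i) = meval y (p $ i)"
      by (rule msubst_generic_form[OF tuplesD(1)[OF that]]) (simp_all add: eval_restrict_mvar[OF that(2)])
    then show ?thesis by simp
  qed
  have liftev: "msubst (?h p) y (?lift i) = meval y (q $ i)" for p y i
    by (rule msubst_lift_form[OF hom h\<iota>]) simp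
  have ev1: "msubst (?h p) X (semiconj_form n d ?\<iota> ?z 0 ?gen ?lift x i) =
      meval (mact n (point_mat n 0 X) x) (p $ i) - X ?z ^ (d - 1) * mact n (point_mat n 0 X) (\<lambda>j. meval x (q $ j)) i"
    if "p \<in> tuples n d" "i < n + 1" for p X x i
    using msubst_semiconj_form[where h = "?h p" and \<iota> = ?\<iota> and Q' = ?gen and X = X and z = ?z and s = 0 and Q = ?lift
        and x = x, OF hom h\<iota> generic_form_forms that(2)]
    unfolding gen[OF that] liftev .
  have ev2: "msubst (?h p) X (semiconj_form n d ?\<iota> ?z ?N ?lift ?gen x i) =
      meval (mact n (point_mat n ?N X) x) (q $ i) - X ?z ^ (d - 1) * mact n (point_mat n ?N X) (\<lambda>j. meval x (p $ j)) i"
    if "p \<in> tuples n d" "i < n + 1" for p X x i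
  proof -
    have "mact n (point_mat n ?N X) (\<lambda>j. msubst (?h p) x (?gen j)) i = mact n (point_mat n ?N X) (\<lambda>j. meval x (p $ j)) i"
      unfolding mact_def by (intro sum.cong refl) (simp add: gen[OF that(1)] del: One_nat_def)
    then show ?thesis
      using msubst_semiconj_form[where h = "?h p" and \<iota> = ?\<iota> and Q' = ?lift and X = X and z = ?z and s = ?N and Q = ?gen
          and x = x, OF hom h\<iota> lift[OF that(2)] that(2)]
      unfolding liftev by (simp only:)
  qed
  have ev3: "msubst (?h p) X (prod_form i j * mvar v ^ (d - 2)) =
      ((point_mat n 0 X * point_mat n ?N X) $$ (i, j) - (if i = j then X ?z ^ 2 else 0)) * X v ^ (d - 2)"
    if "i < n + 1" "j < n + 1" for p X i j v
  proof -
    interpret h: comm_ring_hom "?h p" by (rule hom)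
    interpret H: comm_ring_hom "msubst (?h p) X" by (rule msubst_hom[OF hom])
    have "(point_mat n 0 X * point_mat n ?N X) $$ (i, j) = (\<Sum>l<n + 1. X (mat_var n 0 i l) * X (mat_var n ?N l j))"
      using that by (simp add: point_mat_def scalar_prod_def lessThan_atLeast0)
    then show ?thesis
      unfolding prod_form_def H.hom_mult H.hom_minus H.hom_sum H.hom_power by (simp add: H.hom_power)
  qed
  have nz: "\<exists>g\<in>S1 \<union> S2 \<union> S3. msubst (?h q') X g \<noteq> 0" if X: "\<exists>j\<le>?z. X j \<noteq> 0" for X
  proof (rule ccontr)
    assume "\<not> (\<exists>g\<in>S1 \<union> S2 \<union> S3. msubst (?h q') X g \<noteq> 0)"
    then have all: "msubst (?h q') X g = 0" if "g \<in> S1 \<union> S2 \<union> S3" for g using that by blast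
    let ?A = "point_mat n 0 X" and ?B = "point_mat n ?N X"
    have e1: "meval (mact n ?A x) (q' $ i) - X ?z ^ (d - 1) * mact n ?A (\<lambda>j. meval x (q $ j)) i = 0"
      if "x \<in> T" "i < n + 1" for x i
      unfolding ev1[OF q'(1) that(2), symmetric]
      by (rule all) (use that in \<open>auto simp: S1_def intro!: image_eqI[of _ _ "(x, i)"]\<close>)
    have e2: "meval (mact n ?B x) (q $ i) - X ?z ^ (d - 1) * mact n ?B (\<lambda>j. meval x (q' $ j)) i = 0"
      if "x \<in> T" "i < n + 1" for x i
      unfolding ev2[OF q'(1) that(2), symmetric]
      by (rule all) (use that in \<open>auto simp: S2_def intro!: image_eqI[of _ _ "(x, i)"]\<close>)
    have e3: "((?A * ?B) $$ (i, j) - (if i = j then X ?z ^ 2 else 0)) * X v ^ (d - 2) = 0"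
      if "i < n + 1" "j < n + 1" "v \<le> ?z" for i j v
      unfolding ev3[OF that(1,2), of q' X v, symmetric]
      by (rule all) (use that in \<open>auto simp: S3_def intro!: image_eqI[of _ _ "((i, j), v)"]\<close>)
    have z0: "X ?z \<noteq> 0"
    proof
      assume z: "X ?z = 0"
      have p0: "X ?z ^ (d - 1) = 0" using z d by (simp add: power_0_left)
      have A0: "?A $$ (i, j) = 0" if "i < n + 1" "j < n + 1" for i j
        using e1 unfolding p0 by (intro zero_mat_if_degenerate[OF q' T(2) _ that]) simp_all
      have B0: "?B $$ (i, j) = 0" if "i < n + 1" "j < n + 1" for i j
        using e2 unfolding p0 by (intro zero_mat_if_degenerate[OF q T(2) _ that]) simp_all
      obtain v where v: "v \<le> ?z" "X v \<noteq> 0" using X by blast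
      define w where "w = (if v < ?N then v else v - ?N)"
      have "v \<noteq> ?z" using v(2) z by auto
      then have w: "w < ?N" using v(1) by (auto simp: w_def)
      then have dm: "w div (n + 1) < n + 1" "w mod (n + 1) < n + 1"
        by (auto simp: less_mult_imp_div_less)
      have mw: "mat_var n s (w div (n + 1)) (w mod (n + 1)) = s + w" for s
        by (simp only: mat_var_def add.assoc div_mult_mod_eq)
      show False
      proof (cases "v < ?N")
        case True
        then show False using A0[OF dm] dm v(2) mw[of 0] by (simp add: point_mat_def w_def)
      next
        case False
        then have "?N + w = v" by (simp add: w_def)
        then show False using B0[OF dm] dm v(2) mw[of ?N] by (simp add: point_mat_def)
      qed
    qed
    \<comment> \<open>Scaling to \<open>z = 1\<close> turns \<open>A B = z^2\<close> into mutually
      inverse matrices and the homogenised equation into an exact semiconjugacy.\<close>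
    let ?t = "1 / X ?z"
    have t0: "?t \<noteq> 0" using z0 by simp
    have AB: "?A * ?B = X ?z ^ 2 \<cdot>\<^sub>m 1\<^sub>m (n + 1)"
    proof (rule eq_matI)
      fix i j assume "i < dim_row (X ?z ^ 2 \<cdot>\<^sub>m 1\<^sub>m (n + 1))" "j < dim_col (X ?z ^ 2 \<cdot>\<^sub>m 1\<^sub>m (n + 1))"
      then have ij: "i < n + 1" "j < n + 1" by auto
      then show "(?A * ?B) $$ (i, j) = (X ?z ^ 2 \<cdot>\<^sub>m 1\<^sub>m (n + 1)) $$ (i, j)"
        using e3[OF ij order_refl] z0 by auto
    qed (auto simp: point_mat_def)
    have inv: "(?t \<cdot>\<^sub>m ?A) * (?t \<cdot>\<^sub>m ?B) = 1\<^sub>m (n + 1)"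
    proof -
      have "(?t \<cdot>\<^sub>m ?A) * (?t \<cdot>\<^sub>m ?B) = (?t * ?t) \<cdot>\<^sub>m (?A * ?B)"
        by (rule smult_mult_smult_mat[OF point_mat_carrier point_mat_carrier])
      also have "\<dots> = 1\<^sub>m (n + 1)"
        unfolding AB using z0 by (intro eq_matI) (auto simp: power2_eq_square)
      finally show ?thesis .
    qed
    have semi: "meval (mact n ?A x) (q' $ i) = X ?z ^ (d - 1) * mact n ?A (\<lambda>j. meval x (q $ j)) i"
      if i: "i < n + 1" for x i
    proof -
      \<comment> \<open>The equation is known at the test points only. Both sides are forms of
        degree \<open>d\<close> in \<open>x\<close>, so it holds everywhere.\<close>
      let ?p = "precomp n q' ?A $ i - mconst (X ?z ^ (d - 1)) * (\<Sum>j<n + 1. mconst (?A $$ (i, j)) * q $ j)"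
      have evp: "meval x ?p = meval (mact n ?A x) (q' $ i) - X ?z ^ (d - 1) * mact n ?A (\<lambda>j. meval x (q $ j)) i" for x
      proof -
        interpret comm_ring_hom "meval x :: (nat, 'k) mpoly \<Rightarrow> 'k" by (rule meval_hom)
        show ?thesis
          by (simp only: hom_minus hom_mult hom_sum meval_precomp[OF q'(1) i] mact_def[of n ?A "\<lambda>j. meval x (q $ j)"] msubst_mconst id_apply)
      qed
      have "?p \<in> forms {..n} d"
        using i by (intro forms_diff forms_scale forms_sum tuplesD(1)[OF q(1)] tuplesD(1)[OF precomp_tuples[OF q'(1)]]) auto
      then have "?p = 0"
      proof (rule T(2))
        fix x assume "x \<in> T"
        then show "meval x ?p = 0" unfolding evp by (rule e1[OF _ i])
      qed
      then have "meval x ?p = 0" by (simp only: msubst_def keys_zero sum.empty)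
      then show ?thesis unfolding evp by (rule right_minus_eq[THEN iffD1])
    qed
    have "meval (mact n (?t \<cdot>\<^sub>m ?A) x) (q' $ i) = mact n (?t \<cdot>\<^sub>m ?A) (\<lambda>j. meval x (q $ j)) i" if i: "i < n + 1" for x i
    proof -
      have "meval (mact n (?t \<cdot>\<^sub>m ?A) x) (q' $ i) = ?t ^ d * (X ?z ^ (d - 1) * mact n ?A (\<lambda>j. meval x (q $ j)) i)"
        unfolding meval_smult_mat[OF q'(1) i point_mat_carrier] semi[OF i] ..
      also have "?t ^ d * (X ?z ^ (d - 1) * mact n ?A (\<lambda>j. meval x (q $ j)) i) = ?t * mact n ?A (\<lambda>j. meval x (q $ j)) i"
      proof -
        have "?t ^ d = ?t * ?t ^ (d - 1)" using d by (simp flip: power_Suc)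
        moreover have "?t ^ (d - 1) * X ?z ^ (d - 1) = 1" using z0 by (simp flip: power_mult_distrib)
        ultimately show ?thesis by simp
      qed
      also have "\<dots> = mact n (?t \<cdot>\<^sub>m ?A) (\<lambda>j. meval x (q $ j)) i"
        using i by (intro mact_smult[OF point_mat_carrier, symmetric]) simp
      finally show ?thesis .
    qed
    then obtain A' c where "A' \<in> SL (n + 1)" "c \<noteq> 0" "conj_act n A' q = scale c q'"
      by (rule semiconj_imp_conj[OF q(1) q'(1) smult_carrier_mat[OF point_mat_carrier] smult_carrier_mat[OF point_mat_carrier] inv])
    then show False using sep by blast
  qed
  obtain P where P: "?h q' P \<noteq> 0"
    "\<And>p X. \<exists>j\<le>?z. X j \<noteq> 0 \<Longrightarrow> (\<And>g. g \<in> S1 \<union> S2 \<union> S3 \<Longrightarrow> msubst (?h p) X g = 0) \<Longrightarrow> ?h p P = 0"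
  proof (rule elimination_set[of "S1 \<union> S2 \<union> S3" ?z d "?h q'" ?\<iota>])
    show "finite (S1 \<union> S2 \<union> S3)" using T(1) by (simp add: S1_def S2_def S3_def)
    fix P assume P: "?h q' P \<noteq> 0" "\<And>h x. comm_ring_hom h \<Longrightarrow> (\<And>a. h (?\<iota> a) = a) \<Longrightarrow> \<exists>j\<le>?z. x j \<noteq> 0 \<Longrightarrow>
      (\<And>g. g \<in> S1 \<union> S2 \<union> S3 \<Longrightarrow> msubst h x g = 0) \<Longrightarrow> h P = 0"
    show thesis by (rule that[OF P(1)]) (rule P(2)[OF hom h\<iota>])
  qed (use S12 S3 d nz hom h\<iota> in auto)
  show thesis
  proof (rule that[OF P(1)])
    fix A :: "'k mat" and c :: 'k assume A: "A \<in> SL (n + 1)" and c: "c \<noteq> 0"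
    obtain B where B: "B \<in> SL (n + 1)" "A * B = 1\<^sub>m (n + 1)" "B * A = 1\<^sub>m (n + 1)"
      by (rule SL_inverse[OF A]) blast
    have car: "A \<in> carrier_mat (n + 1) (n + 1)" "B \<in> carrier_mat (n + 1) (n + 1)"
      using A B by (auto simp: SL_def)
    have Aq: "conj_act n A q \<in> tuples n d" by (rule conj_act_tuples[OF q(1) car(1)])
    let ?p = "scale c (conj_act n A q)"
    have p: "?p \<in> tuples n d" by (rule scale_tuples[OF Aq])
    \<comment> \<open>Conjugating by \<open>\<mu> A\<close> instead of \<open>A\<close> multiplies
      the result by the inverse of \<open>\<mu> ^ (d - 1)\<close>, which is \<open>c\<close>. So the
      multiple \<open>?p\<close> is an exact conjugate as well.\<close>
    obtain \<mu> where \<mu>: "\<mu> ^ (d - 1) = 1 / c"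
      using nth_root_exists[of "d - 1" "1 / c"] d by auto
    then have \<mu>0: "\<mu> \<noteq> 0" using c d by (auto simp: power_0_left)
    have \<mu>d: "\<mu> ^ d * c = \<mu>"
    proof -
      have "\<mu> ^ d = \<mu> * \<mu> ^ (d - 1)" using d by (simp flip: power_Suc)
      then show ?thesis unfolding \<mu> using c by simp
    qed
    let ?A = "\<mu> \<cdot>\<^sub>m A" and ?B = "(1 / \<mu>) \<cdot>\<^sub>m B"
    \<comment> \<open>The nontrivial solution: the entries of \<open>?A\<close>, then those of its
      inverse \<open>?B\<close>, then \<open>z = 1\<close>.\<close>
    define X where "X k = (if k < ?N then ?A $$ (k div (n + 1), k mod (n + 1))
        else if k < ?z then ?B $$ ((k - ?N) div (n + 1), (k - ?N) mod (n + 1)) else 1)" for k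
    have dm: "mat_var n 0 i j div (n + 1) = i" "mat_var n 0 i j mod (n + 1) = j" "mat_var n ?N i j - ?N = mat_var n 0 i j"
      if "i < n + 1" "j < n + 1" for i j
      using mat_var_div_mod[OF that(2)] by (simp_all add: mat_var_def)
    have XA: "point_mat n 0 X = ?A"
    proof (rule eq_matI)
      fix i j assume "i < dim_row ?A" "j < dim_col ?A"
      then have ij: "i < n + 1" "j < n + 1" using car by auto
      then show "point_mat n 0 X $$ (i, j) = ?A $$ (i, j)"
        using mat_var_less[OF ij, of 0] dm(1,2)[OF ij] by (simp add: point_mat_def X_def del: index_smult_mat)
    qed (use car in \<open>auto simp: point_mat_def\<close>)
    have XB: "point_mat n ?N X = ?B"
    proof (rule eq_matI)
      fix i j assume "i < dim_row ?B" "j < dim_col ?B"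
      then have ij: "i < n + 1" "j < n + 1" using car by auto
      have "\<not> mat_var n ?N i j < ?N" by (simp add: mat_var_def)
      moreover have "mat_var n ?N i j < ?z" using mat_var_less[OF ij, of ?N] by simp
      ultimately have "X (mat_var n ?N i j) = ?B $$ (i, j)"
        unfolding X_def dm(3)[OF ij] dm(1,2)[OF ij] by (simp only: if_True if_False)
      then show "point_mat n ?N X $$ (i, j) = ?B $$ (i, j)"
        using ij by (simp add: point_mat_def del: index_smult_mat)
    qed (use car in \<open>auto simp: point_mat_def\<close>)
    have Xz: "X ?z = 1" by (simp add: X_def)
    have pev: "meval y (?p $ i) = c * mact n A (\<lambda>j. meval (mact n B y) (q $ j)) i" if "i < n + 1" for y i
      unfolding meval_scale[OF Aq that] meval_conj_act[OF q(1) A car(2) B(2) that] mact_def[of n A] ..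
    have s1: "meval (mact n ?A x) (?p $ i) = mact n ?A (\<lambda>j. meval x (q $ j)) i" if i: "i < n + 1" for x i
    proof -
      have BA: "meval (mact n B (mact n A x)) (q $ j) = meval x (q $ j)" if "j < n + 1" for j
        using mact_mult[OF car(2,1), of _ x] by (intro meval_tuple_cong[OF q(1) that]) (simp add: B(3) mact_1)
      have "meval (mact n ?A x) (?p $ i) = \<mu> ^ d * meval (mact n A x) (?p $ i)"
        by (rule meval_smult_mat[OF p i car(1)])
      also have "meval (mact n A x) (?p $ i) = c * mact n A (\<lambda>j. meval (mact n B (mact n A x)) (q $ j)) i"
        by (rule pev[OF i])
      also have "mact n A (\<lambda>j. meval (mact n B (mact n A x)) (q $ j)) i = mact n A (\<lambda>j. meval x (q $ j)) i"
        unfolding mact_def[of n A] by (intro sum.cong refl) (simp add: BA[unfolded mact_def[of n A]] del: One_nat_def)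
      also have "\<mu> ^ d * (c * mact n A (\<lambda>j. meval x (q $ j)) i) = \<mu> * mact n A (\<lambda>j. meval x (q $ j)) i"
        by (simp only: mult.assoc[symmetric] \<mu>d)
      also have "\<dots> = mact n ?A (\<lambda>j. meval x (q $ j)) i"
        using i by (intro mact_smult[OF car(1), symmetric]) simp
      finally show ?thesis .
    qed
    have s2: "meval (mact n ?B x) (q $ i) = mact n ?B (\<lambda>j. meval x (?p $ j)) i" if i: "i < n + 1" for x i
    proof -
      let ?y = "\<lambda>j. meval (mact n B x) (q $ j)"
      have "mact n ?B (\<lambda>j. meval x (?p $ j)) i = (1 / \<mu>) * mact n B (\<lambda>j. meval x (?p $ j)) i"
        using i by (intro mact_smult[OF car(2)]) simp
      also have "mact n B (\<lambda>j. meval x (?p $ j)) i = mact n B (\<lambda>j. c * mact n A ?y j) i"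
        unfolding mact_def[of n B] by (intro sum.cong refl) (simp add: pev[unfolded mact_def[of n B]] del: One_nat_def)
      also have "\<dots> = c * mact n (B * A) ?y i"
        using i by (simp only: mact_scaled_point) (simp add: mact_mult[OF car(2,1)])
      also have "\<dots> = c * ?y i" using i by (simp add: B(3) mact_1)
      also have "(1 / \<mu>) * (c * ?y i) = (1 / \<mu>) ^ d * ?y i"
      proof -
        have "\<mu> ^ d \<noteq> 0" using \<mu>0 by simp
        then have "(1 / \<mu>) * c = (1 / \<mu>) ^ d"
          using \<mu>d \<mu>0 by (simp add: field_simps power_divide)
        then show ?thesis by (simp only: mult.assoc[symmetric])
      qed
      also have "\<dots> = meval (mact n ?B x) (q $ i)"
        by (rule meval_smult_mat[OF q(1) i car(2), symmetric])
      finally show ?thesis by (rule sym)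
    qed
    have s3: "?A * ?B = 1\<^sub>m (n + 1)" by (rule smult_mat_inverse_pair[OF car B(2) \<mu>0])
    show "?h ?p P = 0"
    proof (rule P(2))
      show "\<exists>j\<le>?z. X j \<noteq> 0" using Xz by (intro exI[of _ ?z]) simp
      fix g assume "g \<in> S1 \<union> S2 \<union> S3"
      then consider "g \<in> S1" | "g \<in> S2" | "g \<in> S3" by blast
      then show "msubst (?h ?p) X g = 0"
      proof cases
        case 1
        then obtain xi where xi: "g = (\<lambda>(x, i). semiconj_form n d ?\<iota> ?z 0 ?gen ?lift x i) xi" "xi \<in> T \<times> {..<n + 1}"
          unfolding S1_def by (rule imageE)
        obtain x i where "xi = (x, i)" by (cases xi)
        with xi have g: "g = semiconj_form n d ?\<iota> ?z 0 ?gen ?lift x i" "i < n + 1"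
          by simp_all
        show ?thesis unfolding g(1) ev1[OF p g(2)] XA Xz s1[OF g(2)] by simp
      next
        case 2
        then obtain xi where xi: "g = (\<lambda>(x, i). semiconj_form n d ?\<iota> ?z ?N ?lift ?gen x i) xi" "xi \<in> T \<times> {..<n + 1}"
          unfolding S2_def by (rule imageE)
        obtain x i where "xi = (x, i)" by (cases xi)
        with xi have g: "g = semiconj_form n d ?\<iota> ?z ?N ?lift ?gen x i" "i < n + 1"
          by simp_all
        show ?thesis unfolding g(1) ev2[OF p g(2)] XB Xz s2[OF g(2)] by simp
      next
        case 3
        then obtain i j v where g: "g = prod_form i j * mvar v ^ (d - 2)" "i < n + 1" "j < n + 1"
          unfolding S3_def by auto
        show ?thesis unfolding g(1) ev3[OF g(2,3)] XA XB Xz s3 using g(2,3) by simp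
      qed
    qed
  qed
qed

text \<open>The polynomial obtained by elimination may be inhomogeneous, but it vanishes on all
  nonzero multiples of the orbit, hence so do its homogeneous components, one of which is nonzero at
  \<open>q'\<close>.\<close>

lemma orbit_separation:
  fixes q q' :: "'k::alg_closed_field tuple"
  assumes q: "q \<in> tuples n d" "nozero n q" and q': "q' \<in> tuples n d" "nozero n q'" and d: "d > 1"
    and sep: "\<And>A c. A \<in> SL (n + 1) \<Longrightarrow> c \<noteq> 0 \<Longrightarrow> conj_act n A q \<noteq> scale c q'"
  obtains r H where "H \<in> forms (coords n d) r" "eval_coords H q' \<noteq> 0"
    "\<And>A. A \<in> SL (n + 1) \<Longrightarrow> eval_coords H (conj_act n A q) = 0"
proof (rule orbit_separation_poly[OF q q' d sep])
  fix P
  assume P: "eval_coords (restrict_coords n d P) q' \<noteq> 0"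
    "\<And>A c. A \<in> SL (n + 1) \<Longrightarrow> c \<noteq> 0 \<Longrightarrow> eval_coords (restrict_coords n d P) (scale c (conj_act n A q)) = 0"
  obtain R H where H: "finite R" "\<And>r. H r \<in> forms (coords n d) r" "restrict_coords n d P = (\<Sum>r\<in>R. H r)"
    by (rule restrict_coords_components) blast
  have ev: "eval_coords (restrict_coords n d P) p = (\<Sum>r\<in>R. eval_coords (H r) p)" for p
  proof -
    interpret comm_ring_hom "\<lambda>F. eval_coords F p" by (rule eval_coords_hom)
    show ?thesis unfolding H(3) by (rule hom_sum)
  qed
  obtain r where r: "r \<in> R" "eval_coords (H r) q' \<noteq> 0"
    using P(1) unfolding ev by (meson sum.neutral)
  show thesis
  proof (rule that[OF H(2) r(2)])
    fix A :: "'k mat" assume A: "A \<in> SL (n + 1)"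
    then have Aq: "conj_act n A q \<in> tuples n d"
      by (intro conj_act_tuples[OF q(1)]) (simp add: SL_def)
    show "eval_coords (H r) (conj_act n A q) = 0"
    proof (rule homogeneous_components_vanish[OF H(1) _ r(1)])
      fix c :: 'k assume "c \<noteq> 0"
      then show "(\<Sum>r\<in>R. c ^ r * eval_coords (H r) (conj_act n A q)) = 0"
        using P(2)[OF A] by (simp add: ev eval_coords_scale[OF H(2) Aq])
    qed
  qed
qed auto

section \<open>Stability of morphisms\<close>

theorem theorem2p2:
  fixes n d :: nat
  assumes "n \<ge> 1" and "d > 1"
  shows "(Hom n d :: 'k::alg_closed_field tuple set set) \<subseteq> stable_locus n d"
proof
  have d: "d > 1" "d > 0" using assms(2) by auto
  obtain r and F :: "(coord, 'k) mpoly" where F: "r > 0" "F \<in> forms (coords n d) r"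
    "\<And>q. q \<in> tuples n d \<Longrightarrow> eval_coords F q \<noteq> 0 \<longleftrightarrow> nozero n q"
    by (rule resultant[OF d(2), where 'k = 'k and n = n]) (auto simp: nozero_def)
  have inv: "invariant n d F" by (rule invariant_if_zero_locus[OF F(2,3)])
  have inv_eq: "eval_coords G (conj_act n A q) = eval_coords G q"
    if "invariant n d G" "A \<in> SL (n + 1)" "q \<in> tuples n d" for G A and q :: "'k tuple"
    using that by (auto simp: invariant_def)
  have ss: "tuple_class q \<in> semistable_locus n d" if "q \<in> tuples n d" "nozero n q" for q :: "'k tuple"
  proof -
    have "tuple_class q \<in> rat_maps n d" using nozero_nonzero[OF that] by (auto simp: rat_maps_iff)
    moreover have "\<not> vanishes_at F (tuple_class q)"
      using F(3)[OF that(1)] that(2) by (simp add: vanishes_at_class[OF F(2) that(1)])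
    ultimately show ?thesis unfolding semistable_locus_def using F(1,2) inv by blast
  qed
  fix \<phi> :: "'k tuple set" assume "\<phi> \<in> Hom n d"
  then obtain q where q: "q \<in> tuples n d" "nozero n q" "\<phi> = tuple_class q"
    by (rule HomE)
  have Aq: "conj_act n A q \<in> tuples n d" "nozero n (conj_act n A q)" if "A \<in> SL (n + 1)" for A
    using that conj_act_tuples[OF q(1)] nozero_conj_act[OF q(1) that q(2)] by (auto simp: SL_def)
  have orbit: "orbit n \<phi> = {tuple_class (conj_act n A q) | A. A \<in> SL (n + 1)}"
    unfolding orbit_def q(3) using conj_act_class[OF q(1)] by (metis (no_types, lifting))
  \<comment> \<open>All forms that vanish on the orbit, so that \<open>Z\<close> is its Zariski
    closure.\<close>
  define S where "S = {G \<in> \<Union>r. forms (coords n d) r. \<forall>A \<in> SL (n + 1). eval_coords G (conj_act n A q) = 0}"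
  define Z where "Z = {\<psi> \<in> rat_maps n d. \<forall>G\<in>S. vanishes_at G \<psi>}"
  have Z: "zariski_closed n d Z"
    unfolding zariski_closed_def Z_def by (rule exI[of _ S]) (auto simp: S_def)
  have "orbit n \<phi> \<subseteq> Z \<inter> semistable_locus n d"
  proof
    fix \<psi> assume "\<psi> \<in> orbit n \<phi>"
    then obtain A where A: "A \<in> SL (n + 1)" "\<psi> = tuple_class (conj_act n A q)" unfolding orbit by blast
    have "vanishes_at G \<psi>" if "G \<in> S" for G
      using that A(1) unfolding S_def A(2) by (auto simp: vanishes_at_class[OF _ Aq(1)[OF A(1)]])
    moreover have "\<psi> \<in> semistable_locus n d" unfolding A(2) by (rule ss[OF Aq[OF A(1)]])
    ultimately show "\<psi> \<in> Z \<inter> semistable_locus n d" by (auto simp: Z_def semistable_locus_def)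
  qed
  moreover have "Z \<inter> semistable_locus n d \<subseteq> orbit n \<phi>"
  proof
    fix \<psi> assume \<psi>: "\<psi> \<in> Z \<inter> semistable_locus n d"
    then obtain q' where q': "q' \<in> nonzero_tuples n d" "\<psi> = tuple_class q'"
      unfolding Z_def rat_maps_iff by blast
    have q't: "q' \<in> tuples n d" using q'(1) by (simp add: nonzero_tuples_def)
    have vanish: "eval_coords G q' = 0"
      if "G \<in> forms (coords n d) s" "\<And>A. A \<in> SL (n + 1) \<Longrightarrow> eval_coords G (conj_act n A q) = 0" for G s
    proof -
      have "G \<in> S" using that unfolding S_def by blast
      then have "vanishes_at G (tuple_class q')" using \<psi> unfolding Z_def q'(2) by blast
      then show ?thesis using vanishes_at_class[OF that(1) q't] by simp
    qed
    obtain s G where G: "s > 0" "G \<in> forms (coords n d) s" "invariant n d G" "\<not> vanishes_at G \<psi>"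
      using \<psi> unfolding semistable_locus_def by blast
    then have Gq': "eval_coords G q' \<noteq> 0" using vanishes_at_class[OF G(2) q't] q'(2) by simp
    txt \<open>The invariant \<open>F\<^sup>s / G\<^sup>r\<close> of degree zero is constant on the orbit, so \<open>F\<close> does not vanish on its semistable limits.\<close>
    have Fq: "eval_coords F q \<noteq> 0" using F(3)[OF q(1)] q(2) by blast
    have "eval_coords F q' \<noteq> 0"
    proof
      assume Fq': "eval_coords F q' = 0"
      \<comment> \<open>The constancy of the quotient with denominators cleared; both powers have
        degree \<open>s * r\<close>. At \<open>q'\<close> only the term with \<open>G\<close>
        survives, and it is nonzero.\<close>
      let ?H = "mconst (eval_coords G q ^ r) * F ^ s - mconst (eval_coords F q ^ s) * G ^ r"
      have ev: "eval_coords ?H p = eval_coords G q ^ r * eval_coords F p ^ s - eval_coords F q ^ s * eval_coords G p ^ r" for p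
      proof -
        interpret comm_ring_hom "\<lambda>F. eval_coords F p" by (rule eval_coords_hom)
        show ?thesis by (simp add: hom_minus hom_mult hom_power)
      qed
      have "F ^ s \<in> forms (coords n d) (s * r)" "G ^ r \<in> forms (coords n d) (s * r)"
        using forms_power[OF F(2), of s] forms_power[OF G(2), of r] by (simp_all add: mult.commute)
      then have "?H \<in> forms (coords n d) (s * r)"
        by (intro forms_diff forms_scale)
      then have "eval_coords ?H q' = 0"
        by (rule vanish) (simp add: ev inv_eq[OF inv _ q(1)] inv_eq[OF G(3) _ q(1)])
      then show False unfolding ev using Fq Fq' Gq' G(1) by (simp add: power_0_left)
    qed
    then have nz': "nozero n q'" using F(3)[OF q't] by blast
    have "\<exists>A c. A \<in> SL (n + 1) \<and> c \<noteq> 0 \<and> conj_act n A q = scale c q'"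
    proof (rule ccontr)
      assume no: "\<not> (\<exists>A c. A \<in> SL (n + 1) \<and> c \<noteq> 0 \<and> conj_act n A q = scale c q')"
      show False
      proof (rule orbit_separation[OF q(1,2) q't nz' d(1)])
        show "conj_act n A q \<noteq> scale c q'" if "A \<in> SL (n + 1)" "c \<noteq> 0" for A c
          using no that by blast
        show False if "H \<in> forms (coords n d) s" "eval_coords H q' \<noteq> 0"
          "\<And>A. A \<in> SL (n + 1) \<Longrightarrow> eval_coords H (conj_act n A q) = 0" for s H
          using that vanish by blast
      qed
    qed
    then obtain A c where "A \<in> SL (n + 1)" "c \<noteq> 0" "conj_act n A q = scale c q'" by blast
    then show "\<psi> \<in> orbit n \<phi>"
      unfolding orbit q'(2) using tuple_class_eq[of c q'] by (intro CollectI exI[of _ A]) simp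
  qed
  ultimately have "orbit n \<phi> = Z \<inter> semistable_locus n d" by blast
  moreover have "finite (stabilizer n \<phi>)"
    unfolding q(3) by (rule finite_stabilizer[OF q(1,2) d(1)])
  ultimately show "\<phi> \<in> stable_locus n d"
    unfolding stable_locus_def using Z ss[OF q(1,2)] q(3) by blast
qed

end
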